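(* There is an algorithm that, given a tree $T$ on $n$ vertices, determines in $O(n^2)$ time whether $T$ is P1-win or P2-win in Trail Trap.
   Context: Trail Trap on a finite simple undirected graph $G$: Player 1 (P1) chooses a vertex, places a token on it and moves it along an incident edge $e$ to the other endpoint. Player 2 (P2) then places their own token on any vertex and moves it along an incident edge $f \neq e$. Thereafter the players alternate, starting with P1, each moving their own token from its current vertex along an unused edge (an edge not previously traversed, in either direction, by either player) to the adjacent vertex; vertices may be revisited and the two tokens may share a vertex. The first player unable to move loses. $G$ is P1-win if P1 has a winning strategy, and P2-win otherwise (exactly one holds). *)

theory Defs
  imports Complex_Main "HOL-Library.Landau_Symbols"
begin

section \<open>Finite simple graphs and trees\<close>

definition simple_graph :: "'a set \<Rightarrow> 'a set set \<Rightarrow> bool" where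
  "simple_graph V E \<longleftrightarrow> finite V \<and> (\<forall>e\<in>E. e \<subseteq> V \<and> card e = 2)"

definition connected_graph :: "'a set \<Rightarrow> 'a set set \<Rightarrow> bool" where
  "connected_graph V E \<longleftrightarrow> V \<noteq> {} \<and> (\<forall>u\<in>V. \<forall>v\<in>V. (u, v) \<in> {(x, y). {x, y} \<in> E}\<^sup>*)"

definition cycle :: "'a set set \<Rightarrow> 'a list \<Rightarrow> bool" where
  "cycle E p \<longleftrightarrow> 3 \<le> length p \<and> distinct p \<and>
     (\<forall>i. Suc i < length p \<longrightarrow> {p ! i, p ! Suc i} \<in> E) \<and> {last p, hd p} \<in> E"

definition tree :: "'a set \<Rightarrow> 'a set set \<Rightarrow> bool" where
  "tree V E \<longleftrightarrow> simple_graph V E \<and> connected_graph V E \<and> (\<nexists>p. cycle E p)"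


section \<open>Trail Trap\<close>

text \<open>
  A move \<open>(u, v)\<close> carries a token from \<open>u\<close> to \<open>v\<close> along the edge \<open>{u, v}\<close>. A history lists all
  moves made so far, oldest first; the moves with even index are those of P1. In a player's
  first move (index 0 or 1) the start vertex \<open>u\<close> is the vertex on which the token is placed;
  later, \<open>u\<close> is the vertex reached by the same player's previous move. Placing a token on a
  vertex without an unused incident edge loses at once and is not recorded as a move.
\<close>

type_synonym 'a move = "'a \<times> 'a"

fun edge_of :: "'a move \<Rightarrow> 'a set" where
  "edge_of (u, v) = {u, v}"

definition legal :: "'a set set \<Rightarrow> 'a move list \<Rightarrow> 'a move \<Rightarrow> bool" where
  "legal E h m \<longleftrightarrow> edge_of m \<in> E \<and> edge_of m \<notin> edge_of ` set h \<and>
     (2 \<le> length h \<longrightarrow> fst m = snd (h ! (length h - 2)))"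

inductive play :: "'a set set \<Rightarrow> 'a move list \<Rightarrow> bool" for E where
  play_Nil: "play E []"
| play_snoc: "play E h \<Longrightarrow> legal E h m \<Longrightarrow> play E (h @ [m])"

definition stuck :: "'a set set \<Rightarrow> 'a move list \<Rightarrow> bool" where
  "stuck E h \<longleftrightarrow> (\<nexists>m. legal E h m)"

text \<open>A P1-strategy is a function from histories; only its values at even length matter.\<close>

definition follows :: "('a move list \<Rightarrow> 'a move) \<Rightarrow> 'a move list \<Rightarrow> bool" where
  "follows \<sigma> h \<longleftrightarrow> (\<forall>i<length h. even i \<longrightarrow> h ! i = \<sigma> (take i h))"

definition P1_strategy :: "'a set set \<Rightarrow> ('a move list \<Rightarrow> 'a move) \<Rightarrow> bool" where
  "P1_strategy E \<sigma> \<longleftrightarrow>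
     (\<forall>h. play E h \<and> follows \<sigma> h \<and> even (length h) \<and> \<not> stuck E h \<longrightarrow> legal E h (\<sigma> h))"

text \<open>A completed play is lost by the player to move, so P1 wins it iff its length is odd.\<close>

definition P1_winning_strategy :: "'a set set \<Rightarrow> ('a move list \<Rightarrow> 'a move) \<Rightarrow> bool" where
  "P1_winning_strategy E \<sigma> \<longleftrightarrow> P1_strategy E \<sigma> \<and>
     (\<forall>h. play E h \<and> follows \<sigma> h \<and> stuck E h \<longrightarrow> odd (length h))"

definition P1_win :: "'a set set \<Rightarrow> bool" where
  "P1_win E \<longleftrightarrow> (\<exists>\<sigma>. P1_winning_strategy E \<sigma>)"

definition P2_win :: "'a set set \<Rightarrow> bool" where
  "P2_win E \<longleftrightarrow> \<not> P1_win E"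


section \<open>Algorithms: programs on a word RAM\<close>

text \<open>
  Programs are while-programs over finitely many registers and random-access arrays of natural
  numbers. Every operation costs one unit of time. Words are bounded: \<open>W\<close> is the largest value a
  word can hold, and a program that computes a larger value (also as an intermediate result or as
  an array index) has no execution. Hence numbers cannot grow without being charged for.
\<close>

datatype aexp =
    Const nat
  | Reg nat
  | Read nat aexp  \<comment> \<open>\<open>Read a i\<close>: entry \<open>i\<close> of array \<open>a\<close>\<close>
  | Plus aexp aexp
  | Minus aexp aexp  \<comment> \<open>truncated subtraction\<close>
  | Times aexp aexp

datatype bexp = Less aexp aexp | Equal aexp aexp | Neg bexp | Conj bexp bexp

datatype com =
    Skip
  | Assign nat aexp
  | Write nat aexp aexp  \<comment> \<open>\<open>Write a i e\<close>: entry \<open>i\<close> of array \<open>a\<close> becomes \<open>e\<close>\<close>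
  | Seq com com
  | If bexp com com
  | While bexp com

record state =
  reg :: "nat \<Rightarrow> nat"
  arr :: "nat \<Rightarrow> nat \<Rightarrow> nat"

fun aval :: "aexp \<Rightarrow> state \<Rightarrow> nat" where
  "aval (Const k) s = k"
| "aval (Reg x) s = reg s x"
| "aval (Read a i) s = arr s a (aval i s)"
| "aval (Plus e f) s = aval e s + aval f s"
| "aval (Minus e f) s = aval e s - aval f s"
| "aval (Times e f) s = aval e s * aval f s"

fun bval :: "bexp \<Rightarrow> state \<Rightarrow> bool" where
  "bval (Less e f) s = (aval e s < aval f s)"
| "bval (Equal e f) s = (aval e s = aval f s)"
| "bval (Neg b) s = (\<not> bval b s)"
| "bval (Conj b c) s = (bval b s \<and> bval c s)"

fun afits :: "nat \<Rightarrow> aexp \<Rightarrow> state \<Rightarrow> bool" where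
  "afits W (Const k) s = (k \<le> W)"
| "afits W (Reg x) s = (reg s x \<le> W)"
| "afits W (Read a i) s = (afits W i s \<and> arr s a (aval i s) \<le> W)"
| "afits W (Plus e f) s = (afits W e s \<and> afits W f s \<and> aval e s + aval f s \<le> W)"
| "afits W (Minus e f) s = (afits W e s \<and> afits W f s)"
| "afits W (Times e f) s = (afits W e s \<and> afits W f s \<and> aval e s * aval f s \<le> W)"

fun bfits :: "nat \<Rightarrow> bexp \<Rightarrow> state \<Rightarrow> bool" where
  "bfits W (Less e f) s = (afits W e s \<and> afits W f s)"
| "bfits W (Equal e f) s = (afits W e s \<and> afits W f s)"
| "bfits W (Neg b) s = bfits W b s"
| "bfits W (Conj b c) s = (bfits W b s \<and> bfits W c s)"

fun acost :: "aexp \<Rightarrow> nat" where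
  "acost (Const k) = 1"
| "acost (Reg x) = 1"
| "acost (Read a i) = acost i + 1"
| "acost (Plus e f) = acost e + acost f + 1"
| "acost (Minus e f) = acost e + acost f + 1"
| "acost (Times e f) = acost e + acost f + 1"

fun bcost :: "bexp \<Rightarrow> nat" where
  "bcost (Less e f) = acost e + acost f + 1"
| "bcost (Equal e f) = acost e + acost f + 1"
| "bcost (Neg b) = bcost b + 1"
| "bcost (Conj b c) = bcost b + bcost c + 1"

text \<open>\<open>exec W c s t s'\<close>: with words bounded by \<open>W\<close>, program \<open>c\<close> started in state \<open>s\<close> halts in
  state \<open>s'\<close> after time exactly \<open>t\<close>.\<close>

inductive exec :: "nat \<Rightarrow> com \<Rightarrow> state \<Rightarrow> nat \<Rightarrow> state \<Rightarrow> bool" for W where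
  exec_Skip: "exec W Skip s 1 s"
| exec_Assign: "afits W e s \<Longrightarrow>
    exec W (Assign x e) s (acost e + 1) (s\<lparr>reg := (reg s)(x := aval e s)\<rparr>)"
| exec_Write: "afits W i s \<Longrightarrow> afits W e s \<Longrightarrow>
    exec W (Write a i e) s (acost i + acost e + 1)
      (s\<lparr>arr := (arr s)(a := (arr s a)(aval i s := aval e s))\<rparr>)"
| exec_Seq: "exec W c s t s' \<Longrightarrow> exec W d s' t' s'' \<Longrightarrow> exec W (Seq c d) s (t + t') s''"
| exec_IfTrue: "bfits W b s \<Longrightarrow> bval b s \<Longrightarrow> exec W c s t s' \<Longrightarrow>
    exec W (If b c d) s (bcost b + t + 1) s'"
| exec_IfFalse: "bfits W b s \<Longrightarrow> \<not> bval b s \<Longrightarrow> exec W d s t s' \<Longrightarrow>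
    exec W (If b c d) s (bcost b + t + 1) s'"
| exec_WhileFalse: "bfits W b s \<Longrightarrow> \<not> bval b s \<Longrightarrow> exec W (While b c) s (bcost b + 1) s"
| exec_WhileTrue: "bfits W b s \<Longrightarrow> bval b s \<Longrightarrow> exec W c s t s' \<Longrightarrow>
    exec W (While b c) s' t' s'' \<Longrightarrow> exec W (While b c) s (bcost b + t + t' + 1) s''"

inductive_cases exec_SkipE: "exec W Skip s t s'"
inductive_cases exec_AssignE: "exec W (Assign x e) s t s'"
inductive_cases exec_WriteE: "exec W (Write a i e) s t s'"
inductive_cases exec_SeqE: "exec W (Seq c d) s t s'"
inductive_cases exec_IfE: "exec W (If b c d) s t s'"
inductive_cases exec_WhileE: "exec W (While b c) s t s'"

lemma exec_deterministic:
  "exec W c s t s' \<Longrightarrow> exec W c s u s'' \<Longrightarrow> u = t \<and> s'' = s'"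
proof (induction arbitrary: u s'' rule: exec.induct)
  case (exec_Seq c s t s' d t' s2)
  from exec_Seq.prems show ?case
  proof (rule exec_SeqE)
    fix t1 s1 t2
    assume u: "u = t1 + t2" and c: "exec W c s t1 s1" and d: "exec W d s1 t2 s''"
    have 1: "t1 = t \<and> s1 = s'" by (rule exec_Seq.IH(1)[OF c])
    with d have "exec W d s' t2 s''" by simp
    from exec_Seq.IH(2)[OF this] 1 u show ?thesis by simp
  qed
next
  case (exec_IfTrue b s c t s' d)
  from exec_IfTrue.prems show ?case
  proof (rule exec_IfE)
    fix t1
    assume u: "u = Suc (bcost b + t1)" and c: "exec W c s t1 s''"
    from exec_IfTrue.IH[OF c] u show ?thesis by simp
  qed (use exec_IfTrue.hyps in simp)
next
  case (exec_IfFalse b s d t s' c)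
  from exec_IfFalse.prems show ?case
  proof (rule exec_IfE)
    fix t1
    assume u: "u = Suc (bcost b + t1)" and d: "exec W d s t1 s''"
    from exec_IfFalse.IH[OF d] u show ?thesis by simp
  qed (use exec_IfFalse.hyps in simp)
next
  case (exec_WhileTrue b s c t s' t' s2)
  from exec_WhileTrue.prems show ?case
  proof (rule exec_WhileE)
    fix t1 s1 t2
    assume u: "u = Suc (bcost b + t1 + t2)" and c: "exec W c s t1 s1"
      and w: "exec W (While b c) s1 t2 s''"
    have 1: "t1 = t \<and> s1 = s'" by (rule exec_WhileTrue.IH(1)[OF c])
    with w have "exec W (While b c) s' t2 s''" by simp
    from exec_WhileTrue.IH(2)[OF this] 1 u show ?thesis by simp
  qed (use exec_WhileTrue.hyps in simp)
qed (auto elim: exec_SkipE exec_AssignE exec_WriteE exec_WhileE)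


section \<open>Input format\<close>

text \<open>
  A graph on the vertices \<open>0, \<dots>, n - 1\<close> is given as a list of its edges, in any order and with
  the end vertices of each edge in any order, without repetition. Register 0 contains \<open>n\<close>,
  register 1 the number of edges, and arrays 0 and 1 the first and second end vertices.
\<close>

definition edge_list :: "('a \<times> 'a) list \<Rightarrow> 'a set set \<Rightarrow> bool" where
  "edge_list es E \<longleftrightarrow> distinct (map edge_of es) \<and> edge_of ` set es = E"

definition input_state :: "nat \<Rightarrow> (nat \<times> nat) list \<Rightarrow> state" where
  "input_state n es =
     \<lparr>reg = (\<lambda>x. if x = 0 then n else if x = 1 then length es else 0),
      arr = (\<lambda>a i. if i < length es
                    then if a = 0 then fst (es ! i) else if a = 1 then snd (es ! i) else 0
                    else 0)\<rparr>"

end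

(*
  In a tree every pair of distinct first-move edges consists of the end edges {s, v}, {t, y} of a
  path s, v, ..., y, t. Unless both tokens move inwards, they are then in different components
  and the player with the longer remaining path wins. If both move inwards, they walk towards
  each other; as soon as one leaves the path, the tokens are separated, so it is best to leave
  along the longest side branch. This gives a recursion over pairs (s, t), that is, over O(n^2)
  positions, each needing O(1) time once the four longest branches at every vertex are known.
  The pairs are processed in the order in which the vertices are attached to a growing subtree,
  which makes all pairs on the inner part of a path available in time.

  The algorithm is a program in a small language whose loops run over 0, ..., n - 1, so that its
  cost and the size of its numbers are evident from its text.
*)
theory Submission
  imports Defs
begin

section \<open>For-programs\<close>

text \<open>The tree is given once and for all by the table \<open>nxt\<close> of first steps: an
  edge \<open>{p, q}\<close> splits the vertices according to whether \<open>nxt p z = q\<close>,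
  and a component of the remaining forest consists of the vertices on the same side of every used
  edge. The same tables are computed by the program, and attaching a leaf adds only one row and one
  column to them; so the memory of the program itself satisfies the axioms of the abstract tree.

  A tie goes against the player to move, which decides between strict and weak inequalities
  throughout. Four branches per vertex are enough because at most three directions are excluded at
  \<open>v\<close>: back to \<open>s\<close>, onwards to \<open>t\<close>, and the best side branch
  when the second best is wanted.

  Pairs are ordered, since \<open>(s, t)\<close> and \<open>(t, s)\<close> differ in the player to
  move. A path may be shortened only at an end where this leads to a pair already treated; hence the
  inner path length has one recursion for each end.\<close>

datatype ex = Zero | One | R nat | T nat ex ex | Add ex ex | Sub ex ex

datatype bx = Lt ex ex | Eq ex ex | Ng bx | An bx bx

datatype pg = Nop | Set nat ex | Put nat ex ex ex | Sq pg pg | Cnd bx pg pg | For nat pg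

type_synonym mem = "(nat \<Rightarrow> nat) \<times> (nat \<Rightarrow> nat \<Rightarrow> nat \<Rightarrow> nat)"

text \<open>Sums are cut off at \<open>n + 1\<close>, so that all values stay small whatever the program does.\<close>

fun ev :: "nat \<Rightarrow> ex \<Rightarrow> mem \<Rightarrow> nat" where
  "ev n Zero m = 0"
| "ev n One m = 1"
| "ev n (R x) m = fst m x"
| "ev n (T a i j) m = snd m a (ev n i m) (ev n j m)"
| "ev n (Add e f) m = min (ev n e m + ev n f m) (n + 1)"
| "ev n (Sub e f) m = ev n e m - ev n f m"

fun bv :: "nat \<Rightarrow> bx \<Rightarrow> mem \<Rightarrow> bool" where
  "bv n (Lt e f) m = (ev n e m < ev n f m)"
| "bv n (Eq e f) m = (ev n e m = ev n f m)"
| "bv n (Ng b) m = (\<not> bv n b m)"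
| "bv n (An b c) m = (bv n b m \<and> bv n c m)"

definition setr :: "nat \<Rightarrow> nat \<Rightarrow> mem \<Rightarrow> mem" where
  "setr x v m = ((fst m)(x := v), snd m)"

definition putt :: "nat \<Rightarrow> nat \<Rightarrow> nat \<Rightarrow> nat \<Rightarrow> mem \<Rightarrow> mem" where
  "putt a i j v m = (fst m, (snd m)(a := (snd m a)(i := (snd m a i)(j := v))))"

lemma fst_setr [simp]: "fst (setr x v m) = (fst m)(x := v)"
  and snd_setr [simp]: "snd (setr x v m) = snd m"
  and fst_putt [simp]: "fst (putt a i j v m) = fst m"
  and snd_putt [simp]: "snd (putt a i j v m) = (snd m)(a := (snd m a)(i := (snd m a i)(j := v)))"
  by (simp_all add: setr_def putt_def)

text \<open>The final \<open>setr x n\<close> of a loop imitates the translated while loop, which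
  stops with its counter at \<open>n\<close>; memory and machine state then agree exactly, counters
  included.\<close>

fun run :: "nat \<Rightarrow> pg \<Rightarrow> mem \<Rightarrow> mem" where
  "run n Nop m = m"
| "run n (Set x e) m = setr x (ev n e m) m"
| "run n (Put a i j e) m = putt a (ev n i m) (ev n j m) (ev n e m) m"
| "run n (Sq p q) m = run n q (run n p m)"
| "run n (Cnd b p q) m = (if bv n b m then run n p m else run n q m)"
| "run n (For x p) m = setr x n (fold (\<lambda>i m. run n p (setr x i m)) [0..<n] m)"

fun wr :: "pg \<Rightarrow> nat set" where
  "wr (Set x e) = {x}"
| "wr (Sq p q) = wr p \<union> wr q"
| "wr (Cnd b p q) = wr p \<union> wr q"
| "wr (For x p) = insert x (wr p)"
| "wr _ = {}"

fun wt :: "pg \<Rightarrow> nat set" where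
  "wt (Put a i j e) = {a}"
| "wt (Sq p q) = wt p \<union> wt q"
| "wt (Cnd b p q) = wt p \<union> wt q"
| "wt (For x p) = wt p"
| "wt _ = {}"

text \<open>Register 0 holds \<open>n\<close>, on which the loop bounds, the cut-off and the layout
  of the tables depend, so it must not be overwritten. A loop body may not write its own counter,
  because the translated loop increments whatever it finds there.\<close>

fun wellf :: "pg \<Rightarrow> bool" where
  "wellf (Set x e) = (x \<noteq> 0)"
| "wellf (Sq p q) = (wellf p \<and> wellf q)"
| "wellf (Cnd b p q) = (wellf p \<and> wellf q)"
| "wellf (For x p) = (x \<noteq> 0 \<and> x \<notin> wr p \<and> wellf p)"
| "wellf _ = True"

lemma fold_invariant_upt:
  assumes "I 0 m" "\<And>i m. i < n \<Longrightarrow> I i m \<Longrightarrow> I (Suc i) (f i m)"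
  shows "I n (fold f [0..<n] m)"
  using assms by (induction n) auto

lemma run_frame_reg: "x \<notin> wr p \<Longrightarrow> fst (run n p m) x = fst m x"
proof (induction p arbitrary: m)
  case (For y p)
  have "fst (fold (\<lambda>i m. run n p (setr y i m)) [0..<n] m) x = fst m x"
    by (rule fold_invariant_upt) (use For in auto)
  then show ?case using For.prems by simp
qed auto

lemma run_frame_tab: "a \<notin> wt p \<Longrightarrow> snd (run n p m) a = snd m a"
proof (induction p arbitrary: m)
  case (For y p)
  have "snd (fold (\<lambda>i m. run n p (setr y i m)) [0..<n] m) a = snd m a"
    by (rule fold_invariant_upt) (use For in auto)
  then show ?case by simp
qed auto

lemma run_For:
  assumes "I 0 m"
    and "\<And>i m. i < n \<Longrightarrow> I i m \<Longrightarrow> I (Suc i) (run n p (setr x i m))"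
    and "\<And>m. I n m \<Longrightarrow> Q (setr x n m)"
  shows "Q (run n (For x p) m)"
  using fold_invariant_upt[of I m n "\<lambda>i m. run n p (setr x i m)"] assms by auto


subsection \<open>Translation to the word RAM\<close>

text \<open>Since subtraction is truncated, \<open>e - (e - k)\<close> is the minimum of
  \<open>e\<close> and \<open>k\<close>; the cut-off needs no branching.\<close>

definition clamp :: "aexp \<Rightarrow> aexp" where
  "clamp e = Minus e (Minus e (Plus (Reg 0) (Const 1)))"

text \<open>Indices, like all values, are at most \<open>n + 1\<close>, so rows of length
  \<open>n + 2\<close> do not overlap. Row 0 of a table is the beginning of its array, whence the
  input arrays need no conversion.\<close>

definition idx :: "aexp \<Rightarrow> aexp \<Rightarrow> aexp" where
  "idx i j = Plus (Times i (Plus (Reg 0) (Const 2))) j"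

fun ce :: "ex \<Rightarrow> aexp" where
  "ce Zero = Const 0"
| "ce One = Const 1"
| "ce (R x) = Reg x"
| "ce (T a i j) = Read a (idx (ce i) (ce j))"
| "ce (Add e f) = clamp (Plus (ce e) (ce f))"
| "ce (Sub e f) = Minus (ce e) (ce f)"

fun cb :: "bx \<Rightarrow> bexp" where
  "cb (Lt e f) = Less (ce e) (ce f)"
| "cb (Eq e f) = Equal (ce e) (ce f)"
| "cb (Ng b) = Neg (cb b)"
| "cb (An b c) = Conj (cb b) (cb c)"

fun cp :: "pg \<Rightarrow> com" where
  "cp Nop = Skip"
| "cp (Set x e) = Assign x (ce e)"
| "cp (Put a i j e) = Write a (idx (ce i) (ce j)) (ce e)"
| "cp (Sq p q) = Seq (cp p) (cp q)"
| "cp (Cnd b p q) = If (cb b) (cp p) (cp q)"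
| "cp (For x p) = Seq (Assign x (Const 0))
     (While (Less (Reg x) (Reg 0)) (Seq (cp p) (Assign x (Plus (Reg x) (Const 1)))))"

text \<open>An upper bound read off from the text: both branches of a conditional are charged. In a
  loop, 6 is the initialisation (2) plus the last, failing test (4), and 8 is one successful test
  (4) plus the increment (4).\<close>

fun cost :: "nat \<Rightarrow> pg \<Rightarrow> nat" where
  "cost n Nop = 1"
| "cost n (Set x e) = acost (ce e) + 1"
| "cost n (Put a i j e) = acost (idx (ce i) (ce j)) + acost (ce e) + 1"
| "cost n (Sq p q) = cost n p + cost n q"
| "cost n (Cnd b p q) = bcost (cb b) + cost n p + cost n q + 1"
| "cost n (For x p) = 6 + n * (cost n p + 8)"

text \<open>The bounds on all values belong to the relation because they keep every computed index
  within the range in which tables and arrays are required to agree.\<close>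

definition repr :: "nat \<Rightarrow> mem \<Rightarrow> state \<Rightarrow> bool" where
  "repr n m s \<longleftrightarrow> reg s = fst m \<and> fst m 0 = n \<and> (\<forall>x. fst m x \<le> n + 1) \<and>
     (\<forall>a i j. snd m a i j \<le> n + 1) \<and>
     (\<forall>a i j. i \<le> n + 1 \<longrightarrow> j \<le> n + 1 \<longrightarrow> arr s a (i * (n + 2) + j) = snd m a i j)"

lemma ev_le: "repr n m s \<Longrightarrow> ev n e m \<le> n + 1"
proof (induction e)
  case (Sub e f)
  then show ?case using le_trans[OF diff_le_self] by simp
qed (simp_all add: repr_def)

lemma index_le:
  fixes i j n W :: nat
  assumes "i \<le> n + 1" "j \<le> n + 1" "(n + 2)\<^sup>2 \<le> W"
  shows "i * (n + 2) + j \<le> W"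
proof -
  have "i * (n + 2) + j \<le> (n + 1) * (n + 2) + (n + 1)"
    using assms by (intro add_mono mult_right_mono) auto
  also have "\<dots> \<le> (n + 2)\<^sup>2" by (simp add: power2_eq_square)
  finally show ?thesis using assms by simp
qed

lemma index_inject:
  assumes "j < (k::nat)" "j' < k"
  shows "i * k + j = i' * k + j' \<longleftrightarrow> i = i' \<and> j = j'"
proof -
  have "(i * k + j) div k = i" "(i * k + j) mod k = j" if "j < k" for i j
    using that by auto
  then show ?thesis using assms by metis
qed

text \<open>Two values of at most \<open>n + 1\<close> are added before the cut-off takes effect,
  and this intermediate sum must fit into a word as well.\<close>

lemma small_le: "(n + 2)\<^sup>2 \<le> W \<Longrightarrow> k \<le> 2 * n + 4 \<Longrightarrow> k \<le> (W::nat)"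
  by (simp add: power2_eq_square)

lemma ce_correct:
  assumes "repr n m s" "(n + 2)\<^sup>2 \<le> W"
  shows "aval (ce e) s = ev n e m \<and> afits W (ce e) s"
proof (induction e)
  case (T a i j)
  have le: "ev n i m \<le> n + 1" "ev n j m \<le> n + 1" "snd m a (ev n i m) (ev n j m) \<le> n + 1"
    using ev_le[OF assms(1)] assms(1) by (simp_all add: repr_def)
  have W: "n + 2 \<le> W" "n + 1 \<le> W" "n \<le> W" "2 \<le> W"
    using small_le[OF assms(2)] by simp_all
  have "snd m a (ev n i m) (ev n j m) \<le> W" using le W by linarith
  moreover have "ev n i m * (n + 2) + ev n j m \<le> W" by (rule index_le) (use le assms in auto)
  moreover have "arr s a (ev n i m * (n + 2) + ev n j m) = snd m a (ev n i m) (ev n j m)" "reg s 0 = n"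
    using assms(1) le by (auto simp: repr_def simp del: mult_Suc_right add_2_eq_Suc')
  ultimately show ?case using T W by (simp add: idx_def del: mult_Suc_right add_2_eq_Suc')
next
  case (Add e f)
  have le: "ev n e m \<le> n + 1" "ev n f m \<le> n + 1" using assms ev_le by auto
  then have W: "ev n e m + ev n f m \<le> W" "1 \<le> W" "n \<le> W" "n + 1 \<le> W"
    using small_le[OF assms(2)] by simp_all
  show ?case using Add W assms(1) by (auto simp: repr_def clamp_def min_def)
next
  case (R x)
  have "fst m x \<le> n + 1" using assms(1) by (simp add: repr_def)
  then have "fst m x \<le> W" using small_le[OF assms(2), of "fst m x"] by simp
  then show ?case using assms(1) by (simp add: repr_def)
qed (use small_le[OF assms(2)] in simp_all)

lemma cb_correct:
  assumes "repr n m s" "(n + 2)\<^sup>2 \<le> W"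
  shows "bval (cb b) s = bv n b m \<and> bfits W (cb b) s"
  by (induction b) (simp_all add: ce_correct[OF assms])

lemma repr_setr:
  assumes "repr n m s" "x \<noteq> 0" "v \<le> n + 1"
  shows "repr n (setr x v m) (s\<lparr>reg := (reg s)(x := v)\<rparr>)"
  using assms by (auto simp: repr_def)

lemma repr_putt:
  assumes "repr n m s" "i \<le> n + 1" "j \<le> n + 1" "v \<le> n + 1"
  shows "repr n (putt a i j v m) (s\<lparr>arr := (arr s)(a := (arr s a)(i * (n + 2) + j := v))\<rparr>)"
  using assms index_inject[of _ "n + 2"] by (auto simp: repr_def simp del: mult_Suc_right add_2_eq_Suc')

text \<open>One simulation by induction on the syntax settles word size and time for every
  well-formed program, so that afterwards only the values computed by \<open>run\<close> have to be
  studied.\<close>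

lemma cp_correct:
  assumes "wellf p" "repr n m s" "(n + 2)\<^sup>2 \<le> W"
  shows "\<exists>t s'. exec W (cp p) s t s' \<and> t \<le> cost n p \<and> repr n (run n p m) s'"
  using assms(1,2)
proof (induction p arbitrary: m s)
  case Nop
  then show ?case using exec_Skip by fastforce
next
  case (Set x e)
  note ce = ce_correct[OF Set(2) assms(3), of e]
  show ?case
    using exec_Assign[of W "ce e" s x] ce repr_setr[OF Set(2), of x] ev_le[OF Set(2)] Set(1) by fastforce
next
  case (Put a i j e)
  note ce = ce_correct[OF Put(2) assms(3)]
  have le: "ev n i m \<le> n + 1" "ev n j m \<le> n + 1" "ev n e m \<le> n + 1"
    using ev_le[OF Put(2)] by auto
  have W: "n + 2 \<le> W" "n \<le> W" "2 \<le> W"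
    using small_le[OF assms(3)] by simp_all
  have "ev n i m * (n + 2) + ev n j m \<le> W" by (rule index_le) (use le assms in auto)
  moreover have "ev n i m * (n + 2) \<le> W" using calculation by linarith
  moreover have r: "reg s 0 = n" using Put by (simp add: repr_def)
  ultimately have "afits W (idx (ce i) (ce j)) s" using W ce
    by (simp add: idx_def del: mult_Suc_right add_2_eq_Suc')
  from exec_Write[OF this, of "ce e" a] ce
  have "exec W (cp (Put a i j e)) s (cost n (Put a i j e))
     (s\<lparr>arr := (arr s)(a := (arr s a)(ev n i m * (n + 2) + ev n j m := ev n e m))\<rparr>)"
    using r by (simp add: idx_def del: mult_Suc_right add_2_eq_Suc')
  then show ?case using repr_putt[OF Put(2) le, of a] by (metis run.simps(3) order_refl)
next
  case (Sq p q)
  from Sq.IH(1)[OF _ Sq.prems(2)] Sq.prems obtain t s' where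
    1: "exec W (cp p) s t s'" "t \<le> cost n p" "repr n (run n p m) s'" by auto
  from Sq.IH(2)[OF _ 1(3)] Sq.prems obtain t' s'' where
    2: "exec W (cp q) s' t' s''" "t' \<le> cost n q" "repr n (run n q (run n p m)) s''" by auto
  show ?case using exec_Seq[OF 1(1) 2(1)] 1 2 by (auto intro!: exI)
next
  case (Cnd b p q)
  note cb = cb_correct[OF Cnd.prems(2) assms(3), of b]
  show ?case
  proof (cases "bv n b m")
    case True
    from Cnd.IH(1)[OF _ Cnd.prems(2)] Cnd.prems obtain t s' where
      1: "exec W (cp p) s t s'" "t \<le> cost n p" "repr n (run n p m) s'" by auto
    show ?thesis using exec_IfTrue[OF _ _ 1(1)] cb True 1
      by (intro exI[of _ "bcost (cb b) + t + 1"] exI[of _ s']) auto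
  next
    case False
    from Cnd.IH(2)[OF _ Cnd.prems(2)] Cnd.prems obtain t s' where
      1: "exec W (cp q) s t s'" "t \<le> cost n q" "repr n (run n q m) s'" by auto
    show ?thesis using exec_IfFalse[OF _ _ 1(1)] cb False 1
      by (intro exI[of _ "bcost (cb b) + t + 1"] exI[of _ s']) auto
  qed
next
  case (For x p)
  define f where "f = (\<lambda>i m. run n p (setr x i m))"
  define w where "w = While (Less (Reg x) (Reg 0)) (Seq (cp p) (Assign x (Plus (Reg x) (Const 1))))"
  have x: "x \<noteq> 0" "x \<notin> wr p" "wellf p" using For.prems by auto
  have W: "n + 2 \<le> W" "n + 1 \<le> W" using small_le[OF assms(3)] by simp_all
  \<comment> \<open>The induction is on the number \<open>k\<close> of iterations still to come: the
    rule for \<open>While\<close> peels off the first iteration, which matches the step from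
    \<open>Suc k\<close> to \<open>k\<close>.\<close>
  have loop: "\<exists>t s'. exec W w s t s' \<and> t \<le> 4 + k * (cost n p + 8) \<and>
     repr n (setr x n (fold f [n - k..<n] m)) s'"
    if "k \<le> n" "repr n (setr x (n - k) m) s" for k m s
    using that
  proof (induction k arbitrary: m s)
    case 0
    then have "reg s x = n" "reg s 0 = n" using x(1) by (auto simp: repr_def)
    then have "exec W w s 4 s"
      using W exec_WhileFalse[of W "Less (Reg x) (Reg 0)" s] by (simp add: w_def eval_nat_numeral)
    then show ?case using 0 by auto
  next
    case (Suc k)
    let ?m = "run n p (setr x (n - Suc k) m)"
    have r: "reg s x = n - Suc k" "reg s 0 = n" using Suc.prems(2) x(1) by (auto simp: repr_def)
    from For.IH[OF x(3) Suc.prems(2)] obtain t s' where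
      1: "exec W (cp p) s t s'" "t \<le> cost n p" "repr n ?m s'" by auto
    have "fst ?m x = n - Suc k" using run_frame_reg[OF x(2)] by simp
    then have rx: "reg s' x = n - Suc k" using 1(3) by (simp add: repr_def)
    let ?s = "s'\<lparr>reg := (reg s')(x := n - k)\<rparr>"
    have "n - Suc k \<le> W" "n - k \<le> W" using W by linarith+
    then have "exec W (Assign x (Plus (Reg x) (Const 1))) s' 4 ?s"
      using exec_Assign[of W "Plus (Reg x) (Const 1)" s' x] rx Suc.prems(1) W
      by (simp add: Suc_diff_Suc eval_nat_numeral)
    then have 2: "exec W (Seq (cp p) (Assign x (Plus (Reg x) (Const 1)))) s (t + 4) ?s"
      by (rule exec_Seq[OF 1(1)])
    have "repr n (setr x (n - k) ?m) ?s" by (rule repr_setr[OF 1(3) x(1)]) simp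
    from Suc.IH[OF _ this] Suc.prems obtain t' s'' where
      3: "exec W w ?s t' s''" "t' \<le> 4 + k * (cost n p + 8)"
        "repr n (setr x n (fold f [n - k..<n] ?m)) s''" by auto
    have "exec W w s (3 + (t + 4) + t' + 1) s''"
      using exec_WhileTrue[of W "Less (Reg x) (Reg 0)" s _ _ _ t' s'', OF _ _ 2] 3(1) r W Suc.prems
      by (simp add: w_def)
    moreover have "[n - Suc k..<n] = (n - Suc k) # [n - k..<n]"
      using Suc.prems(1) by (simp add: upt_conv_Cons Suc_diff_Suc)
    then have "fold f [n - Suc k..<n] m = fold f [n - k..<n] ?m" by (simp add: f_def)
    ultimately show ?case using 3 1(2) by (intro exI[of _ "3 + (t + 4) + t' + 1"] exI[of _ s'']) auto
  qed
  let ?s = "s\<lparr>reg := (reg s)(x := 0)\<rparr>"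
  have a: "exec W (Assign x (Const 0)) s 2 ?s" using exec_Assign[of W "Const 0" s x]
    by (simp add: eval_nat_numeral)
  have "repr n (setr x (n - n) m) ?s" using repr_setr[OF For.prems(2) x(1), of 0] by simp
  from loop[OF order_refl this] obtain t s' where
    "exec W w ?s t s'" "t \<le> 4 + n * (cost n p + 8)" "repr n (setr x n (fold f [0..<n] m)) s'"
    by auto
  then show ?case using exec_Seq[OF a, of w t s']
    by (intro exI[of _ "2 + t"] exI[of _ s']) (auto simp: w_def f_def)
qed

section \<open>Loop nesting and polynomial running time\<close>

fun depth :: "pg \<Rightarrow> nat" where
  "depth (Sq p q) = max (depth p) (depth q)"
| "depth (Cnd b p q) = max (depth p) (depth q)"
| "depth (For x p) = Suc (depth p)"
| "depth _ = 0"

text \<open>Code without loops has constant cost, so only the nesting of loops contributes to the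
  exponent.\<close>

lemma cost_bound: "depth p \<le> k \<Longrightarrow> \<exists>C. \<forall>n. cost n p \<le> C * (n + 1) ^ k"
proof (induction p arbitrary: k)
  case (Sq p q)
  then obtain C D where "\<forall>n. cost n p \<le> C * (n + 1) ^ k" "\<forall>n. cost n q \<le> D * (n + 1) ^ k" by force
  then have "\<forall>n. cost n (Sq p q) \<le> (C + D) * (n + 1) ^ k" by (auto simp: algebra_simps intro: add_mono)
  then show ?case by blast
next
  case (Cnd b p q)
  then obtain C D where CD: "\<forall>n. cost n p \<le> C * (n + 1) ^ k" "\<forall>n. cost n q \<le> D * (n + 1) ^ k" by force
  have "cost n (Cnd b p q) \<le> (bcost (cb b) + 1 + (C + D)) * (n + 1) ^ k" for n
  proof -
    have "bcost (cb b) + 1 \<le> (bcost (cb b) + 1) * (n + 1) ^ k"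
      using mult_le_mono2[of 1 "(n + 1) ^ k" "bcost (cb b) + 1"] by simp
    moreover have "cost n p \<le> C * (n + 1) ^ k" "cost n q \<le> D * (n + 1) ^ k" using CD by auto
    ultimately show ?thesis unfolding cost.simps add_mult_distrib by linarith
  qed
  then show ?case by blast
next
  case (For x p)
  then obtain l where k: "k = Suc l" "depth p \<le> l" by (cases k) auto
  from For.IH[OF k(2)] obtain C where C: "\<And>n. cost n p \<le> C * (n + 1) ^ l" by auto
  have "cost n (For x p) \<le> (14 + C) * (n + 1) ^ k" for n
  proof -
    have "n * cost n p \<le> (n + 1) * (C * (n + 1) ^ l)" by (rule mult_mono[OF _ C]) auto
    moreover have "6 + n * 8 \<le> 14 * (n + 1)" by simp
    then have "6 + n * 8 \<le> 14 * (n + 1) ^ k"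
      using self_le_power[of "n + 1" k] k by (meson Suc_leI le_add2 le_trans mult_le_mono2 zero_less_Suc add_gr_0 zero_less_one order_refl)
    ultimately show ?thesis by (simp add: k algebra_simps)
  qed
  then show ?case by blast
next
  case Nop
  show ?case by (rule exI[of _ 1]) simp
next
  case (Set x e)
  have "acost (ce e) + 1 \<le> (acost (ce e) + 1) * (n + 1) ^ k" for n
    using mult_le_mono2[of 1 "(n + 1) ^ k" "acost (ce e) + 1"] by simp
  then show ?case by (intro exI[of _ "acost (ce e) + 1"]) simp
next
  case (Put a i j e)
  let ?C = "acost (idx (ce i) (ce j)) + acost (ce e) + 1"
  have "?C \<le> ?C * (n + 1) ^ k" for n
    using mult_le_mono2[of 1 "(n + 1) ^ k" ?C] by simp
  then show ?case by (intro exI[of _ ?C]) simp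
qed

section \<open>The game on positions\<close>

fun winN :: "nat \<Rightarrow> 'a set set \<Rightarrow> 'a \<Rightarrow> 'a \<Rightarrow> bool" where
  "winN 0 F a b = False"
| "winN (Suc k) F a b = (\<exists>a'. {a, a'} \<in> F \<and> \<not> winN k (F - {{a, a'}}) b a')"

definition win :: "'a set set \<Rightarrow> 'a \<Rightarrow> 'a \<Rightarrow> bool" where
  "win F a b = winN (card F) F a b"

lemma win_unfold:
  assumes "finite F"
  shows "win F a b \<longleftrightarrow> (\<exists>a'. {a, a'} \<in> F \<and> \<not> win (F - {{a, a'}}) b a')"
proof (cases "card F")
  case 0
  then show ?thesis using assms by (auto simp: win_def)
next
  case (Suc k)
  then have "card (F - {e}) = k" if "e \<in> F" for e using that by simp
  then show ?thesis using Suc by (auto simp: win_def)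
qed

section \<open>Strategies and backward induction over histories\<close>

fun hwN :: "nat \<Rightarrow> 'a set set \<Rightarrow> 'a move list \<Rightarrow> bool" where
  "hwN 0 E h = False"
| "hwN (Suc k) E h = (\<exists>m. legal E h m \<and> \<not> hwN k E (h @ [m]))"

definition hwin :: "'a set set \<Rightarrow> 'a move list \<Rightarrow> bool" where
  "hwin E h = hwN (card E - length h) E h"

lemma play_edges:
  assumes "play E h"
  shows "edge_of ` set h \<subseteq> E \<and> card (edge_of ` set h) = length h"
  using assms by (induction) (auto simp: legal_def)

lemma play_length: "play E h \<Longrightarrow> finite E \<Longrightarrow> length h \<le> card E"
  using play_edges[of E h] card_mono[of E] by metis

lemma hwin_unfold:
  assumes "play E h" "finite E"
  shows "hwin E h \<longleftrightarrow> (\<exists>m. legal E h m \<and> \<not> hwin E (h @ [m]))"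
proof (cases "card E - length h")
  case 0
  have "\<not> legal E h m" for m
  proof
    assume "legal E h m"
    from play_length[OF play_snoc[OF assms(1) this] assms(2)] show False using 0 by simp
  qed
  then show ?thesis using 0 by (simp add: hwin_def)
next
  case (Suc k)
  then have "card E - length (h @ [m]) = k" for m by simp
  then show ?thesis using Suc by (simp add: hwin_def)
qed

lemma follows_snoc:
  "follows \<sigma> (h @ [m]) \<longleftrightarrow> follows \<sigma> h \<and> (even (length h) \<longrightarrow> m = \<sigma> h)"
  by (auto simp: follows_def nth_append less_Suc_eq)

lemma P1_win_imp_hwin:
  assumes \<sigma>: "P1_winning_strategy E \<sigma>" and "finite E"
  shows "play E h \<Longrightarrow> follows \<sigma> h \<Longrightarrow> even (length h) \<Longrightarrow> hwin E h"
proof (induction "card E - length h" arbitrary: h rule: less_induct)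
  case less
  have "\<not> stuck E h" using \<sigma> less.prems by (auto simp: P1_winning_strategy_def)
  then have leg: "legal E h (\<sigma> h)"
    using \<sigma> less.prems by (auto simp: P1_winning_strategy_def P1_strategy_def)
  let ?h = "h @ [\<sigma> h]"
  have p: "play E ?h" "follows \<sigma> ?h"
    using leg less.prems by (auto simp: follows_snoc intro: play_snoc)
  have "hwin E (?h @ [m])" if m: "legal E ?h m" for m
  proof (rule less.hyps)
    show pl: "play E (?h @ [m])" using p m by (rule_tac play_snoc)
    show "card E - length (?h @ [m]) < card E - length h"
      using play_length[OF pl \<open>finite E\<close>] by simp
      show "follows \<sigma> (?h @ [m])" using p less.prems by (subst follows_snoc) auto
    show "even (length (?h @ [m]))" using less.prems by simp
  qed
  then have "\<not> hwin E ?h" using hwin_unfold[OF p(1) \<open>finite E\<close>] by blast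
  then show ?case using hwin_unfold[OF less.prems(1) \<open>finite E\<close>] leg by blast
qed

lemma P1_win_iff_hwin:
  assumes "finite E"
  shows "P1_win E \<longleftrightarrow> hwin E []"
proof
  assume "P1_win E"
  then show "hwin E []"
    using P1_win_imp_hwin[OF _ assms, of _ "[]"] by (auto simp: P1_win_def follows_def play_Nil)
next
  assume start: "hwin E []"
  \<comment> \<open>In lost positions \<open>\<sigma>\<close> still has to be legal, as
    \<open>P1_strategy\<close> demands a legal move whenever there is one; hence the implication
    inside the choice.\<close>
  define \<sigma> where "\<sigma> h = (SOME m. legal E h m \<and> (hwin E h \<longrightarrow> \<not> hwin E (h @ [m])))" for h
  have \<sigma>: "legal E h (\<sigma> h) \<and> (hwin E h \<longrightarrow> \<not> hwin E (h @ [\<sigma> h]))"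
    if "play E h" "\<not> stuck E h" for h
  proof -
    have "\<exists>m. legal E h m \<and> (hwin E h \<longrightarrow> \<not> hwin E (h @ [m]))"
      using hwin_unfold[OF that(1) assms] that(2) by (auto simp: stuck_def)
    then show ?thesis unfolding \<sigma>_def by (rule someI_ex)
  qed
  \<comment> \<open>As \<open>\<sigma>\<close> never gives away a won position, winning positions
    alternate with the parity of the history. A stuck position is not winning for the player to
    move, so its length is odd.\<close>
  have inv: "follows \<sigma> h \<Longrightarrow> hwin E h \<longleftrightarrow> even (length h)" if "play E h" for h
    using that
  proof (induction)
    case play_Nil
    then show ?case using start by simp
  next
    case (play_snoc h m)
    then have IH: "hwin E h \<longleftrightarrow> even (length h)" by (simp add: follows_snoc)
    show ?case
    proof (cases "even (length h)")
      case True
      have "\<not> stuck E h" using play_snoc(2) unfolding stuck_def by blast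
      then show ?thesis using \<sigma>[OF play_snoc(1)] play_snoc(4) True IH by (auto simp: follows_snoc)
    next
      case False
      then show ?thesis using hwin_unfold[OF play_snoc(1) assms] play_snoc(2) IH by (cases m) auto
    qed
  qed
  have "odd (length h)" if "play E h" "follows \<sigma> h" "stuck E h" for h
    using inv[OF that(1,2)] hwin_unfold[OF that(1) assms] that(3) by (auto simp: stuck_def)
  then have "P1_winning_strategy E \<sigma>"
    using \<sigma> by (auto simp: P1_winning_strategy_def P1_strategy_def)
  then show "P1_win E" by (auto simp: P1_win_def)
qed

text \<open>The start vertex is free only in the first two moves. From then on a history matters
  only through the used edges and the two token positions, and the token moved longer ago is the
  next to move.\<close>

lemma hwN_eq_winN:
  "2 \<le> length h \<Longrightarrow> hwN k E h = winN k (E - edge_of ` set h) (snd (h ! (length h - 2))) (snd (last h))"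
proof (induction k arbitrary: h)
  case (Suc k)
  let ?a = "snd (h ! (length h - 2))" and ?F = "E - edge_of ` set h"
  have leg: "legal E h m \<longleftrightarrow> (\<exists>a'. m = (?a, a') \<and> {?a, a'} \<in> ?F)" for m
    using Suc.prems by (cases m) (auto simp: legal_def)
  have "hwN k E (h @ [(?a, a')]) = winN k (?F - {{?a, a'}}) (snd (last h)) a'" for a'
  proof -
    have "hwN k E (h @ [(?a, a')]) =
      winN k (E - edge_of ` set (h @ [(?a, a')])) (snd ((h @ [(?a, a')]) ! (length h - 1))) a'"
      using Suc.IH[of "h @ [(?a, a')]"] Suc.prems by simp
    also have "E - edge_of ` set (h @ [(?a, a')]) = ?F - {{?a, a'}}" by auto
    also have "(h @ [(?a, a')]) ! (length h - 1) = last h"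
      using Suc.prems by (subst last_conv_nth) (auto simp: nth_append)
    finally show ?thesis .
  qed
  then show ?case using leg by auto
qed simp

lemma P1_win_iff:
  assumes "finite E"
  shows "P1_win E \<longleftrightarrow> (\<exists>u v. {u, v} \<in> E \<and>
    (\<forall>x y. {x, y} \<in> E \<and> {x, y} \<noteq> {u, v} \<longrightarrow> win (E - {{u, v}, {x, y}}) v y))"
proof -
  have 2: "hwin E [(u, v), (x, y)] = win (E - {{u, v}, {x, y}}) v y"
    if "{u, v} \<in> E" "{x, y} \<in> E" "{x, y} \<noteq> {u, v}" for u v x y
  proof -
    have "card (E - {{u, v}, {x, y}}) = card E - 2"
      using that by (subst card_Diff_subset) auto
    then show ?thesis using hwN_eq_winN[of "[(u, v), (x, y)]" "card E - 2" E]
      by (simp add: hwin_def win_def eval_nat_numeral)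
  qed
  have l0: "legal E [] m \<longleftrightarrow> (\<exists>u v. m = (u, v) \<and> {u, v} \<in> E)" for m
    by (cases m) (auto simp: legal_def)
  have l1: "legal E [(u, v)] m \<longleftrightarrow> (\<exists>x y. m = (x, y) \<and> {x, y} \<in> E \<and> {x, y} \<noteq> {u, v})" for m u v
    by (cases m) (auto simp: legal_def)
  have "hwin E [(u, v)] \<longleftrightarrow> (\<exists>x y. {x, y} \<in> E \<and> {x, y} \<noteq> {u, v} \<and> \<not> win (E - {{u, v}, {x, y}}) v y)"
    if uv: "{u, v} \<in> E" for u v
  proof -
    have "play E [(u, v)]" using play_snoc[OF play_Nil, of E "(u, v)"] l0 uv by simp
    from hwin_unfold[OF this assms] show ?thesis unfolding l1 using 2[OF uv] by (simp, metis)
  qed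
  then show ?thesis
    unfolding P1_win_iff_hwin[OF assms] hwin_unfold[OF play_Nil assms] l0 by (simp, metis)
qed


section \<open>Trees with a table of first steps\<close>

text \<open>\<open>nxt u v\<close> is the neighbour of \<open>u\<close> in the direction of \<open>v\<close>.\<close>

locale routed_tree =
  fixes V :: "'a set" and E :: "'a set set" and nxt :: "'a \<Rightarrow> 'a \<Rightarrow> 'a" and dst :: "'a \<Rightarrow> 'a \<Rightarrow> nat"
  assumes finV: "finite V"
    and edge_pair: "e \<in> E \<Longrightarrow> \<exists>x y. e = {x, y}"
    and edge: "{x, y} \<in> E \<Longrightarrow> x \<in> V \<and> y \<in> V \<and> x \<noteq> y"
    and nxt_self: "u \<in> V \<Longrightarrow> nxt u u = u"
    and nxt_edge: "{u, v} \<in> E \<Longrightarrow> nxt u v = v"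
    and edge_nxt: "u \<in> V \<Longrightarrow> v \<in> V \<Longrightarrow> u \<noteq> v \<Longrightarrow> {u, nxt u v} \<in> E"
    and nxt_const: "{x, y} \<in> E \<Longrightarrow> u \<in> V \<Longrightarrow> u \<noteq> x \<Longrightarrow> u \<noteq> y \<Longrightarrow> nxt u x = nxt u y"
    and nxt_side: "{x, y} \<in> E \<Longrightarrow> u \<in> V \<Longrightarrow> nxt x u = y \<longleftrightarrow> nxt y u \<noteq> x"
    and dst_self: "u \<in> V \<Longrightarrow> dst u u = 0"
    and dst_nxt: "u \<in> V \<Longrightarrow> v \<in> V \<Longrightarrow> u \<noteq> v \<Longrightarrow> dst u v = Suc (dst (nxt u v) v)"
    and dst_sym: "u \<in> V \<Longrightarrow> v \<in> V \<Longrightarrow> dst u v = dst v u"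
    and dst_less: "u \<in> V \<Longrightarrow> v \<in> V \<Longrightarrow> dst u v < card V"

lemma routed_tree_single:
  assumes "nxt a a = a" "dst a a = 0"
  shows "routed_tree {a} {} nxt dst"
  using assms by unfold_locales auto

text \<open>The new leaf \<open>b\<close> sees everything through \<open>a\<close>, and is seen from
  everywhere else in the direction of \<open>a\<close>. The new tables are constrained only on
  \<open>insert b V\<close>, since those of the program have arbitrary entries elsewhere.\<close>

lemma routed_tree_insert:
  assumes "routed_tree V E nx d" and a: "a \<in> V" and b: "b \<notin> V"
    and old: "\<And>u v. u \<in> V \<Longrightarrow> v \<in> V \<Longrightarrow> nx' u v = nx u v \<and> d' u v = d u v"
    and new: "\<And>u. u \<in> V \<Longrightarrow> nx' b u = a \<and> nx' u b = (if u = a then b else nx u a) \<and>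
       d' b u = Suc (d u a) \<and> d' u b = Suc (d u a)"
    and self: "nx' b b = b" "d' b b = 0"
  shows "routed_tree (insert b V) (insert {a, b} E) nx' d'"
proof -
  interpret routed_tree V E nx d by fact
  have E: "{x, y} \<in> E \<Longrightarrow> x \<in> V \<and> y \<in> V \<and> x \<noteq> b \<and> y \<noteq> b" for x y using edge b by blast
  have nV: "nx u v \<in> V" if "u \<in> V" "v \<in> V" for u v
    using edge_nxt[OF that] edge nxt_self[of u] that by (cases "u = v") auto
  have ab: "a \<noteq> b" using a b by auto
  show ?thesis
  proof
    show "finite (insert b V)" using finV by simp
    show "\<exists>x y. e = {x, y}" if "e \<in> insert {a, b} E" for e using that edge_pair by blast
    show "x \<in> insert b V \<and> y \<in> insert b V \<and> x \<noteq> y" if "{x, y} \<in> insert {a, b} E" for x y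
      using that edge[of x y] a ab by (auto simp: doubleton_eq_iff)
    show "nx' u u = u" if "u \<in> insert b V" for u
      using that self old nxt_self by auto
    show "nx' u v = v" if "{u, v} \<in> insert {a, b} E" for u v
      using that nxt_edge[of u v] old[of u v] new[OF a] E[of u v] by (auto simp: doubleton_eq_iff)
    show "{u, nx' u v} \<in> insert {a, b} E" if "u \<in> insert b V" "v \<in> insert b V" "u \<noteq> v" for u v
    proof (cases "u = b")
      case True
      then show ?thesis using that new[of v] by (auto simp: insert_commute)
    next
      case False
      then show ?thesis using that new[of u] old[of u v] edge_nxt[of u v] edge_nxt[of u a] a by auto
    qed
    show "nx' u x = nx' u y"
      if "{x, y} \<in> insert {a, b} E" "u \<in> insert b V" "u \<noteq> x" "u \<noteq> y" for x y u
    proof (cases "{x, y} = {a, b}")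
      case True
      then show ?thesis using that new[of u] old[OF _ a, of u] b by (auto simp: doubleton_eq_iff)
    next
      case False
      then have "{x, y} \<in> E" using that by auto
      then show ?thesis using that E[of x y] new[of x] new[of y] old[of u x] old[of u y] nxt_const[of x y u]
        by auto
    qed
    show "nx' x u = y \<longleftrightarrow> nx' y u \<noteq> x" if "{x, y} \<in> insert {a, b} E" "u \<in> insert b V" for x y u
    proof (cases "{x, y} = {a, b}")
      case True
      have "nx' a u = b \<longleftrightarrow> nx' b u \<noteq> a"
        using that(2) new[OF a] new[of u] old[OF a, of u] nV[OF a, of u] self ab b by auto
      then show ?thesis using True by (auto simp: doubleton_eq_iff)
    next
      case False
      then have xy: "{x, y} \<in> E" "{y, x} \<in> E" using that by (auto simp: insert_commute)
      show ?thesis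
      proof (cases "u = b")
        case True
        \<comment> \<open>Across an old edge, \<open>b\<close> lies on the same side as its
          attachment point \<open>a\<close>.\<close>
        have "nx' p b = q \<longleftrightarrow> nx p a = q" if "{p, q} \<in> E" for p q
          using new[of p] E[OF that] edge[OF that] nxt_self[OF a] by (cases "p = a") auto
        then show ?thesis using True nxt_side[OF xy(1) a] xy by auto
      next
        case False
        then show ?thesis using that(2) nxt_side[OF xy(1)] old E[OF xy(1)] by auto
      qed
    qed
    show "d' u u = 0" if "u \<in> insert b V" for u using that self old dst_self by auto
    show "d' u v = Suc (d' (nx' u v) v)" if "u \<in> insert b V" "v \<in> insert b V" "u \<noteq> v" for u v
    proof (cases "u = b")
      case True
      then show ?thesis using that new[of v] old[OF a, of v] dst_sym[OF a, of v] by auto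
    next
      case u: False
      show ?thesis
      proof (cases "v = b")
        case True
        then show ?thesis using that u new[of u] new[of "nx u a"] nV[of u a] a dst_nxt[of u a] self dst_self[of a]
          by auto
      next
        case False
        then show ?thesis using that u old[of u v] old[of "nx u v" v] nV[of u v] dst_nxt[of u v] by auto
      qed
    qed
    show "d' u v = d' v u" if "u \<in> insert b V" "v \<in> insert b V" for u v
      using that new old dst_sym by (cases "u = b"; cases "v = b") auto
    show "d' u v < card (insert b V)" if "u \<in> insert b V" "v \<in> insert b V" for u v
      using that new[of u] new[of v] old[of u v] dst_less[of u v] dst_less[of u a] dst_less[of v a] self finV a b
      by (auto simp: less_Suc_eq)
  qed
qed

context routed_tree
begin

lemma finE: "finite E"
proof -
  have "E \<subseteq> Pow V" using edge_pair edge by blast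
  then show ?thesis using finV finite_subset by blast
qed

lemma nxt_in [simp]: "u \<in> V \<Longrightarrow> v \<in> V \<Longrightarrow> nxt u v \<in> V"
  using edge_nxt[of u v] edge nxt_self[of u] by (cases "u = v") auto

lemma edge_sym: "{x, y} \<in> E \<Longrightarrow> {y, x} \<in> E"
  by (simp add: insert_commute)

lemma nxt_eq_self: "u \<in> V \<Longrightarrow> v \<in> V \<Longrightarrow> nxt u v = u \<longleftrightarrow> v = u"
  using edge_nxt[of u v] edge[of u "nxt u v"] nxt_self[of u] by metis

lemma nxt_back: "u \<in> V \<Longrightarrow> v \<in> V \<Longrightarrow> u \<noteq> v \<Longrightarrow> nxt (nxt u v) v \<noteq> u"
  using nxt_side[OF edge_nxt[of u v], of v] by auto

lemma dst_edge: "{u, v} \<in> E \<Longrightarrow> dst u v = 1"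
  using dst_nxt[of u v] nxt_edge edge[of u v] dst_self[of v] by auto

lemma dst_eq_0: "u \<in> V \<Longrightarrow> v \<in> V \<Longrightarrow> dst u v = 0 \<longleftrightarrow> u = v"
  using dst_nxt[of u v] dst_self[of u] by (cases "u = v") auto

lemma dst_eq_1: "u \<in> V \<Longrightarrow> v \<in> V \<Longrightarrow> dst u v = 1 \<longleftrightarrow> u \<noteq> v \<and> nxt u v = v"
  using dst_nxt[of u v] dst_self[of u] dst_eq_0[of "nxt u v" v] by (cases "u = v") auto

text \<open>If the path from \<open>y\<close> to \<open>z\<close> does not set out towards
  \<open>s\<close>, then \<open>y\<close> lies on the path from \<open>s\<close> to
  \<open>z\<close>, so both are reached by the same first step from \<open>s\<close>. The proof
  walks from \<open>s\<close> to \<open>y\<close>; at each edge, \<open>nxt_side\<close> turns not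
  going back into going forward.\<close>

lemma nxt_beyond:
  "s \<in> V \<Longrightarrow> y \<in> V \<Longrightarrow> z \<in> V \<Longrightarrow> s \<noteq> y \<Longrightarrow> nxt y z \<noteq> nxt y s \<Longrightarrow> nxt s z = nxt s y"
proof (induction "dst s y" arbitrary: s rule: less_induct)
  case less
  let ?v = "nxt s y"
  have e: "{s, ?v} \<in> E" using edge_nxt less.prems by auto
  show ?case
  proof (cases "?v = y")
    case True
    then have "nxt y s = s" using nxt_edge edge_sym e by metis
    then show ?thesis using nxt_side[OF e less.prems(3)] True less.prems by auto
  next
    case False
    have "nxt y s = nxt y ?v" using nxt_const[OF e] less.prems False by auto
    then have "nxt ?v z = nxt ?v y"
      using less.hyps[of ?v] dst_nxt[of s y] less.prems False by auto
    then have "nxt ?v z \<noteq> s" using nxt_back[of s y] less.prems by auto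
    then show ?thesis using nxt_side[OF e less.prems(3)] by auto
  qed
qed

lemma dst_add:
  "s \<in> V \<Longrightarrow> y \<in> V \<Longrightarrow> z \<in> V \<Longrightarrow> nxt y z \<noteq> nxt y s \<or> s = y \<Longrightarrow> dst s z = dst s y + dst y z"
proof (induction "dst s y" arbitrary: s rule: less_induct)
  case less
  show ?case
  proof (cases "s = y")
    case True
    then show ?thesis using less.prems dst_self by auto
  next
    case False
    let ?v = "nxt s y"
    have e: "{s, ?v} \<in> E" using edge_nxt less.prems False by auto
    have n: "nxt s z = ?v" using nxt_beyond[OF less.prems(1-3) False] less.prems(4) False by simp
    then have "s \<noteq> z" using nxt_eq_self[of s y] nxt_self[of s] False less.prems(1-3) by auto
    then have 1: "dst s z = Suc (dst ?v z)" using dst_nxt[of s z] less.prems n by auto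
    have 2: "dst s y = Suc (dst ?v y)" using dst_nxt[of s y] less.prems False by auto
    have "nxt y z \<noteq> nxt y ?v \<or> ?v = y"
      using nxt_const[OF e less.prems(2)] less.prems(4) False by metis
    then have "dst ?v z = dst ?v y + dst y z" using less.hyps[of ?v] 2 less.prems by auto
    then show ?thesis using 1 2 by simp
  qed
qed


subsection \<open>Components of a tree without some of its edges\<close>

text \<open>An edge \<open>{p, q}\<close> separates two vertices exactly if the test
  \<open>nxt p z = q\<close> gives different results for them. For a set \<open>U\<close> of tree
  edges this is thus the vertex set of the component of \<open>a\<close> after deletion of
  \<open>U\<close>.\<close>

definition comp :: "'a set set \<Rightarrow> 'a \<Rightarrow> 'a set" where
  "comp U a = {z \<in> V. \<forall>p q. {p, q} \<in> U \<longrightarrow> (nxt p a = q \<longleftrightarrow> nxt p z = q)}"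

text \<open>In a forest every trail is a path, so this is the number of moves that a token at
  \<open>a\<close> can make on its own after the edges \<open>U\<close> are used.\<close>

definition far :: "'a set set \<Rightarrow> 'a \<Rightarrow> nat" where
  "far U a = Max (dst a ` comp U a)"

lemma comp_self: "a \<in> V \<Longrightarrow> a \<in> comp U a"
  by (simp add: comp_def)

lemma fin_comp: "finite (comp U a)"
  using finV by (simp add: comp_def)

lemma comp_subset: "comp U a \<subseteq> V"
  by (auto simp: comp_def)

lemma far_le: "z \<in> comp U a \<Longrightarrow> dst a z \<le> far U a"
  unfolding far_def using fin_comp by (intro Max_ge) auto

lemma far_ge_iff:
  assumes "a \<in> V"
  shows "k \<le> far U a \<longleftrightarrow> (\<exists>z\<in>comp U a. k \<le> dst a z)"
proof -
  have "dst a ` comp U a \<noteq> {}" using comp_self[OF assms] by blast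
  then show ?thesis unfolding far_def using fin_comp by (subst Max_ge_iff) auto
qed

lemma comp_neighbour:
  assumes "U \<subseteq> E" "{a, a'} \<in> E"
  shows "a' \<in> comp U a \<longleftrightarrow> {a, a'} \<notin> U"
proof
  assume "a' \<in> comp U a"
  then have "{a, a'} \<in> U \<longrightarrow> (nxt a a = a' \<longleftrightarrow> nxt a a' = a')" by (simp add: comp_def)
  then show "{a, a'} \<notin> U" using nxt_edge[OF assms(2)] nxt_self[of a] edge[OF assms(2)] by auto
next
  assume n: "{a, a'} \<notin> U"
  have "nxt p a = q \<longleftrightarrow> nxt p a' = q" if pq: "{p, q} \<in> U" for p q
  proof -
    have E: "{p, q} \<in> E" using pq assms by auto
    have "q \<noteq> a'" if "p = a" using that n pq by auto
    moreover have "q \<noteq> a" if "p = a'" using that n pq by (auto simp: insert_commute)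
    ultimately show ?thesis
      using nxt_const[OF assms(2), of p] edge[OF E] nxt_self[of p] nxt_edge[OF assms(2)]
        nxt_edge[OF edge_sym[OF assms(2)]] by metis
  qed
  then show "a' \<in> comp U a" using edge[OF assms(2)] by (auto simp: comp_def)
qed

lemma comp_eq: "b \<in> comp U a \<Longrightarrow> comp U b = comp U a"
  by (auto simp: comp_def)

text \<open>The definition of \<open>comp\<close> tests an edge in both orientations;
  \<open>nxt_side\<close> makes the two tests equivalent, so one is enough.\<close>

lemma comp_insert:
  assumes "U \<subseteq> E" "{p, q} \<in> E" "a \<in> V"
  shows "comp (insert {p, q} U) a = {z \<in> comp U a. nxt p a = q \<longleftrightarrow> nxt p z = q}"
proof -
  have "(nxt q a = p) = (nxt q z = p) \<longleftrightarrow> (nxt p a = q) = (nxt p z = q)" if "z \<in> V" for z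
    using nxt_side[OF assms(2)] assms(3) that by metis
  then show ?thesis by (auto simp: comp_def doubleton_eq_iff)
qed

lemma comp_step:
  assumes "U \<subseteq> E" "{a, a'} \<in> E" "{a, a'} \<notin> U"
  shows "comp (insert {a, a'} U) a' = {z \<in> comp U a. nxt a z = a'}"
proof -
  have "comp U a' = comp U a" using comp_eq comp_neighbour[OF assms(1,2)] assms(3) by blast
  then show ?thesis using comp_insert[OF assms(1,2), of a'] edge[OF assms(2)] nxt_edge[OF assms(2)] by auto
qed

text \<open>A used edge matters only if it bounds the component of a token. This allows used edges
  left behind to be forgotten, so that a later position becomes one of the same kind on a shorter
  path.\<close>

lemma win_comp:
  assumes "U \<subseteq> E" "U' \<subseteq> E" "a \<in> V" "b \<in> V" "comp U a = comp U' a" "comp U b = comp U' b"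
  shows "win (E - U) a b = win (E - U') a b"
  using assms
proof (induction "card (E - U)" arbitrary: U U' a b rule: less_induct)
  case less
  have edges: "{a, a'} \<in> E - U \<longleftrightarrow> {a, a'} \<in> E - U'" for a'
    using comp_neighbour[OF less.prems(1)] comp_neighbour[OF less.prems(2)] less.prems(5) by blast
  have "win (E - U - {{a, a'}}) b a' = win (E - U' - {{a, a'}}) b a'" if e: "{a, a'} \<in> E - U" for a'
  proof -
    let ?I = "insert {a, a'} U" and ?I' = "insert {a, a'} U'"
    have E: "{a, a'} \<in> E" "{a, a'} \<notin> U" "{a, a'} \<notin> U'" using e edges by auto
    have "win (E - ?I) b a' = win (E - ?I') b a'"
    proof (rule less.hyps)
      have "E - ?I = E - U - {{a, a'}}" by auto
      then show "card (E - ?I) < card (E - U)" using finE e by (simp only:) (rule card_Diff1_less, auto)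
      show "comp ?I a' = comp ?I' a'"
        using comp_step[OF less.prems(1) E(1,2)] comp_step[OF less.prems(2) E(1,3)] less.prems(5) by simp
      show "comp ?I b = comp ?I' b"
        using comp_insert[OF less.prems(1) E(1)] comp_insert[OF less.prems(2) E(1)] less.prems by simp
    qed (use E less.prems edge in auto)
    moreover have "E - ?I = E - U - {{a, a'}}" "E - ?I' = E - U' - {{a, a'}}" by auto
    ultimately show ?thesis by simp
  qed
  then show ?case
    using win_unfold[of "E - U" a b] win_unfold[of "E - U'" a b] finE edges by auto
qed

text \<open>Components are convex, and the last hypothesis places \<open>a\<close> on the path from
  \<open>b\<close> to \<open>z\<close>.\<close>

lemma between_comp:
  assumes "U \<subseteq> E" "a \<in> V" "b \<in> V" "z \<in> comp U b" "nxt a b \<noteq> nxt a z"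
  shows "a \<in> comp U b"
proof -
  have z: "z \<in> V" using assms(4) by (simp add: comp_def)
  have "nxt p b = q \<longleftrightarrow> nxt p a = q" if pq: "{p, q} \<in> U" for p q
  proof -
    have E: "{p, q} \<in> E" using pq assms by auto
    have same: "nxt p b = q \<longleftrightarrow> nxt p z = q" using assms(4) pq by (auto simp: comp_def)
    show ?thesis
    proof (cases "p = a")
      case True
      then show ?thesis using same assms(5) nxt_self[OF assms(2)] edge[OF E] by auto
    next
      case False
      \<comment> \<open>Seen from \<open>p\<close>, at least one of \<open>b\<close> and
        \<open>z\<close> lies in the same direction as \<open>a\<close>.\<close>
      then have "nxt p b = nxt p a \<or> nxt p z = nxt p a"
        using nxt_beyond[of p a b] nxt_beyond[of p a z] assms z edge[OF E] by metis
      then show ?thesis using same by auto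
    qed
  qed
  then show ?thesis using assms(2) by (auto simp: comp_def)
qed

lemma far_step:
  assumes "U \<subseteq> E" "a \<in> V"
  shows "Suc k \<le> far U a \<longleftrightarrow> (\<exists>a'. {a, a'} \<in> E - U \<and> k \<le> far (insert {a, a'} U) a')"
proof
  assume "Suc k \<le> far U a"
  then obtain z where z: "z \<in> comp U a" "Suc k \<le> dst a z" using far_ge_iff[OF assms(2)] by blast
  then have zV: "z \<in> V" "a \<noteq> z" using dst_self assms by (auto simp: comp_def)
  let ?a = "nxt a z"
  have e: "{a, ?a} \<in> E" using edge_nxt assms zV by auto
  moreover have "{a, ?a} \<in> U \<longrightarrow> (nxt a a = ?a \<longleftrightarrow> nxt a z = ?a)" using z(1) by (auto simp: comp_def)
  then have "{a, ?a} \<notin> U" using nxt_eq_self[OF assms(2) zV(1)] nxt_self[OF assms(2)] zV by metis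
  ultimately have "{a, ?a} \<in> E - U" by blast
  moreover have "k \<le> far (insert {a, ?a} U) ?a"
  proof -
    have "z \<in> comp (insert {a, ?a} U) ?a" using comp_step[OF assms(1) e] calculation z by auto
    moreover have "k \<le> dst ?a z" using z(2) dst_nxt[of a z] assms zV by auto
    ultimately show ?thesis using far_le le_trans by blast
  qed
  ultimately show "\<exists>a'. {a, a'} \<in> E - U \<and> k \<le> far (insert {a, a'} U) a'" by blast
next
  assume "\<exists>a'. {a, a'} \<in> E - U \<and> k \<le> far (insert {a, a'} U) a'"
  then obtain a' where e: "{a, a'} \<in> E" "{a, a'} \<notin> U" and k: "k \<le> far (insert {a, a'} U) a'" by auto
  have V: "a' \<in> V" "a \<noteq> a'" using edge[OF e(1)] by auto
  obtain z where z: "z \<in> comp (insert {a, a'} U) a'" "k \<le> dst a' z" using k far_ge_iff[OF V(1)] by blast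
  then have "z \<in> comp U a" "nxt a z = a'" using comp_step[OF assms(1) e] by auto
  moreover have "a \<noteq> z" using calculation V nxt_self assms by auto
  ultimately have "Suc k \<le> dst a z" using z(2) dst_nxt[of a z] assms(2) by (auto simp: comp_def)
  then show "Suc k \<le> far U a" using far_le[OF \<open>z \<in> comp U a\<close>] by simp
qed

text \<open>Tokens in different components cannot affect each other, so each player walks along a
  longest path. In a tie the player to move runs out of moves first, hence the strict
  inequality.\<close>

lemma win_separated:
  assumes "U \<subseteq> E" "a \<in> V" "b \<in> V" "b \<notin> comp U a"
  shows "win (E - U) a b \<longleftrightarrow> far U b < far U a"
  using assms
proof (induction "card (E - U)" arbitrary: U a b rule: less_induct)
  case less
  have "\<not> win (E - U - {{a, a'}}) b a' \<longleftrightarrow> far U b \<le> far (insert {a, a'} U) a'"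
    if e: "{a, a'} \<in> E - U" for a'
  proof -
    let ?U = "insert {a, a'} U"
    have E: "{a, a'} \<in> E" "{a, a'} \<notin> U" "?U \<subseteq> E" using e less.prems by auto
    have V: "a' \<in> V" using edge E by auto
    have eq: "E - ?U = E - U - {{a, a'}}" by auto
    then have less_card: "card (E - ?U) < card (E - U)"
      using finE e by (simp only:) (rule card_Diff1_less, auto)
    have "a' \<in> comp U a" using comp_neighbour[OF less.prems(1) E(1)] E(2) by simp
    then have a': "a' \<notin> comp U b" using comp_eq comp_self less.prems by metis
    have a: "a \<notin> comp U b" using comp_eq comp_self less.prems by metis
    \<comment> \<open>By convexity, an edge at \<open>a\<close> cuts nothing off from a component
      that does not contain \<open>a\<close>.\<close>
    then have "comp ?U b = comp U b"
      using comp_insert[OF less.prems(1) E(1) less.prems(3)]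
        between_comp[OF less.prems(1,2,3)] by fastforce
    then have far: "far ?U b = far U b" and sep: "a' \<notin> comp ?U b" using a' by (auto simp: far_def)
    show ?thesis using less.hyps[OF less_card E(3) less.prems(3) V sep] far by (simp only: eq not_less)
  qed
  then have "win (E - U) a b \<longleftrightarrow> (\<exists>a'. {a, a'} \<in> E - U \<and> far U b \<le> far (insert {a, a'} U) a')"
    using win_unfold[of "E - U" a b] finE by auto
  also have "\<dots> \<longleftrightarrow> Suc (far U b) \<le> far U a" using far_step[OF less.prems(1,2)] by simp
  finally show ?case by (simp add: Suc_le_eq)
qed


subsection \<open>Longest paths\<close>

text \<open>The lengths below are maxima, best known through the numbers \<open>k\<close> that they
  reach; equations between them are proved by comparing these.\<close>

lemma eq_by_lower:
  fixes a b :: nat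
  assumes "\<And>k. k \<le> a \<longleftrightarrow> k \<le> b"
  shows "a = b"
  using assms[of a] assms[of b] by simp

text \<open>The inserted \<open>0\<close> is the value of an empty set, such as a direction without
  a neighbour, or what lies between adjacent ends.\<close>

definition lmax :: "'a \<Rightarrow> 'a set \<Rightarrow> nat" where
  "lmax a A = Max (insert 0 (dst a ` A))"

lemma lmax_ge_iff: "A \<subseteq> V \<Longrightarrow> k \<le> lmax a A \<longleftrightarrow> k = 0 \<or> (\<exists>z\<in>A. k \<le> dst a z)"
  unfolding lmax_def using finite_subset[OF _ finV, of A] by (subst Max_ge_iff) auto

lemma far_eq_lmax: "a \<in> V \<Longrightarrow> far U a = lmax a (comp U a)"
  by (metis comp_self comp_subset far_ge_iff le0 lmax_ge_iff order_antisym order_refl)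

lemma lmax_Suc:
  assumes "A \<subseteq> V" "A \<noteq> {}" "\<And>z. z \<in> A \<Longrightarrow> dst a z = Suc (dst b z)"
  shows "lmax a A = Suc (lmax b A)"
proof -
  have "k \<le> lmax a A \<longleftrightarrow> k \<le> Suc (lmax b A)" for k
    using assms lmax_ge_iff[OF assms(1)] by (cases k) auto
  then show ?thesis by (rule eq_by_lower)
qed

text \<open>For a neighbour \<open>w\<close> of \<open>v\<close>, the length of a longest path from
  \<open>v\<close> with first edge \<open>{v, w}\<close>; this edge is counted.\<close>

definition branch :: "'a \<Rightarrow> 'a \<Rightarrow> nat" where
  "branch v w = lmax v {z \<in> V. nxt v z = w}"

text \<open>If \<open>s\<close> and \<open>t\<close> have distance at least 2, this is the component
  between the two end edges of their path; it is empty if they are adjacent.\<close>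

definition between :: "'a \<Rightarrow> 'a \<Rightarrow> 'a set" where
  "between s t = {z \<in> V. nxt s z = nxt s t \<and> nxt t z = nxt t s}"

text \<open>For distance at least 2, the length of a longest path from \<open>s\<close> that starts
  towards \<open>t\<close> but avoids the last edge into \<open>t\<close>; the first edge is
  counted.\<close>

definition inner :: "'a \<Rightarrow> 'a \<Rightarrow> nat" where
  "inner s t = lmax s (between s t)"

definition side :: "'a \<Rightarrow> 'a set \<Rightarrow> nat" where
  "side v X = lmax v {z \<in> V. nxt v z \<notin> X}"

text \<open>The alternative \<open>branch v w = 0\<close> admits a dummy vertex when no branch is
  left, such as the sentinel of the program.\<close>

definition best_branch :: "'a \<Rightarrow> 'a set \<Rightarrow> 'a \<Rightarrow> bool" where
  "best_branch v X w \<longleftrightarrow> (w \<in> V - X \<or> branch v w = 0) \<and> (\<forall>w'\<in>V - X. branch v w' \<le> branch v w)"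

lemma branch_ge_iff: "k \<le> branch v w \<longleftrightarrow> k = 0 \<or> (\<exists>z\<in>V. nxt v z = w \<and> k \<le> dst v z)"
  unfolding branch_def by (subst lmax_ge_iff) auto

lemma inner_ge_iff: "k \<le> inner s t \<longleftrightarrow> k = 0 \<or> (\<exists>z\<in>between s t. k \<le> dst s z)"
  unfolding inner_def by (subst lmax_ge_iff) (auto simp: between_def)

lemma side_ge_iff: "k \<le> side v X \<longleftrightarrow> k = 0 \<or> (\<exists>z\<in>V. nxt v z \<notin> X \<and> k \<le> dst v z)"
  unfolding side_def by (subst lmax_ge_iff) auto

lemma branch_pos_iff:
  assumes "v \<in> V"
  shows "0 < branch v w \<longleftrightarrow> {v, w} \<in> E"
proof
  assume "0 < branch v w"
  then obtain z where "z \<in> V" "nxt v z = w" "1 \<le> dst v z"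
    using branch_ge_iff[of 1 v w] by auto
  then show "{v, w} \<in> E" using edge_nxt[OF assms] dst_self[OF assms] by (cases "v = z") auto
next
  assume e: "{v, w} \<in> E"
  then have "w \<in> V" "nxt v w = w" "1 \<le> dst v w" using edge nxt_edge dst_edge by auto
  then have "1 \<le> branch v w" using branch_ge_iff[of 1 v w] by auto
  then show "0 < branch v w" by simp
qed

lemma side_best:
  assumes "v \<in> V" "v \<notin> X" "best_branch v X w"
  shows "side v X = branch v w"
proof -
  have "k \<le> side v X \<longleftrightarrow> k \<le> branch v w" for k
  proof (cases "k = 0")
    case False
    show ?thesis
    proof
      assume "k \<le> side v X"
      then obtain z where z: "z \<in> V" "nxt v z \<notin> X" "k \<le> dst v z"
        using side_ge_iff[of k v X] False by auto
      then have "k \<le> branch v (nxt v z)" using branch_ge_iff[of k v "nxt v z"] by auto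
      also have "\<dots> \<le> branch v w" using assms z by (auto simp: best_branch_def)
      finally show "k \<le> branch v w" .
    next
      assume "k \<le> branch v w"
      then show "k \<le> side v X" using branch_ge_iff[of k v w] side_ge_iff[of k v X] assms False
        by (auto simp: best_branch_def)
    qed
  qed simp
  then show ?thesis by (rule eq_by_lower)
qed

lemma inner_adjacent:
  assumes "{s, t} \<in> E"
  shows "inner s t = 0"
proof -
  have "between s t = {}"
    using nxt_side[OF assms] nxt_edge[OF assms] nxt_edge[OF edge_sym[OF assms]] by (auto simp: between_def)
  then show ?thesis by (simp add: inner_def lmax_def)
qed

end

text \<open>The path from \<open>s\<close> to \<open>t\<close> is \<open>s, v, \<dots>, y, t\<close>, possibly with \<open>v = y\<close>.\<close>

locale far_pair = routed_tree V E nxt dst for V :: "'a set" and E nxt dst +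
  fixes s t v y :: 'a
  assumes s: "s \<in> V" and t: "t \<in> V" and dst2: "2 \<le> dst s t"
    and v_def: "v = nxt s t" and y_def: "y = nxt t s"
begin

lemma flip: "far_pair V E nxt dst t s y v"
  using s t dst2 v_def y_def dst_sym by unfold_locales auto

lemma st: "s \<noteq> t"
  using dst2 dst_self s by auto

lemma sv: "{s, v} \<in> E"
  using edge_nxt s t st v_def by auto

lemma vV: "v \<in> V" "s \<noteq> v"
  using edge[OF sv] by auto

lemma vt: "v \<noteq> t"
  using dst2 dst_edge[OF sv] by auto

lemma dst_vt: "dst s t = Suc (dst v t)"
  using dst_nxt s t st v_def by auto

lemma nxt_t_v: "nxt t v = y"
  using nxt_const[OF sv t] st vt y_def by auto

lemma dst_vy: "dst s t = dst v y + 2"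
proof -
  have "dst t v = Suc (dst y v)" using dst_nxt[of t v] t vV vt nxt_t_v by auto
  moreover have "y \<in> V" using y_def s t by simp
  ultimately show ?thesis using dst_vt dst_sym[of t v] dst_sym[of v y] t vV by simp
qed

abbreviation (input) cut :: "'a set set" where
  "cut \<equiv> {{s, v}, {t, y}}"

lemma ty: "{t, y} \<in> E"
  using far_pair.sv[OF flip] .

lemma yV: "y \<in> V" "t \<noteq> y"
  using edge[OF ty] by auto

lemma ys: "y \<noteq> s"
  using far_pair.vt[OF flip] .

lemma nxt_s_y: "nxt s y = v"
  using far_pair.nxt_t_v[OF flip] .

lemma cut_sub: "cut \<subseteq> E"
  using sv ty by auto

lemma comp_cut: "a \<in> V \<Longrightarrow> comp cut a =
    {z \<in> V. (nxt s a = v \<longleftrightarrow> nxt s z = v) \<and> (nxt t a = y \<longleftrightarrow> nxt t z = y)}"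
proof -
  assume "a \<in> V"
  have "comp {} a = V" by (auto simp: comp_def)
  moreover have "comp {{t, y}} a = {z \<in> comp {} a. nxt t a = y \<longleftrightarrow> nxt t z = y}"
    by (rule comp_insert) (use ty \<open>a \<in> V\<close> in auto)
  moreover have "comp cut a = {z \<in> comp {{t, y}} a. nxt s a = v \<longleftrightarrow> nxt s z = v}"
    by (rule comp_insert) (use sv ty \<open>a \<in> V\<close> in auto)
  ultimately show ?thesis by auto
qed

lemma comp_v: "comp cut v = between s t"
  using comp_cut[OF vV(1)] nxt_edge[OF sv] nxt_t_v v_def y_def by (auto simp: between_def)

lemma comp_y: "comp cut y = between s t"
  using comp_cut[OF yV(1)] nxt_edge[OF ty] nxt_s_y v_def y_def by (auto simp: between_def)

lemma comp_s: "comp cut s = {z \<in> V. nxt v z = s}"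
proof -
  have "nxt t z = y" if "z \<in> V" "nxt s z \<noteq> v" for z
    using nxt_beyond[of t s z] that s t st v_def y_def by auto
  then show ?thesis using comp_cut[OF s] nxt_self[OF s] vV nxt_side[OF sv] y_def by auto
qed

text \<open>The tabulated lengths include the opening move, hence the \<open>Suc\<close>. As it
  occurs for both players, these lengths may be compared in place of the numbers of remaining
  moves.\<close>

lemma far_s: "branch v s = Suc (far cut s)"
proof -
  have "dst v z = Suc (dst s z)" if "z \<in> V" "nxt v z = s" for z
    using dst_nxt[of v z] that vV nxt_self[of v] by auto
  moreover have "s \<in> {z \<in> V. nxt v z = s}" using s nxt_edge[OF edge_sym[OF sv]] by auto
  ultimately show ?thesis
    unfolding branch_def far_eq_lmax[OF s] comp_s by (intro lmax_Suc) auto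
qed

lemma dst_between: "z \<in> between s t \<Longrightarrow> dst s z = Suc (dst v z)"
  using dst_nxt[of s z] s nxt_self[of s] vV v_def by (cases "s = z") (auto simp: between_def)

lemma v_between: "v \<in> between s t"
  using comp_v comp_self vV by auto

lemma far_v: "inner s t = Suc (far cut v)"
  unfolding inner_def far_eq_lmax[OF vV(1)] comp_v
  by (intro lmax_Suc dst_between) (use v_between in \<open>auto simp: between_def\<close>)

end

section \<open>Separated tokens, and recursions for the inner length\<close>

context far_pair
begin

lemmas far_t = far_pair.far_s[OF flip] and far_y = far_pair.far_v[OF flip]

lemma cut_flip: "{{t, y}, {s, v}} = cut"
  by auto

text \<open>The mover stands at \<open>s\<close> or \<open>v\<close> and the opponent at
  \<open>t\<close> or \<open>y\<close>, according to the directions of their openings. Three of the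
  four combinations separate the tokens and are settled here and in the next two lemmas; the fourth
  is \<open>facing\<close>.\<close>

lemma win_apart: "win (E - cut) s t \<longleftrightarrow> branch y t < branch v s"
proof -
  have "t \<notin> comp cut s" using comp_s nxt_side[OF sv t] v_def by auto
  then show ?thesis using win_separated[OF cut_sub s t] far_s far_t by (simp add: cut_flip)
qed

lemma win_behind: "win (E - cut) v t \<longleftrightarrow> branch y t < inner s t"
proof -
  have "t \<notin> comp cut v" using comp_v nxt_self[OF t] yV y_def by (auto simp: between_def)
  then show ?thesis using win_separated[OF cut_sub vV(1) t] far_v far_t by (simp add: cut_flip)
qed

lemma win_ahead: "win (E - cut) s y \<longleftrightarrow> inner t s < branch v s"
proof -
  have "y \<notin> comp cut s" using comp_s nxt_side[OF sv yV(1)] nxt_s_y by auto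
  then show ?thesis using win_separated[OF cut_sub s yV(1)] far_s far_y by (simp add: cut_flip)
qed

text \<open>After the edge from \<open>s\<close> to \<open>v\<close>, a path that stays between the
  end edges either turns off at \<open>v\<close> or goes on towards \<open>t\<close>.\<close>

lemma inner_step_left:
  "inner s t = Suc (max (side v {s, nxt v t}) (inner v t))"
proof -
  have sub: "between s t = {z \<in> V. nxt v z \<notin> {s, nxt v t}} \<union> between v t"
  proof (intro set_eqI iffI)
    fix z assume "z \<in> between s t"
    then show "z \<in> {z \<in> V. nxt v z \<notin> {s, nxt v t}} \<union> between v t"
      using nxt_side[OF sv] v_def y_def nxt_t_v by (auto simp: between_def)
  next
    fix z assume z: "z \<in> {z \<in> V. nxt v z \<notin> {s, nxt v t}} \<union> between v t"
    then have zV: "z \<in> V" by (auto simp: between_def)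
    have "nxt v t \<noteq> s" using nxt_side[OF sv t] v_def by auto
    then have "nxt v z \<noteq> s" using z by (auto simp: between_def)
    then have 1: "nxt s z = v" using nxt_side[OF sv zV] by auto
    have "nxt t z = y" using z nxt_beyond[of t v z] nxt_t_v vt t vV by (auto simp: between_def)
    then show "z \<in> between s t" using 1 zV v_def y_def by (auto simp: between_def)
  qed
  have "k \<le> inner s t \<longleftrightarrow> k \<le> Suc (max (side v {s, nxt v t}) (inner v t))" for k
  proof (cases k)
    case (Suc l)
    have "k \<le> inner s t \<longleftrightarrow> (\<exists>z\<in>between s t. l \<le> dst v z)"
      using inner_ge_iff[of k s t] dst_between Suc by auto
    also have "\<dots> \<longleftrightarrow> l \<le> side v {s, nxt v t} \<or> l \<le> inner v t"
    proof (cases "l = 0")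
      case True
      then show ?thesis using v_between by auto
    next
      case False
      then show ?thesis unfolding sub using side_ge_iff[of l v] inner_ge_iff[of l v t] by auto
    qed
    finally show ?thesis using Suc by auto
  qed simp
  then show ?thesis by (rule eq_by_lower)
qed

text \<open>Here a path is classified at \<open>y\<close>: it either stays short of
  \<open>y\<close>, or runs to \<open>y\<close> and possibly turns off there. This refers to the
  pair \<open>(s, y)\<close> instead of \<open>(v, t)\<close>, which is the one available when
  \<open>t\<close> is the vertex attached last.\<close>

lemma inner_step_right:
  "inner s t = max (inner s y) (dst s y + side y {t, nxt y s})"
proof -
  have sub: "between s t = {z \<in> V. nxt y z \<notin> {t, nxt y s}} \<union> between s y"
  proof (intro set_eqI iffI)
    fix z assume "z \<in> between s t"
    then show "z \<in> {z \<in> V. nxt y z \<notin> {t, nxt y s}} \<union> between s y"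
      using nxt_side[OF ty] v_def y_def nxt_s_y by (auto simp: between_def)
  next
    fix z assume z: "z \<in> {z \<in> V. nxt y z \<notin> {t, nxt y s}} \<union> between s y"
    then have zV: "z \<in> V" by (auto simp: between_def)
    have "nxt y s \<noteq> t" using nxt_side[OF ty s] y_def by auto
    then have "nxt y z \<noteq> t" using z by (auto simp: between_def)
    then have 1: "nxt t z = y" using nxt_side[OF ty zV] by auto
    have "nxt s z = v" using z nxt_beyond[of s y z] nxt_s_y ys s yV by (auto simp: between_def)
    then show "z \<in> between s t" using 1 zV v_def y_def by (auto simp: between_def)
  qed
  have d: "dst s z = dst s y + dst y z" if "z \<in> V" "nxt y z \<noteq> nxt y s" for z
    using dst_add[of s y z] that s yV by auto
  have y: "y \<in> V" "nxt y y \<noteq> t" "nxt y y \<noteq> nxt y s"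
    using yV nxt_self[of y] nxt_eq_self[of y s] ys s by auto
  have "k \<le> inner s t \<longleftrightarrow> k \<le> max (inner s y) (dst s y + side y {t, nxt y s})" for k
  proof (cases "k = 0")
    case False
    have "k \<le> dst s y + side y {t, nxt y s} \<longleftrightarrow> (\<exists>z\<in>V. nxt y z \<notin> {t, nxt y s} \<and> k \<le> dst s z)"
    proof (cases "k \<le> dst s y")
      case True
      then show ?thesis using y by auto
    next
      case F: False
      have "k \<le> dst s y + side y {t, nxt y s} \<longleftrightarrow> k - dst s y \<le> side y {t, nxt y s}" by auto
      also have "\<dots> \<longleftrightarrow> (\<exists>z\<in>V. nxt y z \<notin> {t, nxt y s} \<and> k - dst s y \<le> dst y z)"
        using F by (subst side_ge_iff) auto
      also have "\<dots> \<longleftrightarrow> (\<exists>z\<in>V. nxt y z \<notin> {t, nxt y s} \<and> k \<le> dst s z)"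
        using d by (intro bex_cong) auto
      finally show ?thesis .
    qed
    then show ?thesis using False inner_ge_iff[of k s t] inner_ge_iff[of k s y] sub by auto
  qed simp
  then show ?thesis by (rule eq_by_lower)
qed

end


subsection \<open>Tokens facing each other\<close>

definition (in routed_tree) facing :: "'a \<Rightarrow> 'a \<Rightarrow> bool" where
  "facing s t \<longleftrightarrow> win (E - {{s, nxt s t}, {t, nxt t s}}) (nxt s t) (nxt t s)"

context far_pair
begin

lemma next_neq: "nxt v t \<noteq> s" "nxt v t \<noteq> v" "{v, nxt v t} \<in> E"
  using nxt_side[OF sv t] v_def nxt_eq_self[of v t] vV t vt edge_nxt[of v t] by auto

lemma next_end: "nxt v t = t \<longleftrightarrow> v = y"
  using nxt_edge[of t v] edge_sym[OF next_neq(3)] nxt_t_v nxt_edge[OF edge_sym[OF ty]] by auto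

lemma side_branch_between:
  assumes "z \<in> V" "nxt v z \<notin> {s, nxt v t}"
  shows "z \<in> between s t"
  using nxt_side[OF sv assms(1)] nxt_beyond[of t v z] assms nxt_t_v vt t vV v_def y_def
  by (auto simp: between_def)

text \<open>The edge \<open>{v, w}\<close> separates the tokens. The opponent's component consists
  of the part between \<open>t\<close> and \<open>v\<close> and of the other side branches at
  \<open>v\<close>, which are \<open>dst s t - 2\<close> steps away from \<open>y\<close>. As
  \<open>inner t v\<close> counts the used edge at \<open>t\<close> and the branch counts the edge
  to \<open>w\<close>, a tie is good enough in the first comparison; the second length starts at
  \<open>y\<close> and must be strictly smaller.\<close>

lemma win_leave:
  assumes "{v, w} \<in> E" "w \<noteq> s" "w \<noteq> nxt v t"
  shows "\<not> win (E - cut - {{v, w}}) y w \<longleftrightarrow>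
    inner t v \<le> branch v w \<and> dst s t - 2 + side v {s, nxt v t, w} < branch v w"
proof -
  let ?U = "insert {v, w} cut" and ?v = "nxt v t"
  have wV: "w \<in> V" "w \<noteq> v" using edge[OF assms(1)] by auto
  have new: "{v, w} \<notin> cut"
    using assms vt next_end vV by (auto simp: doubleton_eq_iff)
  have sub: "?U \<subseteq> E" using cut_sub assms by auto
  have cw: "comp ?U w = {z \<in> V. nxt v z = w}"
    using comp_step[OF cut_sub assms(1) new] comp_v side_branch_between assms
    by (auto simp: between_def)
  have vy: "v = y \<or> nxt v y = ?v"
    using nxt_const[OF ty vV(1)] vt by metis
  have "comp ?U y = {z \<in> between s t. nxt v z \<noteq> w}"
    using comp_insert[OF cut_sub assms(1) yV(1)] comp_y vy nxt_self[OF vV(1)] wV assms by auto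
  also have "\<dots> = between t v \<union> {z \<in> V. nxt v z \<notin> {s, ?v, w}}"
  proof (intro set_eqI iffI)
    fix z assume "z \<in> {z \<in> between s t. nxt v z \<noteq> w}"
    then show "z \<in> between t v \<union> {z \<in> V. nxt v z \<notin> {s, ?v, w}}"
      using nxt_side[OF sv] v_def y_def nxt_t_v by (auto simp: between_def)
  next
    fix z assume z: "z \<in> between t v \<union> {z \<in> V. nxt v z \<notin> {s, ?v, w}}"
    show "z \<in> {z \<in> between s t. nxt v z \<noteq> w}"
    proof (cases "z \<in> between t v")
      case True
      then have "z \<in> V" "nxt t z = y" "nxt v z = ?v" using nxt_t_v by (auto simp: between_def)
      then show ?thesis using nxt_side[OF sv, of z] next_neq assms v_def y_def by (auto simp: between_def)
    next
      case False
      then show ?thesis using z side_branch_between by auto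
    qed
  qed
  finally have cy: "comp ?U y = between t v \<union> {z \<in> V. nxt v z \<notin> {s, ?v, w}}" .
  have "y \<notin> comp ?U w" using cw vy nxt_self[OF vV(1)] wV assms by auto
  then have "w \<notin> comp ?U y" using comp_eq[of w ?U y] comp_self[OF yV(1), of ?U] by auto
  then have win: "win (E - ?U) y w \<longleftrightarrow> far ?U w < far ?U y"
    using win_separated[OF sub yV(1) wV(1)] by simp
  have "dst v z = Suc (dst w z)" if "z \<in> V" "nxt v z = w" for z
    using dst_nxt[of v z] that vV nxt_self[of v] wV by auto
  moreover have "w \<in> {z \<in> V. nxt v z = w}" using wV nxt_edge[OF assms(1)] by auto
  ultimately have far_w: "branch v w = Suc (far ?U w)"
    unfolding branch_def far_eq_lmax[OF wV(1)] cw by (intro lmax_Suc) auto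
  \<comment> \<open>Towards anything not in the direction of \<open>nxt v t\<close>, the path from
    \<open>y\<close> passes through \<open>v\<close>.\<close>
  have d: "dst y z = dst s t - 2 + dst v z" if "z \<in> V" "nxt v z \<noteq> ?v" for z
    using dst_add[of y v z] vy that yV vV dst_vy dst_sym[of y v] by auto
  have d': "dst t z = Suc (dst y z)" if "z \<in> between t v" for z
    using dst_nxt[of t z] that t nxt_self[of t] yV nxt_t_v by (cases "t = z") (auto simp: between_def)
  have vin: "v \<in> {z \<in> V. nxt v z \<notin> {s, ?v, w}}"
    using nxt_self[OF vV(1)] vV wV next_neq by auto
  have far_y_le: "far ?U y \<le> k \<longleftrightarrow> inner t v \<le> Suc k \<and> dst s t - 2 + side v {s, ?v, w} \<le> k" for k
  proof -
    have "far ?U y \<le> k \<longleftrightarrow> \<not> Suc k \<le> far ?U y" by auto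
    also have "\<dots> \<longleftrightarrow> (\<forall>z\<in>comp ?U y. dst y z \<le> k)"
      using far_ge_iff[OF yV(1), of "Suc k" ?U] by (auto simp: not_less_eq_eq)
    also have "\<dots> \<longleftrightarrow> (\<forall>z\<in>between t v. dst t z \<le> Suc k) \<and>
        (\<forall>z\<in>V. nxt v z \<notin> {s, ?v, w} \<longrightarrow> dst s t - 2 + dst v z \<le> k)"
      unfolding cy ball_Un using d' by (intro conj_cong) (auto simp: d)
    also have "(\<forall>z\<in>between t v. dst t z \<le> Suc k) \<longleftrightarrow> inner t v \<le> Suc k"
      using inner_ge_iff[of "Suc (Suc k)" t v] by (auto simp: not_less_eq_eq)
    also have "(\<forall>z\<in>V. nxt v z \<notin> {s, ?v, w} \<longrightarrow> dst s t - 2 + dst v z \<le> k) \<longleftrightarrow>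
        dst s t - 2 + side v {s, ?v, w} \<le> k" (is "?L \<longleftrightarrow> ?R")
    proof
      assume ?R
      moreover have "dst v z \<le> side v {s, ?v, w}" if "z \<in> V" "nxt v z \<notin> {s, ?v, w}" for z
        using side_ge_iff[of "dst v z" v "{s, ?v, w}"] that by blast
      ultimately show ?L by fastforce
    next
      assume L: ?L
      show ?R
      \<comment> \<open>The value 0 could also stand for an empty set, but \<open>v\<close> itself
        belongs to the set and yields the bound \<open>dst s t - 2\<close>.\<close>
      proof (cases "side v {s, ?v, w} = 0")
        case True
        then show ?thesis using L vin dst_self[OF vV(1)] by force
      next
        case False
        then obtain z where "z \<in> V" "nxt v z \<notin> {s, ?v, w}" "side v {s, ?v, w} \<le> dst v z"
          using side_ge_iff[of "side v {s, ?v, w}" v "{s, ?v, w}"] by auto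
        then show ?thesis using L by fastforce
      qed
    qed
    finally show ?thesis .
  qed
  have "E - ?U = E - cut - {{v, w}}" by auto
  then show ?thesis using win far_w far_y_le[of "far ?U w"] by (auto simp: not_less less_Suc_eq_le)
qed

text \<open>After a step forward the opponent is to move from \<open>y\<close> against a token at
  \<open>nxt v t\<close>, as in the facing position of the pair \<open>(t, v)\<close>. The
  additional used edge \<open>{s, v}\<close> lies behind \<open>v\<close> and is discarded with
  \<open>win_comp\<close>.\<close>

lemma win_advance:
  assumes "nxt v t \<noteq> t"
  shows "win (E - cut - {{v, nxt v t}}) y (nxt v t) \<longleftrightarrow> facing t v"
proof -
  let ?v = "nxt v t"
  have "v \<noteq> y" using next_end assms by simp
  then have "1 \<le> dst v y" using dst_eq_0[OF vV(1) yV(1)] by linarith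
  then interpret n: far_pair V E nxt dst t v y ?v
    using t vV dst_vy dst_vt dst_sym[of t v] nxt_t_v by unfold_locales auto
  let ?C = "{{t, y}, {v, ?v}}"
  have s_side: "nxt s z = v" if "z \<in> between t v" for z
    using that nxt_side[OF sv, of z] next_neq by (auto simp: between_def)
  have c: "comp (insert {s, v} ?C) a = comp ?C a" if "a \<in> V" "comp ?C a = between t v" for a
    using comp_insert[OF n.cut_sub sv that(1)] that s_side comp_self[OF that(1), of ?C] by auto
  have "win (E - insert {s, v} ?C) y ?v = win (E - ?C) y ?v"
    by (rule win_comp) (use c[OF yV(1)] c[OF n.yV(1)] n.comp_v n.comp_y n.cut_sub sv yV n.yV in auto)
  moreover have "E - insert {s, v} ?C = E - cut - {{v, ?v}}" by auto
  ultimately show ?thesis by (simp add: facing_def nxt_t_v)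
qed

text \<open>Only leaving along the longest side branch can win: if the branch at \<open>w\<close> is shorter than
  another one, the opponent can follow and use the longer one.\<close>

lemma facing_step:
  assumes b1: "best_branch v {s, nxt v t} w1" and b2: "best_branch v {s, nxt v t, w1} w2"
  shows "facing s t \<longleftrightarrow>
    inner t v \<le> branch v w1 \<and> dst s t - 2 + branch v w2 < branch v w1 \<or>
    nxt v t \<noteq> t \<and> \<not> facing t v"
proof -
  let ?v = "nxt v t"
  define leave where "leave w \<longleftrightarrow> inner t v \<le> branch v w \<and> dst s t - 2 + side v {s, ?v, w} < branch v w" for w
  \<comment> \<open>A step forward is possible unless the next edge is \<open>{t, y}\<close>, which
    is already used; this is the condition \<open>?v \<noteq> t\<close>.\<close>
  have moves: "{v, w} \<in> E - cut \<longleftrightarrow> {v, w} \<in> E \<and> w \<noteq> s \<and> w \<noteq> ?v \<or> w = ?v \<and> ?v \<noteq> t" for w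
    using next_neq next_end vV vt nxt_edge[OF ty] nxt_edge[of v t]
    by (auto simp: doubleton_eq_iff)
  have "facing s t \<longleftrightarrow> (\<exists>w. {v, w} \<in> E - cut \<and> \<not> win (E - cut - {{v, w}}) y w)"
    using win_unfold[of "E - cut" v y] finE by (simp add: facing_def flip: v_def y_def)
  also have "\<dots> \<longleftrightarrow> (\<exists>w. {v, w} \<in> E \<and> w \<noteq> s \<and> w \<noteq> ?v \<and> leave w) \<or> ?v \<noteq> t \<and> \<not> facing t v"
    unfolding moves leave_def using win_leave win_advance by blast
  also have "(\<exists>w. {v, w} \<in> E \<and> w \<noteq> s \<and> w \<noteq> ?v \<and> leave w) \<longleftrightarrow> leave w1" (is "?L \<longleftrightarrow> _")
  proof
    assume ?L
    then obtain w where w: "{v, w} \<in> E" "w \<noteq> s" "w \<noteq> ?v" "leave w" by blast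
    have "w \<in> V" using edge[OF w(1)] by simp
    then have le: "branch v w \<le> branch v w1" using b1 w by (auto simp: best_branch_def)
    have "w = w1"
    proof (rule ccontr)
      assume ne: "w \<noteq> w1"
      have "0 < branch v w" using branch_pos_iff[OF vV(1)] w(1) by simp
      then have "branch v w1 \<noteq> 0" using le by linarith
      then obtain z where z: "z \<in> V" "nxt v z = w1" "branch v w1 \<le> dst v z"
        using branch_ge_iff[of "branch v w1" v w1] by auto
      have "w1 \<in> V - {s, ?v}" using b1 \<open>branch v w1 \<noteq> 0\<close> by (auto simp: best_branch_def)
      then have "branch v w1 \<le> side v {s, ?v, w}" using side_ge_iff[of "branch v w1" v] z ne by auto
      then show False using w(4) le by (auto simp: leave_def)
    qed
    then show "leave w1" using w by simp
  next
    assume l: "leave w1"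
    then have pos: "0 < branch v w1" by (auto simp: leave_def)
    then have "w1 \<in> V - {s, ?v}" using b1 by (auto simp: best_branch_def)
    then show ?L using l pos branch_pos_iff[OF vV(1)] by auto
  qed
  \<comment> \<open>Among the side branches left to the opponent, the one at \<open>w2\<close> is
    longest. Without any side branch both sides fail because of the strict inequality.\<close>
  also have "leave w1 \<longleftrightarrow> inner t v \<le> branch v w1 \<and> dst s t - 2 + branch v w2 < branch v w1"
  proof (cases "branch v w1 = 0")
    case False
    then have "v \<noteq> w1" using branch_pos_iff[OF vV(1), of w1] edge by blast
    then have "side v {s, ?v, w1} = branch v w2"
      using side_best[OF vV(1) _ b2] vV next_neq by auto
    then show ?thesis by (simp add: leave_def)
  qed (simp add: leave_def)
  finally show ?thesis .
qed

end

section \<open>Openings that can be refuted\<close>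

context routed_tree
begin

text \<open>P2 has a winning reply to the opening from \<open>p\<close> to \<open>q\<close>. In the
  first disjunct P1 has moved towards the edge of the reply, in the second away from it; the
  alternatives within each are the two directions of the reply. The inequalities are weak because P1
  is to move and loses ties.\<close>

definition refuted :: "'a \<Rightarrow> 'a \<Rightarrow> bool" where
  "refuted p q \<longleftrightarrow>
    (\<exists>t\<in>V. 2 \<le> dst p t \<and> q = nxt p t \<and> (\<not> facing p t \<or> inner p t \<le> branch (nxt t p) t)) \<or>
    (\<exists>t\<in>V. 2 \<le> dst q t \<and> p = nxt q t \<and> (branch p q \<le> branch (nxt t q) t \<or> branch p q \<le> inner t q))"

text \<open>Each of the two edges lies entirely on one side of the other, which singles out the
  outer ends \<open>s\<close> and \<open>t\<close>.\<close>

lemma edge_pair_path: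
  assumes "{u, v} \<in> E" "{x, y} \<in> E" "{x, y} \<noteq> {u, v}"
  obtains s t where "s \<in> V" "t \<in> V" "2 \<le> dst s t" "s = u \<and> v = nxt s t \<or> s = v \<and> u = nxt s t"
    "t = x \<and> y = nxt t s \<or> t = y \<and> x = nxt t s"
proof -
  have V: "u \<in> V" "v \<in> V" "x \<in> V" "y \<in> V" "u \<noteq> v" "x \<noteq> y" using edge[OF assms(1)] edge[OF assms(2)] by auto
  have same: "nxt p x' = q \<longleftrightarrow> nxt p y' = q"
    if "{p, q} \<in> E" "{x', y'} \<in> E" "{x', y'} \<noteq> {p, q}" for p q x' y'
  proof -
    have p: "p \<in> V" "p \<noteq> q" "nxt p p = p" using edge[OF that(1)] nxt_self by auto
    consider "p = x'" | "p = y'" | "p \<noteq> x'" "p \<noteq> y'" by blast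
    then show ?thesis
    proof cases
      case 1
      then have "nxt p y' = y'" "y' \<noteq> q" using that nxt_edge[OF that(2)] by auto
      then show ?thesis using 1 p by auto
    next
      case 2
      then have "nxt p x' = x'" "x' \<noteq> q" using that nxt_edge[OF edge_sym[OF that(2)]] by (auto simp: insert_commute)
      then show ?thesis using 2 p by auto
    next
      case 3
      then show ?thesis using nxt_const[OF that(2) p(1)] by simp
    qed
  qed
  \<comment> \<open>\<open>nxt u x = v\<close> says that the second edge lies beyond
    \<open>v\<close>, so that \<open>u\<close> is the outer end of the first.\<close>
  define s s' where "s = (if nxt u x = v then u else v)" and "s' = (if nxt u x = v then v else u)"
  define t t' where "t = (if nxt x u = y then x else y)" and "t' = (if nxt x u = y then y else x)"
  have ss: "{s, s'} = {u, v}" "{s, s'} \<in> E" using assms(1) by (auto simp: s_def s'_def insert_commute)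
  have tt: "{t, t'} = {x, y}" "{t, t'} \<in> E" using assms(2) by (auto simp: t_def t'_def insert_commute)
  have ne: "{t, t'} \<noteq> {s, s'}" using ss tt assms(3) by simp
  have "nxt s x = s'" using nxt_side[OF assms(1) V(3)] by (auto simp: s_def s'_def)
  then have s: "nxt s t = s'" using same[OF ss(2) assms(2)] ss assms(3) by (auto simp: t_def)
  have "nxt t u = t'" using nxt_side[OF assms(2) V(1)] by (auto simp: t_def t'_def)
  then have t: "nxt t s = t'" using same[OF tt(2) assms(1)] tt assms(3) by (auto simp: s_def)
  have V': "s \<in> V" "t \<in> V" "s \<noteq> s'" using V by (auto simp: s_def s'_def t_def)
  have "s \<noteq> t" using s nxt_self V' by auto
  \<comment> \<open>At distance 1 both edges would be \<open>{s, t}\<close>.\<close>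
  moreover have "dst s t \<noteq> 1"
    using dst_eq_1[OF V'(1,2)] dst_eq_1[OF V'(2,1)] dst_sym[OF V'(1,2)] s t ne by (auto simp: insert_commute)
  ultimately have "2 \<le> dst s t" using dst_eq_0[OF V'(1,2)] by linarith
  moreover have "s = u \<and> v = nxt s t \<or> s = v \<and> u = nxt s t" unfolding s by (simp add: s_def s'_def)
  moreover have "t = x \<and> y = nxt t s \<or> t = y \<and> x = nxt t s" unfolding t by (simp add: t_def t'_def)
  ultimately show thesis using that[of s t] V' by blast
qed

lemma P1_win_iff_refuted: "P1_win E \<longleftrightarrow> (\<exists>p q. {p, q} \<in> E \<and> \<not> refuted p q)"
proof -
  have "(\<forall>x y. {x, y} \<in> E \<and> {x, y} \<noteq> {p, q} \<longrightarrow> win (E - {{p, q}, {x, y}}) q y) \<longleftrightarrow> \<not> refuted p q"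
    (is "?L \<longleftrightarrow> _") if pq: "{p, q} \<in> E" for p q
  proof
    assume L: ?L
    show "\<not> refuted p q"
    proof
      assume "refuted p q"
      then consider t where "t \<in> V" "2 \<le> dst p t" "q = nxt p t" "\<not> facing p t \<or> inner p t \<le> branch (nxt t p) t"
        | t where "t \<in> V" "2 \<le> dst q t" "p = nxt q t" "branch p q \<le> branch (nxt t q) t \<or> branch p q \<le> inner t q"
        by (auto simp: refuted_def)
      then show False
      proof cases
        case 1
        then interpret far_pair V E nxt dst p t q "nxt t p"
          using edge[OF pq] by unfold_locales auto
        have ne: "{t, nxt t p} \<noteq> {p, q}" using st vt by (auto simp: doubleton_eq_iff)
        have ne': "{nxt t p, t} \<noteq> {p, q}" using st vt by (auto simp: doubleton_eq_iff)
        have "win (E - cut) q (nxt t p)" using L ty ne by blast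
        moreover have "win (E - cut) q t" using L[rule_format, of "nxt t p" t] edge_sym[OF ty] ne'
          by (simp add: insert_commute)
        ultimately show False using 1(3,4) win_behind by (simp add: facing_def)
      next
        case 2
        then interpret far_pair V E nxt dst q t p "nxt t q"
          using edge[OF pq] by unfold_locales auto
        have ne: "{t, nxt t q} \<noteq> {p, q}" "{nxt t q, t} \<noteq> {p, q}" using st vt by (auto simp: doubleton_eq_iff)
        have c: "{{p, q}, {t, nxt t q}} = cut" "{{p, q}, {nxt t q, t}} = cut" by (auto simp: insert_commute)
        have "win (E - cut) q t" using L[rule_format, of "nxt t q" t] edge_sym[OF ty] ne c by simp
        moreover have "win (E - cut) q (nxt t q)" using L[rule_format, of t "nxt t q"] ty ne c by simp
        ultimately show False using 2(4) win_apart win_ahead by auto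
      qed
    qed
  next
    assume nr: "\<not> refuted p q"
    show ?L
    proof (intro allI impI)
      fix x y assume xy: "{x, y} \<in> E \<and> {x, y} \<noteq> {p, q}"
      obtain s t where pth: "s \<in> V" "t \<in> V" "2 \<le> dst s t" "s = p \<and> q = nxt s t \<or> s = q \<and> p = nxt s t"
        "t = x \<and> y = nxt t s \<or> t = y \<and> x = nxt t s"
        by (rule edge_pair_path[OF pq, of x y]) (use xy in blast)+
      then interpret far_pair V E nxt dst s t "nxt s t" "nxt t s"
        by unfold_locales auto
      have c: "{{p, q}, {x, y}} = cut" using pth(4,5) by (elim disjE conjE) (simp_all add: insert_commute)
      show "win (E - {{p, q}, {x, y}}) q y"
        unfolding c using pth(4)
      proof
        assume p: "s = p \<and> q = nxt s t"
        then have "facing p t" "branch (nxt t p) t < inner p t"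
          using nr pth(2,3) unfolding refuted_def by (auto simp: not_le)
        then show "win (E - cut) q y" using pth(5) p win_behind by (auto simp: facing_def)
      next
        assume q: "s = q \<and> p = nxt s t"
        then have "branch (nxt t q) t < branch p q" "inner t q < branch p q"
          using nr pth(2,3) unfolding refuted_def by (auto simp: not_le)
        then show "win (E - cut) q y" using pth(5) q win_apart win_ahead by auto
      qed
    qed
  qed
  then show ?thesis unfolding P1_win_iff[OF finE] by blast
qed

end

section \<open>Growing the tree\<close>

abbreviation sub_edges :: "'a set set \<Rightarrow> 'a set \<Rightarrow> 'a set set" where
  "sub_edges E S \<equiv> {e \<in> E. e \<subseteq> S}"

text \<open>The path follows \<open>nxt\<close>; the bound on the distances to \<open>v\<close> is
  carried along to show that it never returns to its start and hence is distinct.\<close>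

lemma (in routed_tree) path_exists:
  "u \<in> V \<Longrightarrow> v \<in> V \<Longrightarrow> \<exists>p. p \<noteq> [] \<and> hd p = u \<and> last p = v \<and> distinct p \<and> set p \<subseteq> V \<and>
     (\<forall>x\<in>set p. dst x v \<le> dst u v) \<and> (\<forall>i. Suc i < length p \<longrightarrow> {p ! i, p ! Suc i} \<in> E)"
proof (induction "dst u v" arbitrary: u rule: less_induct)
  case less
  show ?case
  proof (cases "u = v")
    case True
    then show ?thesis using less.prems by (intro exI[of _ "[u]"]) auto
  next
    case False
    let ?w = "nxt u v"
    have d: "dst u v = Suc (dst ?w v)" using dst_nxt less.prems False by simp
    obtain p where p: "p \<noteq> []" "hd p = ?w" "last p = v" "distinct p" "set p \<subseteq> V"
      "\<forall>x\<in>set p. dst x v \<le> dst ?w v" "\<forall>i. Suc i < length p \<longrightarrow> {p ! i, p ! Suc i} \<in> E"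
      using less.hyps[of ?w] d less.prems by auto
    have "u \<notin> set p" using p(6) d by auto
    moreover have "{(u # p) ! i, (u # p) ! Suc i} \<in> E" if "Suc i < length (u # p)" for i
      using that p(1,2,7) edge_nxt[OF less.prems False] by (cases i) (auto simp: hd_conv_nth)
    moreover have "dst x v \<le> dst u v" if "x \<in> set p" for x using p(6) d that by fastforce
    ultimately show ?thesis using p less.prems by (intro exI[of _ "u # p"]) auto
  qed
qed

lemma tree_leaving_edge:
  assumes "tree V E" "S \<subseteq> V" "S \<noteq> {}" "S \<noteq> V"
  obtains a b where "a \<in> S" "b \<in> V - S" "{a, b} \<in> E"
proof (rule ccontr)
  assume no: "\<not> thesis"
  obtain u w where u: "u \<in> S" "w \<in> V" "w \<notin> S" using assms by blast
  then have "(u, w) \<in> {(x, y). {x, y} \<in> E}\<^sup>*"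
    using assms by (auto simp: tree_def connected_graph_def)
  then have "w \<in> S"
  proof (induction)
    case (step y z)
    then have "z \<in> V" using assms(1) by (fastforce simp: tree_def simple_graph_def)
    then show ?case using step no that by auto
  qed (use u in simp)
  then show False using u by simp
qed

text \<open>A path between two attachment points inside \<open>S\<close>, closed through
  \<open>b\<close>, would be a cycle; this is where acyclicity enters.\<close>

lemma tree_attach_unique:
  assumes "tree V E" "routed_tree S (sub_edges E S) nx d"
    and "a \<in> S" "a' \<in> S" "b \<notin> S" "{a, b} \<in> E" "{a', b} \<in> E"
  shows "a = a'"
proof (rule ccontr)
  assume ne: "a \<noteq> a'"
  interpret routed_tree S "sub_edges E S" nx d by fact
  obtain p where p: "p \<noteq> []" "hd p = a" "last p = a'" "distinct p" "set p \<subseteq> S"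
    "\<forall>i. Suc i < length p \<longrightarrow> {p ! i, p ! Suc i} \<in> sub_edges E S"
    using path_exists[OF assms(3,4)] by blast
  have "length p \<noteq> 1" using p ne by (cases p) auto
  moreover have "length p \<noteq> 0" using p(1) by simp
  ultimately have "2 \<le> length p" by linarith
  moreover have "{(b # p) ! i, (b # p) ! Suc i} \<in> E" if "Suc i < length (b # p)" for i
    using that p(1,2,6) assms(6) by (cases i) (auto simp: hd_conv_nth insert_commute)
  ultimately have "cycle E (b # p)" using p assms by (auto simp: cycle_def)
  then show False using assms(1) by (auto simp: tree_def)
qed

lemma sub_edges_insert:
  assumes "tree V E" "routed_tree S (sub_edges E S) nx d" "a \<in> S" "b \<notin> S" "{a, b} \<in> E"
  shows "sub_edges E (insert b S) = insert {a, b} (sub_edges E S)"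
proof
  show "sub_edges E (insert b S) \<subseteq> insert {a, b} (sub_edges E S)"
  proof
    fix e assume e: "e \<in> sub_edges E (insert b S)"
    have "card e = 2" using e assms(1) by (auto simp: tree_def simple_graph_def)
    then obtain x y where xy: "e = {x, y}" "x \<noteq> y" by (auto simp: card_2_iff)
    consider "e \<subseteq> S" | "x = b" "y \<in> S" | "y = b" "x \<in> S" using e xy by auto
    then show "e \<in> insert {a, b} (sub_edges E S)"
    proof cases
      case 1
      then show ?thesis using e by simp
    next
      case 2
      then have "y = a" using tree_attach_unique[OF assms(1,2) _ assms(3,4) _ assms(5), of y] e xy
        by (auto simp: insert_commute)
      then show ?thesis using 2 xy by (simp add: insert_commute)
    next
      case 3
      then have "x = a" using tree_attach_unique[OF assms(1,2) _ assms(3,4) _ assms(5), of x] e xy by auto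
      then show ?thesis using 3 xy by simp
    qed
  qed
  show "insert {a, b} (sub_edges E S) \<subseteq> sub_edges E (insert b S)" using assms by auto
qed

lemma tree_sub_edges_all: "tree V E \<Longrightarrow> sub_edges E V = E"
  by (auto simp: tree_def simple_graph_def)

lemma tree_finite: "tree V E \<Longrightarrow> finite V"
  by (auto simp: tree_def simple_graph_def)

lemma tree_no_loop: "tree V E \<Longrightarrow> sub_edges E {a} = {}"
proof -
  assume "tree V E"
  then have "card e = 2" if "e \<in> E" for e using that by (auto simp: tree_def simple_graph_def)
  then have "\<not> e \<subseteq> {a}" if "e \<in> E" for e using that card_mono[of "{a}" e] by fastforce
  then show ?thesis by auto
qed

text \<open>Growing a subtree serves here to count edges; the program repeats the construction with
  its own tables.\<close>

lemma tree_subtree: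
  assumes "tree V E" "Suc k \<le> card V"
  shows "\<exists>S nx d. S \<subseteq> V \<and> card S = Suc k \<and> card (sub_edges E S) = k \<and> routed_tree S (sub_edges E S) nx d"
  using assms(2)
proof (induction k)
  case 0
  obtain a where "a \<in> V" using assms(1) by (auto simp: tree_def connected_graph_def)
  moreover have "routed_tree {a} (sub_edges E {a}) (\<lambda>x y. x) (\<lambda>x y. 0)"
    unfolding tree_no_loop[OF assms(1)] by (rule routed_tree_single) auto
  ultimately show ?case using tree_no_loop[OF assms(1), of a] by (intro exI[of _ "{a}"]) fastforce
next
  case (Suc k)
  then obtain S nx d where S: "S \<subseteq> V" "card S = Suc k" "card (sub_edges E S) = k"
    and rt: "routed_tree S (sub_edges E S) nx d" by auto
  interpret routed_tree S "sub_edges E S" nx d by fact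
  obtain a b where ab: "a \<in> S" "b \<in> V - S" "{a, b} \<in> E"
    by (rule tree_leaving_edge[OF assms(1) S(1)]) (use S Suc.prems in auto)
  define nx' where "nx' u v = (if u = b then if v = b then b else a
    else if v = b then if u = a then b else nx u a else nx u v)" for u v
  define d' where "d' u v = (if u = b then if v = b then 0 else Suc (d v a)
    else if v = b then Suc (d u a) else d u v)" for u v
  have "routed_tree (insert b S) (insert {a, b} (sub_edges E S)) nx' d'"
    by (rule routed_tree_insert[OF rt ab(1)]) (use ab in \<open>auto simp: nx'_def d'_def\<close>)
  moreover have "sub_edges E (insert b S) = insert {a, b} (sub_edges E S)"
    by (rule sub_edges_insert[OF assms(1) rt]) (use ab in auto)
  moreover have "card (insert {a, b} (sub_edges E S)) = Suc k"
    using S ab finE by (subst card_insert_disjoint) auto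
  moreover have "card (insert b S) = Suc (Suc k)" using S ab finV by simp
  ultimately show ?case using S ab by (intro exI[of _ "insert b S"] exI[of _ nx'] exI[of _ d']) auto
qed

text \<open>With fewer edges than vertices, a loop over \<open>0, ..., n - 1\<close> passes through
  the whole edge list, and the input fits into row 0.\<close>

lemma tree_card_edges:
  assumes "tree V E"
  shows "Suc (card E) = card V"
proof -
  have "V \<noteq> {}" using assms by (auto simp: tree_def connected_graph_def)
  then obtain k where k: "card V = Suc k" using tree_finite[OF assms] by (cases "card V") auto
  then obtain S where "S \<subseteq> V" "card S = card V" "card (sub_edges E S) = k"
    using tree_subtree[OF assms, of k] by auto
  then have "S = V" using tree_finite[OF assms] card_subset_eq by blast
  then show ?thesis using k \<open>card (sub_edges E S) = k\<close> tree_sub_edges_all[OF assms] by simp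
qed


section \<open>The program\<close>

text \<open>
  Registers 2 and 3 are loop counters, the others hold temporary values; the answer is left in
  register 12. One-dimensional tables use row 0 only.
  Tables 0 and 1: the input; 2: visited vertices; 3: vertices in the order of attachment;
  4: \<open>nxt\<close>; 5: \<open>dst\<close>; 6: \<open>branch\<close>; 7 to 10: the ends of the four longest branches at each
  vertex, or \<open>n\<close> where there are fewer; 11: \<open>inner\<close>; 12: \<open>facing\<close>; 13: \<open>refuted\<close>.
\<close>

definition scan :: pg where
  "scan = For 3 (Cnd (Lt (R 3) (R 1))
     (Sq (Set 4 (T 0 Zero (R 3))) (Sq (Set 5 (T 1 Zero (R 3)))
       (Cnd (An (Eq (T 2 Zero (R 4)) One) (Eq (T 2 Zero (R 5)) Zero))
         (Sq (Set 6 (R 4)) (Set 7 (R 5)))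
         (Cnd (An (Eq (T 2 Zero (R 5)) One) (Eq (T 2 Zero (R 4)) Zero))
           (Sq (Set 6 (R 5)) (Set 7 (R 4)))
           Nop))))
     Nop)"

text \<open>Registers 6 and 7 hold an old vertex and the new vertex to be attached to it, as found
  by \<open>scan\<close>.\<close>

definition attach :: pg where
  "attach = For 3 (Cnd (Eq (T 2 Zero (R 3)) One)
     (Sq (Put 4 (R 7) (R 3) (R 6))
       (Sq (Cnd (Eq (R 3) (R 6)) (Put 4 (R 3) (R 7) (R 7)) (Put 4 (R 3) (R 7) (T 4 (R 3) (R 6))))
         (Sq (Put 5 (R 7) (R 3) (Add (T 5 (R 3) (R 6)) One))
           (Put 5 (R 3) (R 7) (Add (T 5 (R 3) (R 6)) One)))))
     Nop)"

definition mark :: pg where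
  "mark = Sq (Put 4 (R 7) (R 7) (R 7)) (Sq (Put 5 (R 7) (R 7) Zero)
     (Sq (Put 2 Zero (R 7) One) (Put 3 Zero (R 2) (R 7))))"

text \<open>A linear scan of all edges for each new vertex is affordable in quadratic time, so no
  adjacency lists are built. The start vertex 0 only has to be marked, because the tables are
  initially zero. Counter 0 is skipped; afterwards the counter is the position of the new vertex in
  the order.\<close>

definition grow :: pg where
  "grow = Sq (Put 2 Zero Zero One)
     (For 2 (Cnd (Lt Zero (R 2)) (Sq scan (Sq attach mark)) Nop))"

section \<open>Correctness of the growing phase\<close>

definition holds_input :: "(nat \<times> nat) list \<Rightarrow> mem \<Rightarrow> bool" where
  "holds_input es m \<longleftrightarrow> fst m 1 = length es \<and>
     (\<forall>i<length es. snd m 0 0 i = fst (es ! i) \<and> snd m 1 0 i = snd (es ! i))"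

lemma run_scan:
  assumes "holds_input es m" "length es \<le> n" "{a, b} \<in> edge_of ` set es"
    and vis: "snd m 2 0 a = 1" "snd m 2 0 b = 0"
  shows "snd m 2 0 (fst (run n scan m) 6) = 1 \<and> snd m 2 0 (fst (run n scan m) 7) = 0 \<and>
    {fst (run n scan m) 6, fst (run n scan m) 7} \<in> edge_of ` set es"
proof -
  define vis where "vis = snd m 2 0"
  define good where "good m' \<longleftrightarrow> vis (fst m' 6) = 1 \<and> vis (fst m' 7) = 0 \<and>
      {fst m' 6, fst m' 7} \<in> edge_of ` set es" for m' :: mem
  define crosses where "crosses i \<longleftrightarrow> (vis (fst (es ! i)) = 1 \<and> vis (snd (es ! i)) = 0) \<or>
      (vis (fst (es ! i)) = 0 \<and> vis (snd (es ! i)) = 1)" for i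
  \<comment> \<open>Later crossing edges overwrite earlier ones, so nothing is claimed about which
    of them is found.\<close>
  define I where "I k m' \<longleftrightarrow> holds_input es m' \<and> snd m' = snd m \<and>
      ((\<exists>i<k. i < length es \<and> crosses i) \<longrightarrow> good m')" for k and m' :: mem
  have edge: "{fst (es ! i), snd (es ! i)} \<in> edge_of ` set es" if "i < length es" for i
  proof -
    have "edge_of (es ! i) = {fst (es ! i), snd (es ! i)}" by (cases "es ! i") simp
    then show ?thesis using that by (metis image_eqI nth_mem)
  qed
  have "I n (run n scan m)"
    unfolding scan_def
  proof (rule run_For[where I = I])
    show "I 0 m" using assms by (simp add: I_def)
    fix k m' assume "k < n" and I: "I k m'"
    then have m': "fst m' 1 = length es" "snd m' = snd m" by (auto simp: I_def holds_input_def)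
    have es: "snd m 0 0 k = fst (es ! k)" "snd m 1 0 k = snd (es ! k)" if "k < length es"
      using that assms(1) by (auto simp: holds_input_def)
    show "I (Suc k) (run n (Cnd (Lt (R 3) (R 1))
     (Sq (Set 4 (T 0 Zero (R 3))) (Sq (Set 5 (T 1 Zero (R 3)))
       (Cnd (An (Eq (T 2 Zero (R 4)) One) (Eq (T 2 Zero (R 5)) Zero))
         (Sq (Set 6 (R 4)) (Set 7 (R 5)))
         (Cnd (An (Eq (T 2 Zero (R 5)) One) (Eq (T 2 Zero (R 4)) Zero))
           (Sq (Set 6 (R 5)) (Set 7 (R 4)))
           Nop))))
     Nop) (setr 3 k m'))"
      using I es edge[of k] m' by (auto simp: I_def holds_input_def good_def crosses_def less_Suc_eq insert_commute
          simp flip: vis_def)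
  qed (auto simp: I_def holds_input_def good_def)
  moreover obtain i where "i < length es" "edge_of (es ! i) = {a, b}"
    using assms(3) by (metis imageE in_set_conv_nth)
  then have "crosses i" using vis by (cases "es ! i") (auto simp: crosses_def vis_def doubleton_eq_iff)
  ultimately show ?thesis using \<open>i < length es\<close> assms(2) by (auto simp: I_def good_def vis_def)
qed

text \<open>Distances below \<open>n\<close> guarantee that adding 1 is never cut off. Writing the
  row and the column of \<open>b\<close> disturbs no entry that is still to be read, as
  \<open>b\<close> is not in \<open>S\<close>.\<close>

lemma run_attach:
  fixes m :: mem and n :: nat
  defines "S \<equiv> {v. v < n \<and> snd m 2 0 v = 1}" and "a \<equiv> fst m 6" and "b \<equiv> fst m 7"
    and "m' \<equiv> run n attach m"
  assumes a: "a \<in> S" and b: "b \<notin> S" "b < n"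
    and d: "\<And>u. u \<in> S \<Longrightarrow> snd m 5 u a < n"
  shows "u \<in> S \<Longrightarrow> v \<in> S \<Longrightarrow> snd m' 4 u v = snd m 4 u v \<and> snd m' 5 u v = snd m 5 u v"
    and "u \<in> S \<Longrightarrow> snd m' 4 b u = a \<and> snd m' 4 u b = (if u = a then b else snd m 4 u a) \<and>
      snd m' 5 b u = Suc (snd m 5 u a) \<and> snd m' 5 u b = Suc (snd m 5 u a)"
proof -
  define I where "I k m' \<longleftrightarrow> fst m' 6 = a \<and> fst m' 7 = b \<and> snd m' 2 = snd m 2 \<and>
      (\<forall>u\<in>S. \<forall>v\<in>S. snd m' 4 u v = snd m 4 u v \<and> snd m' 5 u v = snd m 5 u v) \<and>
      (\<forall>u\<in>S. u < k \<longrightarrow> snd m' 4 b u = a \<and> snd m' 4 u b = (if u = a then b else snd m 4 u a) \<and>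
        snd m' 5 b u = Suc (snd m 5 u a) \<and> snd m' 5 u b = Suc (snd m 5 u a))" for k and m' :: mem
  have ne: "u \<noteq> b" if "u \<in> S" for u using that b by auto
  have "I n (run n attach m)"
    unfolding attach_def
  proof (rule run_For[where I = I])
    show "I 0 m" by (simp add: I_def a_def b_def)
    fix k m' assume k: "k < n" and I: "I k m'"
    then have m': "fst m' 6 = a" "fst m' 7 = b" "snd m' 2 = snd m 2" by (auto simp: I_def)
    let ?p = "Cnd (Eq (T 2 Zero (R 3)) One)
     (Sq (Put 4 (R 7) (R 3) (R 6))
       (Sq (Cnd (Eq (R 3) (R 6)) (Put 4 (R 3) (R 7) (R 7)) (Put 4 (R 3) (R 7) (T 4 (R 3) (R 6))))
         (Sq (Put 5 (R 7) (R 3) (Add (T 5 (R 3) (R 6)) One))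
           (Put 5 (R 3) (R 7) (Add (T 5 (R 3) (R 6)) One)))))
     Nop"
    show "I (Suc k) (run n ?p (setr 3 k m'))"
    proof (cases "k \<in> S")
      case True
      then have "snd m 2 0 k = 1" "snd m' 4 k a = snd m 4 k a" "snd m' 5 k a = snd m 5 k a"
        "snd m 5 k a < n" "k \<noteq> b" "a \<noteq> b"
        "snd m' 5 a a = snd m 5 a a" "snd m 5 a a < n"
        using I a d ne by (auto simp: I_def S_def)
      note k_facts = this
      define m2 where "m2 = run n ?p (setr 3 k m')"
      have frame: "fst m2 6 = a" "fst m2 7 = b" "snd m2 2 = snd m 2"
        using k_facts m' by (simp_all add: m2_def)
      have t4: "snd m2 4 u v = (if u = b \<and> v = k then a
           else if u = k \<and> v = b then if k = a then b else snd m 4 k a else snd m' 4 u v)"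
        and t5: "snd m2 5 u v = (if u = b \<and> v = k \<or> u = k \<and> v = b
           then Suc (snd m 5 k a) else snd m' 5 u v)" for u v
        using k_facts m' by (simp_all add: m2_def)
      have old: "snd m2 4 u v = snd m 4 u v \<and> snd m2 5 u v = snd m 5 u v" if "u \<in> S" "v \<in> S" for u v
        using I ne[OF that(1)] ne[OF that(2)] that by (simp add: t4 t5 I_def)
      have "snd m2 4 b u = a \<and> snd m2 4 u b = (if u = a then b else snd m 4 u a) \<and>
        snd m2 5 b u = Suc (snd m 5 u a) \<and> snd m2 5 u b = Suc (snd m 5 u a)"
        if "u \<in> S" "u < Suc k" for u
        using I ne[OF that(1)] that k_facts(5) by (cases "u = k") (simp_all add: t4 t5 I_def)
      then show ?thesis using frame old by (simp add: I_def m2_def)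
    next
      case False
      then have "snd m 2 0 k \<noteq> 1" using k by (auto simp: S_def)
      then show ?thesis using False I m' by (auto simp: I_def less_Suc_eq)
    qed
  qed (auto simp: I_def)
  then show "u \<in> S \<Longrightarrow> v \<in> S \<Longrightarrow> snd m' 4 u v = snd m 4 u v \<and> snd m' 5 u v = snd m 5 u v"
    and "u \<in> S \<Longrightarrow> snd m' 4 b u = a \<and> snd m' 4 u b = (if u = a then b else snd m 4 u a) \<and>
      snd m' 5 b u = Suc (snd m 5 u a) \<and> snd m' 5 u b = Suc (snd m 5 u a)"
    by (auto simp: I_def m'_def S_def)
qed

text \<open>The last conjunct says that every prefix of the order spans a subtree: first steps
  between its vertices stay inside. The recursion over pairs rests on this.\<close>

definition grown :: "nat \<Rightarrow> nat set set \<Rightarrow> nat \<Rightarrow> mem \<Rightarrow> bool" where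
  "grown n E c m \<longleftrightarrow> (let S = snd m 3 0 ` {..<c} in
     S \<subseteq> {0..<n} \<and> inj_on (snd m 3 0) {..<c} \<and> (\<forall>v<n. snd m 2 0 v = of_bool (v \<in> S)) \<and>
     routed_tree S (sub_edges E S) (snd m 4) (snd m 5) \<and>
     (\<forall>k\<le>c. \<forall>i<k. \<forall>j<k. snd m 4 (snd m 3 0 i) (snd m 3 0 j) \<in> snd m 3 0 ` {..<k}))"

lemma grown_step:
  assumes tree: "tree {0..<n} E" and es: "edge_list es E" "holds_input es m" "length es \<le> n"
    and c: "c < n" "fst m 2 = c" and g: "grown n E c m" and "0 < c"
  shows "grown n E (Suc c) (run n (Sq scan (Sq attach mark)) m)"
proof -
  define S where "S = snd m 3 0 ` {..<c}"
  define m1 where "m1 = run n scan m"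
  define m2 where "m2 = run n attach m1"
  define m3 where "m3 = run n mark m2"
  define a b where "a = fst m1 6" and "b = fst m1 7"
  have S: "S \<subseteq> {0..<n}" and inj: "inj_on (snd m 3 0) {..<c}"
    and vis: "\<And>v. v < n \<Longrightarrow> snd m 2 0 v = of_bool (v \<in> S)"
    and rt: "routed_tree S (sub_edges E S) (snd m 4) (snd m 5)"
    and conv: "\<And>k i j. k \<le> c \<Longrightarrow> i < k \<Longrightarrow> j < k \<Longrightarrow> snd m 4 (snd m 3 0 i) (snd m 3 0 j) \<in> snd m 3 0 ` {..<k}"
    using g by (auto simp: grown_def S_def Let_def)
  interpret routed_tree S "sub_edges E S" "snd m 4" "snd m 5" by fact
  have "card S = c" using inj by (simp add: S_def card_image)
  then have "S \<noteq> {0..<n}" "S \<noteq> {}" using c \<open>0 < c\<close> by auto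
  from tree_leaving_edge[OF tree S this(2,1)]
  obtain x y where xy: "x \<in> S" "y \<in> {0..<n} - S" "{x, y} \<in> E" .
  have E: "edge_of ` set es = E" using es by (simp add: edge_list_def)
  have tab1: "snd m1 = snd m" unfolding m1_def
    by (rule ext, rule run_frame_tab) (simp add: scan_def)
  have scan: "snd m 2 0 a = 1" "snd m 2 0 b = 0" "{a, b} \<in> E"
  proof -
    have "x < n" "y < n" "{x, y} \<in> edge_of ` set es" using xy S E by auto
    then show "snd m 2 0 a = 1" "snd m 2 0 b = 0" "{a, b} \<in> E"
      using run_scan[OF es(2,3), of x y] vis xy E unfolding a_def b_def m1_def by simp_all
  qed
  have "{a, b} \<subseteq> {0..<n}" using scan(3) tree unfolding tree_def simple_graph_def by metis
  then have ab: "a \<in> S" "b \<notin> S" "a < n" "b < n"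
    using scan(1,2) vis[of a] vis[of b] by (cases "a \<in> S"; cases "b \<in> S"; simp)+
  have "v < n \<and> snd m1 2 0 v = 1 \<longleftrightarrow> v \<in> S" for v
    using vis[of v] subsetD[OF S, of v] tab1 by (cases "v \<in> S") simp_all
  then have S': "{v. v < n \<and> snd m1 2 0 v = 1} = S" by simp
  have "card S \<le> n" using S card_mono[of "{0..<n}" S] by simp
  then have d: "snd m1 5 u a < n" if "u \<in> S" for u
    using that dst_less[OF that ab(1)] by (simp add: tab1)
  note att = run_attach[where n = n and m = m1, unfolded S', folded a_def b_def m2_def, OF ab(1,2,4), unfolded tab1]
  have old: "snd m2 4 u v = snd m 4 u v \<and> snd m2 5 u v = snd m 5 u v" if "u \<in> S" "v \<in> S" for u v
    by (rule att(1)[OF _ that]) (use d tab1 in simp)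
  have new: "snd m2 4 b u = a \<and> snd m2 4 u b = (if u = a then b else snd m 4 u a) \<and>
      snd m2 5 b u = Suc (snd m 5 u a) \<and> snd m2 5 u b = Suc (snd m 5 u a)" if "u \<in> S" for u
    by (rule att(2)[OF _ that]) (use d tab1 in simp)
  have tab2: "snd m2 2 = snd m 2" "snd m2 3 = snd m 3"
    using run_frame_tab[of _ attach n m1] by (auto simp: m2_def attach_def tab1)
  have reg2: "fst m2 7 = b" "fst m2 2 = c"
    using run_frame_reg[of _ attach n m1] run_frame_reg[of 2 scan n m] c
    by (auto simp: m2_def b_def attach_def scan_def m1_def)
  have m3: "snd m3 4 u v = (if u = b \<and> v = b then b else snd m2 4 u v)"
    "snd m3 5 u v = (if u = b \<and> v = b then 0 else snd m2 5 u v)"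
    "snd m3 2 0 v = (if v = b then 1 else snd m 2 0 v)"
    "snd m3 3 0 v = (if v = c then b else snd m 3 0 v)" for u v
    using reg2 tab2 by (auto simp: m3_def mark_def)
  have ord: "snd m3 3 0 ` {..<k} = snd m 3 0 ` {..<k}" if "k \<le> c" for k
    using that m3(4) by (intro image_cong) auto
  have S3: "snd m3 3 0 ` {..<Suc c} = insert b S"
    using ord[of c] m3(4)[of c] by (simp add: lessThan_Suc S_def)
  have rt3: "routed_tree (insert b S) (insert {a, b} (sub_edges E S)) (snd m3 4) (snd m3 5)"
    by (rule routed_tree_insert[OF rt ab(1,2)]) (use old new ab in \<open>auto simp: m3\<close>)
  interpret n: routed_tree "insert b S" "insert {a, b} (sub_edges E S)" "snd m3 4" "snd m3 5" by fact
  have ordS: "snd m 3 0 i \<in> S" if "i < c" for i using that by (auto simp: S_def)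
  have "snd m3 4 (snd m3 3 0 i) (snd m3 3 0 j) \<in> snd m3 3 0 ` {..<k}" if "k \<le> Suc c" "i < k" "j < k" for k i j
  proof (cases "k = Suc c")
    case True
    have "snd m3 3 0 i \<in> insert b S" "snd m3 3 0 j \<in> insert b S"
      using that True ordS m3(4) by auto
    then show ?thesis using n.nxt_in S3 True by simp
  next
    case False
    then have k: "k \<le> c" "i < c" "j < c" using that by auto
    then have "snd m3 4 (snd m3 3 0 i) (snd m3 3 0 j) = snd m 4 (snd m 3 0 i) (snd m 3 0 j)"
      using old[OF ordS ordS, OF k(2,3)] ordS[of i] ab by (auto simp: m3)
    then show ?thesis using conv[OF k(1) that(2,3)] ord[OF k(1)] by simp
  qed
  moreover have "inj_on (snd m3 3 0) {..<Suc c}"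
  proof -
    have "card (snd m3 3 0 ` {..<Suc c}) = Suc c"
      using S3 ab(2) finV \<open>card S = c\<close> by simp
    then show ?thesis by (simp add: inj_on_iff_eq_card)
  qed
  moreover have "\<forall>v<n. snd m3 2 0 v = of_bool (v \<in> insert b S)" using vis m3(3) by auto
  ultimately have "grown n E (Suc c) m3"
    unfolding grown_def Let_def S3
    using S ab rt3 sub_edges_insert[OF tree rt ab(1,2) scan(3)] by auto
  then show ?thesis by (simp add: m3_def m2_def m1_def)
qed

lemma run_grow:
  assumes tree: "tree {0..<n} E" and es: "edge_list es E" "holds_input es m" "length es \<le> n"
    and zero: "\<And>a i j. 2 \<le> a \<Longrightarrow> snd m a i j = 0"
  shows "grown n E n (run n grow m)"
proof -
  have n: "0 < n" using tree by (auto simp: tree_def connected_graph_def)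
  let ?m = "putt 2 0 0 1 m"
  have rt: "routed_tree {0} (sub_edges E {0}) (snd ?m 4) (snd ?m 5)"
    unfolding tree_no_loop[OF tree] by (rule routed_tree_single) (auto simp: zero)
  have S: "snd ?m 3 0 ` {..<1} = {0}" by (auto simp: zero)
  have g1: "grown n E 1 ?m"
    unfolding grown_def Let_def S using rt n by (auto simp: zero le_Suc_eq inj_on_def)
  \<comment> \<open>The \<open>max\<close> accounts for iteration 0, which does nothing: one vertex
    is present both before and after it.\<close>
  define I where "I i m' \<longleftrightarrow> holds_input es m' \<and> grown n E (max 1 i) m'" for i m'
  have g_setr: "grown n E c (setr x v m') = grown n E c m'" for c x v m' by (simp add: grown_def)
  have "I n (run n (For 2 (Cnd (Lt Zero (R 2)) (Sq scan (Sq attach mark)) Nop)) ?m)"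
  proof (rule run_For[where I = I])
    show "I 0 ?m" using g1 es by (simp add: I_def holds_input_def)
    fix i m' assume i: "i < n" and I: "I i m'"
    show "I (Suc i) (run n (Cnd (Lt Zero (R 2)) (Sq scan (Sq attach mark)) Nop) (setr 2 i m'))"
    proof (cases "i = 0")
      case True
      then show ?thesis using I by (simp add: I_def g_setr holds_input_def)
    next
      case False
      let ?p = "Sq scan (Sq attach mark)"
      have h: "holds_input es (setr 2 i m')" using I by (simp add: I_def holds_input_def)
      have "grown n E (Suc i) (run n ?p (setr 2 i m'))"
        by (rule grown_step[OF tree es(1) h es(3) i]) (use I False in \<open>auto simp: I_def g_setr max_def\<close>)
      moreover have "holds_input es (run n ?p (setr 2 i m'))"
        using h run_frame_reg[of 1 ?p n "setr 2 i m'"] run_frame_tab[of 0 ?p n "setr 2 i m'"]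
          run_frame_tab[of 1 ?p n "setr 2 i m'"]
        by (simp add: holds_input_def scan_def attach_def mark_def)
      ultimately show ?thesis using False by (simp add: I_def)
    qed
  next
    fix m' assume "I n m'"
    then show "I n (setr 2 n m')" by (simp add: I_def g_setr holds_input_def)
  qed
  then show ?thesis using n by (simp add: grow_def I_def max_def Suc_le_eq split: if_splits)
qed

text \<open>The invariant depends on the set of pairs treated so far, which spares every use the
  distinction between complete rows and a partial one.\<close>

lemma run_For_pairs:
  assumes xy: "x \<notin> wr p" "x \<noteq> y"
    and init: "I {} m"
    and step: "\<And>P i j m. i < n \<Longrightarrow> j < n \<Longrightarrow> I P m \<Longrightarrow> finite P \<Longrightarrow> fst m x = i \<Longrightarrow> fst m y = j \<Longrightarrow>
      I (insert (i, j) P) (run n p m)"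
    and setr: "\<And>P z v m. z = x \<or> z = y \<Longrightarrow> I P m \<Longrightarrow> I P (setr z v m)"
  shows "I ({..<n} \<times> {..<n}) (run n (For x (For y p)) m)"
proof (rule run_For[where I = "\<lambda>i. I ({..<i} \<times> {..<n})"])
  fix i m assume i: "i < n" and I: "I ({..<i} \<times> {..<n}) m"
  let ?J = "\<lambda>j m. I ({..<i} \<times> {..<n} \<union> {i} \<times> {..<j}) m \<and> fst m x = i"
  have "?J n (run n (For y p) (setr x i m))"
  proof (rule run_For[where I = ?J])
    fix j m assume j: "j < n" and J: "?J j m"
    have "{..<i} \<times> {..<n} \<union> {i} \<times> {..<Suc j} = insert (i, j) ({..<i} \<times> {..<n} \<union> {i} \<times> {..<j})"
      by auto
    then show "?J (Suc j) (run n p (setr y j m))"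
      using step[OF i j, of _ "setr y j m"] J setr[of y _ m] xy run_frame_reg[OF xy(1)] by simp
  qed (use I setr xy in auto)
  moreover have "{..<i} \<times> {..<n} \<union> {i} \<times> {..<n} = {..<Suc i} \<times> {..<n}" by auto
  ultimately show "I ({..<Suc i} \<times> {..<n}) (run n (For y p) (setr x i m))" by simp
qed (use init setr in auto)

section \<open>Programs for branches, pairs and the answer\<close>

definition heights :: pg where
  "heights = For 2 (For 3 (Cnd (Lt (T 6 (R 2) (T 4 (R 2) (R 3))) (T 5 (R 2) (R 3)))
     (Put 6 (R 2) (T 4 (R 2) (R 3)) (T 5 (R 2) (R 3))) Nop))"

fun differ :: "ex \<Rightarrow> ex list \<Rightarrow> bx" where
  "differ e [] = Eq Zero Zero"
| "differ e (f # fs) = An (Ng (Eq e f)) (differ e fs)"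

lemma bv_differ [simp]: "bv n (differ e fs) m \<longleftrightarrow> ev n e m \<notin> (\<lambda>f. ev n f m) ` set fs"
  by (induction fs) auto

text \<open>The start value \<open>n\<close> is a sentinel with branch length 0; it survives exactly
  if no branch of positive length is left.\<close>

definition select :: "nat \<Rightarrow> nat list \<Rightarrow> pg" where
  "select b ts = Sq (Set 4 (R 0))
     (Sq (For 3 (Cnd (An (differ (R 3) (map (\<lambda>t. T t Zero (R 2)) ts)) (Lt (T 6 (R 2) (R 4)) (T 6 (R 2) (R 3))))
       (Set 4 (R 3)) Nop))
     (Put b Zero (R 2) (R 4)))"

definition tops :: pg where
  "tops = For 2 (Sq (select 7 []) (Sq (select 8 [7]) (Sq (select 9 [8, 7]) (select 10 [9, 8, 7]))))"

fun pick_from :: "nat list \<Rightarrow> nat \<Rightarrow> ex \<Rightarrow> ex list \<Rightarrow> pg" where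
  "pick_from [] d v xs = Set d (R 0)"
| "pick_from (b # bs) d v xs =
     Cnd (differ (T b Zero v) xs) (Set d (T b Zero v)) (pick_from bs d v xs)"

abbreviation pick :: "nat \<Rightarrow> ex \<Rightarrow> ex list \<Rightarrow> pg" where
  "pick \<equiv> pick_from [7, 8, 9, 10]"

text \<open>Registers 4 to 9 hold \<open>s\<close>, \<open>t\<close>, \<open>v\<close>,
  \<open>nxt v t\<close> and the ends of the best and second best side branch at \<open>v\<close>;
  the test is the first disjunct of \<open>facing_step\<close>.\<close>

definition leaves :: bx where
  "leaves = An (Ng (Lt (T 6 (R 6) (R 8)) (T 11 (R 5) (R 6))))
     (Lt (Add (Sub (Sub (T 5 (R 4) (R 5)) One) One) (T 6 (R 6) (R 9))) (T 6 (R 6) (R 8)))"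

definition set_facing :: pg where
  "set_facing = Sq (Set 7 (T 4 (R 6) (R 5)))
     (Sq (pick 8 (R 6) [R 4, R 7])
     (Sq (pick 9 (R 6) [R 4, R 7, R 8])
     (Cnd leaves (Put 12 (R 4) (R 5) One)
       (Cnd (An (Ng (Eq (R 7) (R 5))) (Eq (T 12 (R 5) (R 6)) Zero))
         (Put 12 (R 4) (R 5) One) (Put 12 (R 4) (R 5) Zero)))))"

text \<open>With truncated subtraction \<open>x + (z - x)\<close> is the maximum. Register 8 still
  holds the best side branch found by \<open>set_facing\<close>, so none has to be picked
  again.\<close>

definition set_inner_left :: pg where
  "set_inner_left = Put 11 (R 4) (R 5) (Add One
     (Add (T 6 (R 6) (R 8)) (Sub (T 11 (R 6) (R 5)) (T 6 (R 6) (R 8)))))"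

text \<open>Here the side branch is one at \<open>y\<close>, the neighbour of \<open>t\<close> in
  register 10; register 11 holds the next vertex towards \<open>s\<close>.\<close>

definition set_inner_right :: pg where
  "set_inner_right = Sq (Set 10 (T 4 (R 5) (R 4)))
     (Sq (Set 11 (T 4 (R 10) (R 4)))
     (Sq (pick 9 (R 10) [R 5, R 11])
     (Put 11 (R 4) (R 5) (Add (T 11 (R 4) (R 10))
       (Sub (Add (T 5 (R 4) (R 10)) (T 6 (R 10) (R 9))) (T 11 (R 4) (R 10)))))))"

definition set_pair :: "pg \<Rightarrow> pg" where
  "set_pair p = Sq (Set 6 (T 4 (R 4) (R 5)))
     (Cnd (Eq (R 6) (R 5)) (Put 11 (R 4) (R 5) Zero) (Sq set_facing p))"

text \<open>The pairs starting at the newest vertex come first: shortening them at that end leads to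
  pairs of older vertices. For the pairs ending at it, \<open>facing\<close> refers to a pair of the
  row just completed, while \<open>inner\<close> is again shortened at the newest vertex, now on the
  right.\<close>

definition dynamic :: pg where
  "dynamic = For 2 (Sq
     (For 3 (Cnd (Lt (R 3) (R 2))
       (Sq (Set 4 (T 3 Zero (R 2))) (Sq (Set 5 (T 3 Zero (R 3))) (set_pair set_inner_left))) Nop))
     (For 3 (Cnd (Lt (R 3) (R 2))
       (Sq (Set 4 (T 3 Zero (R 3))) (Sq (Set 5 (T 3 Zero (R 2))) (set_pair set_inner_right))) Nop)))"

text \<open>A pair \<open>(s, t)\<close> concerns two openings, from \<open>s\<close> inwards and
  outwards to \<open>s\<close>, answered along the last edge at \<open>t\<close>. Marking what is
  refuted keeps the work per pair constant.\<close>

definition flag :: pg where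
  "flag = For 2 (For 3 (Cnd (Lt One (T 5 (R 2) (R 3)))
     (Sq (Set 6 (T 4 (R 2) (R 3)))
     (Sq (Set 10 (T 4 (R 3) (R 2)))
     (Sq (Cnd (An (Eq (T 12 (R 2) (R 3)) One) (Lt (T 6 (R 10) (R 3)) (T 11 (R 2) (R 3))))
           Nop (Put 13 (R 2) (R 6) One))
       (Cnd (An (Lt (T 6 (R 10) (R 3)) (T 6 (R 6) (R 2))) (Lt (T 11 (R 3) (R 2)) (T 6 (R 6) (R 2))))
           Nop (Put 13 (R 6) (R 2) One)))))
     Nop))"

definition answer :: pg where
  "answer = Sq (Set 12 (Add One One))
     (For 2 (For 3 (Cnd (An (Eq (T 5 (R 2) (R 3)) One) (Eq (T 13 (R 2) (R 3)) Zero)) (Set 12 One) Nop)))"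

definition solve :: pg where
  "solve = Sq grow (Sq heights (Sq tops (Sq dynamic (Sq flag answer))))"

section \<open>Correctness of the branch tables\<close>

locale numbered_tree = routed_tree "{0..<n}" E nxt dst for n :: nat and E nxt dst
begin

definition metric :: "mem \<Rightarrow> bool" where
  "metric m \<longleftrightarrow> fst m 0 = n \<and> snd m 4 = nxt \<and> snd m 5 = dst"

lemma run_heights:
  assumes "metric m" "\<And>v w. snd m 6 v w = 0"
  shows "\<forall>v<n. snd (run n heights m) 6 v = branch v"
proof -
  define I where "I P m \<longleftrightarrow> metric m \<and>
    (\<forall>v<n. \<forall>w. snd m 6 v w = Max (insert 0 (dst v ` {z. (v, z) \<in> P \<and> nxt v z = w})))" for P m
  have "I ({..<n} \<times> {..<n}) (run n heights m)"
    unfolding heights_def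
  proof (rule run_For_pairs[where I = I])
    show "I {} m" using assms by (simp add: I_def)
    fix P i j m
    assume ij: "i < n" "j < n" and I: "I P m" and P: "finite P" and r: "fst m 2 = i" "fst m 3 = j"
    have m: "snd m 4 = nxt" "snd m 5 = dst" "metric m" using I by (auto simp: I_def metric_def)
    let ?S = "\<lambda>P v w. {z. (v, z) \<in> P \<and> nxt v z = w}"
    have fin: "finite (?S P v w)" for v w
      by (rule finite_subset[of _ "snd ` P"]) (use P in \<open>force+\<close>)
    have S: "?S (insert (i, j) P) v w = (if v = i \<and> nxt v j = w then insert j (?S P v w) else ?S P v w)" for v w
      by auto
    have ins: "Max (insert 0 (dst v ` ?S (insert (i, j) P) v w)) =
      (if v = i \<and> nxt v j = w then max (dst v j) (Max (insert 0 (dst v ` ?S P v w)))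
       else Max (insert 0 (dst v ` ?S P v w)))" for v w
    proof -
      have "Max (insert 0 (insert (dst v j) A)) = max (dst v j) (Max (insert 0 A))" if "finite A" for A
        using that by (subst insert_commute, subst Max_insert) simp_all
      from this[of "dst v ` ?S P v w"] have
        max: "Max (insert 0 (insert (dst v j) (dst v ` ?S P v w))) = max (dst v j) (Max (insert 0 (dst v ` ?S P v w)))"
        using fin[of v w] by blast
      show ?thesis
      proof (cases "v = i \<and> nxt v j = w")
        case True
        show ?thesis unfolding S if_P[OF True] image_insert by (rule max)
      next
        case False
        show ?thesis unfolding S if_not_P[OF False] by (rule refl)
      qed
    qed
    have tab: "snd m 6 v w = Max (insert 0 (dst v ` ?S P v w))" if "v < n" for v w
      using I that by (auto simp: I_def)
    show "I (insert (i, j) P) (run n (Cnd (Lt (T 6 (R 2) (T 4 (R 2) (R 3))) (T 5 (R 2) (R 3)))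
     (Put 6 (R 2) (T 4 (R 2) (R 3)) (T 5 (R 2) (R 3))) Nop) m)"
      unfolding I_def ins using m ij r tab by (auto simp: metric_def max_def)
  qed (auto simp: I_def metric_def)
  moreover have "{z. (v, z) \<in> {..<n} \<times> {..<n} \<and> nxt v z = w} = {z \<in> {0..<n}. nxt v z = w}"
    if "v < n" for v w using that by auto
  ultimately show ?thesis by (auto simp: I_def branch_def lmax_def)
qed

lemma branch_sentinel: "v < n \<Longrightarrow> branch v n = 0"
  using branch_pos_iff[of v n] edge[of v n] by auto

text \<open>The form of \<open>best_branch\<close> with the sentinel: as
  \<open>branch v n = 0\<close>, the choice of \<open>n\<close> forces all branches outside
  \<open>X\<close> to be empty.\<close>

definition choice :: "nat \<Rightarrow> nat set \<Rightarrow> nat \<Rightarrow> bool" where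
  "choice v X w \<longleftrightarrow> (w = n \<or> w < n \<and> w \<notin> X) \<and> (\<forall>w'<n. w' \<notin> X \<longrightarrow> branch v w' \<le> branch v w)"

lemma choice_best: "v < n \<Longrightarrow> choice v X w \<Longrightarrow> best_branch v X w"
  using branch_sentinel by (auto simp: choice_def best_branch_def)

lemma run_select:
  assumes m: "fst m 0 = n" "snd m 6 v = branch v" "fst m 2 = v" "v < n"
  shows "\<exists>w. choice v ((\<lambda>t. snd m t 0 v) ` set ts) w \<and>
    snd (run n (select b ts) m) = (snd m)(b := (snd m b)(0 := (snd m b 0)(v := w)))"
proof -
  define X where "X = (\<lambda>t. snd m t 0 v) ` set ts"
  define I where "I k m' \<longleftrightarrow> snd m' = snd m \<and> fst m' 0 = n \<and> fst m' 2 = v \<and>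
    (let w = fst m' 4 in (w = n \<or> w < n \<and> w \<notin> X) \<and> (\<forall>w'<k. w' \<notin> X \<longrightarrow> branch v w' \<le> branch v w))" for k and m' :: mem
  have "I n (run n (For 3 (Cnd (An (differ (R 3) (map (\<lambda>t. T t Zero (R 2)) ts)) (Lt (T 6 (R 2) (R 4)) (T 6 (R 2) (R 3))))
       (Set 4 (R 3)) Nop)) (run n (Set 4 (R 0)) m))"
  proof (rule run_For[where I = I])
    show "I 0 (run n (Set 4 (R 0)) m)" using m by (simp add: I_def)
    fix k m' assume "k < n" "I k m'"
    moreover have "ev n (R 3) (setr 3 k m') \<notin> (\<lambda>f. ev n f (setr 3 k m')) ` set (map (\<lambda>t. T t Zero (R 2)) ts)
        \<longleftrightarrow> k \<notin> X"
      using calculation(2) by (auto simp: I_def X_def image_image)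
    ultimately show "I (Suc k) (run n (Cnd (An (differ (R 3) (map (\<lambda>t. T t Zero (R 2)) ts)) (Lt (T 6 (R 2) (R 4)) (T 6 (R 2) (R 3))))
       (Set 4 (R 3)) Nop) (setr 3 k m'))"
      using m(2) unfolding I_def Let_def
      by (simp only: run.simps bv.simps bv_differ) (auto simp: less_Suc_eq intro: le_trans less_imp_le)
  qed (auto simp: I_def)
  then show ?thesis
    by (auto simp: I_def select_def choice_def X_def Let_def)
qed

definition ranked :: "mem \<Rightarrow> nat \<Rightarrow> bool" where
  "ranked m v \<longleftrightarrow> choice v {} (snd m 7 0 v) \<and> choice v {snd m 7 0 v} (snd m 8 0 v) \<and>
     choice v {snd m 8 0 v, snd m 7 0 v} (snd m 9 0 v) \<and>
     choice v {snd m 9 0 v, snd m 8 0 v, snd m 7 0 v} (snd m 10 0 v)"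

lemma run_tops:
  assumes "fst m 0 = n" "\<forall>v<n. snd m 6 v = branch v"
  shows "\<forall>v<n. ranked (run n tops m) v"
proof -
  define I where "I k m' \<longleftrightarrow> fst m' 0 = n \<and> snd m' 6 = snd m 6 \<and> (\<forall>v<k. ranked m' v)" for k m'
  let ?p = "Sq (select 7 []) (Sq (select 8 [7]) (Sq (select 9 [8, 7]) (select 10 [9, 8, 7])))"
  have "I n (run n tops m)"
    unfolding tops_def
  proof (rule run_For[where I = I])
    show "I 0 m" using assms by (simp add: I_def)
    fix k m' assume k: "k < n" and I: "I k m'"
    define m0 where "m0 = setr 2 k m'"
    define m1 where "m1 = run n (select 7 []) m0"
    define m2 where "m2 = run n (select 8 [7]) m1"
    define m3 where "m3 = run n (select 9 [8, 7]) m2"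
    define m4 where "m4 = run n (select 10 [9, 8, 7]) m3"
    have reg: "fst (run n (select b ts) m) 0 = fst m 0 \<and> fst (run n (select b ts) m) 2 = fst m 2" for b ts m
      using run_frame_reg[of _ "select b ts"] by (simp add: select_def)
    have r: "fst m0 0 = n" "fst m0 2 = k" "fst m1 0 = n" "fst m1 2 = k" "fst m2 0 = n" "fst m2 2 = k"
       "fst m3 0 = n" "fst m3 2 = k" "fst m4 0 = n" "snd m0 = snd m'"
      using I reg by (auto simp: m0_def m1_def m2_def m3_def m4_def I_def)
    have 6: "snd m' 6 k = branch k" using I assms k by (simp add: I_def)
    obtain w1 where w1: "choice k {} w1" "snd m1 = (snd m')(7 := (snd m' 7)(0 := (snd m' 7 0)(k := w1)))"
      using run_select[of m0 k "[]" 7] r 6 k by (auto simp: m1_def)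
    obtain w2 where w2: "choice k {w1} w2" "snd m2 = (snd m1)(8 := (snd m1 8)(0 := (snd m1 8 0)(k := w2)))"
      using run_select[of m1 k "[7]" 8] r 6 k w1 by (auto simp: m2_def)
    obtain w3 where w3: "choice k {w2, w1} w3" "snd m3 = (snd m2)(9 := (snd m2 9)(0 := (snd m2 9 0)(k := w3)))"
      using run_select[of m2 k "[8, 7]" 9] r 6 k w1 w2 by (auto simp: m3_def)
    obtain w4 where w4: "choice k {w3, w2, w1} w4" "snd m4 = (snd m3)(10 := (snd m3 10)(0 := (snd m3 10 0)(k := w4)))"
      using run_select[of m3 k "[9, 8, 7]" 10] r 6 k w1 w2 w3 by (auto simp: m4_def)
    have "ranked m4 v \<longleftrightarrow> v = k \<or> ranked m' v" for v
      using w1 w2 w3 w4 by (auto simp: ranked_def)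
    moreover have "snd m4 6 = snd m' 6" using w1 w2 w3 w4 by simp
    ultimately have "I (Suc k) m4" using I r by (auto simp: I_def less_Suc_eq)
    then show "I (Suc k) (run n ?p (setr 2 k m'))" by (simp add: m4_def m3_def m2_def m1_def m0_def)
  qed (auto simp: I_def ranked_def)
  then show ?thesis by (simp add: I_def)
qed

text \<open>Four ranks suffice: three excluded vertices cannot cover four distinct ones, and a repetition
  among the ranks is the sentinel \<open>n\<close>, which shows that no branch is left.\<close>

lemma run_pick:
  assumes "ranked m u" "u < n" "ev n v m = u" "fst m 0 = n"
    and X: "X = (\<lambda>x. ev n x m) ` set xs" "length xs \<le> 3"
  shows "\<exists>w. choice u X w \<and> run n (pick d v xs) m = setr d w m"
proof -
  define b where "b = (\<lambda>i. snd m i 0 u)"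
  have r: "choice u {} (b 7)" "choice u {b 7} (b 8)" "choice u {b 8, b 7} (b 9)" "choice u {b 9, b 8, b 7} (b 10)"
    using assms by (auto simp: ranked_def b_def)
  have mono: "choice u X w" if "choice u Y w" "Y \<subseteq> X" "w \<notin> X" for w Y
    using that by (auto simp: choice_def)
  have none: "choice u X n" if "choice u Y n" "Y \<subseteq> X" for Y
    using that by (auto simp: choice_def)
  have "card X \<le> 3" using X card_image_le[of "set xs"] card_length[of xs] by (meson List.finite_set le_trans)
  have 4: "choice u X n" if "b 7 \<in> X" "b 8 \<in> X" "b 9 \<in> X" "b 10 \<in> X"
  proof -
    have "\<not> distinct [b 7, b 8, b 9, b 10]"
    proof
      assume "distinct [b 7, b 8, b 9, b 10]"
      from distinct_card[OF this] have "card (set [b 7, b 8, b 9, b 10]) = 4" by simp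
      moreover have "card (set [b 7, b 8, b 9, b 10]) \<le> card X"
        by (rule card_mono) (use X that in auto)
      ultimately show False using \<open>card X \<le> 3\<close> by linarith
    qed
    then consider "b 8 = b 7" | "b 9 \<in> {b 8, b 7}" | "b 10 \<in> {b 9, b 8, b 7}" by auto
    then show ?thesis
    proof cases
      case 1
      then have "b 8 = n" using r(2) by (auto simp: choice_def)
      then show ?thesis using none[of "{b 7}"] r(2) that by simp
    next
      case 2
      then have "b 9 = n" using r(3) by (auto simp: choice_def)
      then show ?thesis using none[of "{b 8, b 7}"] r(3) that by simp
    next
      case 3
      then have "b 10 = n" using r(4) by (auto simp: choice_def)
      then show ?thesis using none[of "{b 9, b 8, b 7}"] r(4) that by simp
    qed
  qed
  have "run n (pick d v xs) m = setr d (if b 7 \<notin> X then b 7 else if b 8 \<notin> X then b 8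
      else if b 9 \<notin> X then b 9 else if b 10 \<notin> X then b 10 else n) m"
    using assms by (simp add: b_def)
  moreover have "choice u X (if b 7 \<notin> X then b 7 else if b 8 \<notin> X then b 8
      else if b 9 \<notin> X then b 9 else if b 10 \<notin> X then b 10 else n)"
    using mono[OF r(1)] mono[OF r(2)] mono[OF r(3)] mono[OF r(4)] 4 by auto
  ultimately show ?thesis by blast
qed

section \<open>Correctness of the recursion over pairs\<close>

definition prepared :: "mem \<Rightarrow> bool" where
  "prepared m \<longleftrightarrow> metric m \<and> (\<forall>v<n. snd m 6 v = branch v) \<and> (\<forall>v<n. ranked m v)"

lemma prepared_cong:
  assumes "fst m 0 = fst m' 0" "\<And>a. a \<in> {4..10} \<Longrightarrow> snd m a = snd m' a"
  shows "prepared m = prepared m'"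
  using assms by (simp add: prepared_def metric_def ranked_def)

text \<open>For adjacent vertices the two end edges coincide, so \<open>facing\<close> describes no
  position of the game and its entry is never written; the value 0 of \<open>inner\<close> is
  recorded.\<close>

definition solved :: "mem \<Rightarrow> nat \<Rightarrow> nat \<Rightarrow> bool" where
  "solved m s t \<longleftrightarrow> snd m 11 s t = inner s t \<and> (2 \<le> dst s t \<longrightarrow> snd m 12 s t = of_bool (facing s t))"

text \<open>Lengths below \<open>n\<close> are not affected by the cut-off at \<open>n + 1\<close>,
  nor are comparisons with them.\<close>

lemma branch_less: "v < n \<Longrightarrow> branch v w < n"
proof -
  assume v: "v < n"
  have "\<not> n \<le> branch v w"
    using branch_ge_iff[of n v w] dst_less[of v] v by (auto simp: not_le)
  then show ?thesis by simp
qed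

lemma inner_less: "s < n \<Longrightarrow> inner s t < n"
proof -
  assume s: "s < n"
  have "\<not> n \<le> inner s t"
    using inner_ge_iff[of n s t] dst_less[of s] s by (auto simp: not_le between_def)
  then show ?thesis by simp
qed

lemma run_set_facing:
  assumes p: "prepared m" and stn: "s < n" "t < n" "2 \<le> dst s t"
    and r: "fst m 4 = s" "fst m 5 = t" "fst m 6 = nxt s t"
    and tv: "solved m t (nxt s t)"
  defines "v \<equiv> nxt s t" and "m' \<equiv> run n set_facing m"
  shows "snd m' = (snd m)(12 := (snd m 12)(s := (snd m 12 s)(t := of_bool (facing s t))))"
    and "branch v (fst m' 8) = side v {s, nxt v t}"
    and "fst m' 4 = s \<and> fst m' 5 = t \<and> fst m' 6 = v \<and> fst m' 0 = n"
proof -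
  interpret far_pair "{0..<n}" E nxt dst s t v "nxt t s"
    using stn by unfold_locales (auto simp: v_def)
  have vn: "v < n" using vV by simp
  define v' where "v' = nxt v t"
  have m: "metric m" "fst m 0 = n" "snd m 4 = nxt" "snd m 5 = dst"
    "snd m 6 v = branch v" "ranked m v"
    using p vn by (auto simp: prepared_def metric_def)
  define m1 where "m1 = setr 7 v' m"
  obtain w1 where w1: "choice v {s, v'} w1" "run n (pick 8 (R 6) [R 4, R 7]) m1 = setr 8 w1 m1"
    using run_pick[of m1 v "R 6" "{s, v'}" "[R 4, R 7]" 8] m r vn
    by (auto simp: m1_def ranked_def v_def)
  obtain w2 where w2: "choice v {s, v', w1} w2"
    "run n (pick 9 (R 6) [R 4, R 7, R 8]) (setr 8 w1 m1) = setr 9 w2 (setr 8 w1 m1)"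
    using run_pick[of "setr 8 w1 m1" v "R 6" "{s, v', w1}" "[R 4, R 7, R 8]" 9] m r vn
    by (auto simp: m1_def ranked_def v_def)
  note best = choice_best[OF vn w1(1)] choice_best[OF vn w2(1)]
  define m3 where "m3 = setr 9 w2 (setr 8 w1 m1)"
  have m3: "fst m3 4 = s" "fst m3 5 = t" "fst m3 6 = v" "fst m3 7 = v'" "fst m3 8 = w1" "fst m3 9 = w2"
    "snd m3 = snd m" "fst m3 0 = n"
    using r m by (auto simp: m3_def m1_def v_def)
  \<comment> \<open>If \<open>nxt v t = t\<close>, the entry of table 12 for \<open>(t, v)\<close>
    is meaningless, but it then has no influence on the result.\<close>
  have tv': "snd m 11 t v = inner t v" "v' \<noteq> t \<Longrightarrow> snd m 12 t v = of_bool (facing t v)"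
  proof -
    show "snd m 11 t v = inner t v" using tv by (simp add: solved_def v_def)
    assume "v' \<noteq> t"
    then have "dst v t \<noteq> 1" using dst_eq_1[of v t] vn stn by (auto simp: v'_def)
    moreover have "dst v t \<noteq> 0" using dst_eq_0[of v t] vn stn vt by auto
    ultimately have "2 \<le> dst t v" using dst_sym[of v t] vn stn by auto
    then show "snd m 12 t v = of_bool (facing t v)" using tv by (simp add: solved_def v_def)
  qed
  \<comment> \<open>The sum may really be cut off, but then both it and its true value exceed every
    branch length.\<close>
  have cl: "min a (Suc n) < branch v w1 \<longleftrightarrow> a < branch v w1" for a
    using branch_less[OF vn, of w1] by auto
  have lv: "bv n leaves m3 \<longleftrightarrow> inner t v \<le> branch v w1 \<and> dst s t - 2 + branch v w2 < branch v w1"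
    using m m3 tv'(1) by (simp add: leaves_def cl not_less eval_nat_numeral)
  have "snd m' = snd (run n (Cnd leaves (Put 12 (R 4) (R 5) One)
       (Cnd (An (Ng (Eq (R 7) (R 5))) (Eq (T 12 (R 5) (R 6)) Zero))
         (Put 12 (R 4) (R 5) One) (Put 12 (R 4) (R 5) Zero))) m3) \<and>
     fst m' = fst m3"
    unfolding m'_def set_facing_def
    using w1(2) w2(2) m r by (simp add: m3_def m1_def v'_def v_def)
  then have m': "snd m' = (snd m)(12 := (snd m 12)(s := (snd m 12 s)(t := of_bool (bv n leaves m3 \<or> v' \<noteq> t \<and> snd m 12 t v = 0))))"
    "fst m' = fst m3"
    using m3 by auto
  have "bv n leaves m3 \<or> v' \<noteq> t \<and> snd m 12 t v = 0 \<longleftrightarrow> facing s t"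
    using facing_step[of w1 w2] best lv tv'(2) by (auto simp: v'_def)
  then show "snd m' = (snd m)(12 := (snd m 12)(s := (snd m 12 s)(t := of_bool (facing s t))))"
    using m' by simp
  show "branch v (fst m' 8) = side v {s, nxt v t}"
    using side_best[of v "{s, v'}" w1] best vV next_neq m' m3 by (simp add: v'_def)
  show "fst m' 4 = s \<and> fst m' 5 = t \<and> fst m' 6 = v \<and> fst m' 0 = n"
    using m' m3 by simp
qed

lemma run_set_pair:
  assumes p: "prepared m" and stn: "s < n" "t < n" "s \<noteq> t"
    and r: "fst m 4 = s" "fst m 5 = t"
    and tv: "2 \<le> dst s t \<Longrightarrow> solved m t (nxt s t)"
    and q: "q = set_inner_left \<and> (2 \<le> dst s t \<longrightarrow> solved m (nxt s t) t) \<or>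
      q = set_inner_right \<and> (2 \<le> dst s t \<longrightarrow> solved m s (nxt t s))"
  defines "m' \<equiv> run n (set_pair q) m"
  shows "solved m' s t" and "\<And>x y. (x, y) \<noteq> (s, t) \<Longrightarrow> solved m' x y = solved m x y"
proof -
  define v where "v = nxt s t"
  have vn: "v < n" using nxt_in[of s t] stn by (simp add: v_def)
  have m: "fst m 0 = n" "snd m 4 = nxt" "snd m 5 = dst" using p by (auto simp: prepared_def metric_def)
  have "(solved m' s t) \<and> (\<forall>x y. (x, y) \<noteq> (s, t) \<longrightarrow> solved m' x y = solved m x y)"
  proof (cases "v = t")
    case True
    have e: "{s, t} \<in> E" using edge_nxt[of s t] stn True by (simp add: v_def)
    have "snd m' = (snd m)(11 := (snd m 11)(s := (snd m 11 s)(t := 0)))"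
      using m r True by (simp add: m'_def set_pair_def v_def)
    then show ?thesis using inner_adjacent[OF e] dst_edge[OF e] by (auto simp: solved_def)
  next
    case False
    have "dst s t \<noteq> 1" "dst s t \<noteq> 0" using dst_eq_1[of s t] dst_eq_0[of s t] stn False by (auto simp: v_def)
    then have d: "2 \<le> dst s t" by linarith
    define y where "y = nxt t s"
    interpret far_pair "{0..<n}" E nxt dst s t v y
      using stn d by unfold_locales (auto simp: v_def y_def)
    define m1 where "m1 = setr 6 v m"
    have p1: "prepared m1" using p prepared_cong[of m m1] by (simp add: m1_def)
    have r1: "fst m1 4 = s" "fst m1 5 = t" "fst m1 6 = nxt s t" using r by (auto simp: m1_def v_def)
    have s1: "solved m1 x y = solved m x y" for x y by (simp add: solved_def m1_def)
    define m2 where "m2 = run n set_facing m1"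
    note f = run_set_facing[OF p1 stn(1,2) d r1, unfolded s1, OF tv[OF d], folded m2_def v_def]
    have m': "m' = run n q m2" using m r False by (simp add: m'_def set_pair_def m2_def m1_def v_def)
    have m2: "snd m2 6 = snd m 6" "snd m2 11 = snd m 11" "snd m2 4 = nxt" "snd m2 5 = dst"
      "\<And>i. i \<in> {7..10} \<Longrightarrow> snd m2 i = snd m i"
      using f(1) m by (auto simp: m1_def)
    have H: "snd m 6 u = branch u" "ranked m u" if "u < n" for u using p that by (auto simp: prepared_def)
    \<comment> \<open>No partial result exceeds the final value, so this bound makes all cut-offs in
      its computation vanish.\<close>
    have il: "inner s t < n" using inner_less[OF stn(1)] .
    have "snd m' = (snd m2)(11 := (snd m2 11)(s := (snd m2 11 s)(t := inner s t)))"
      using q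
    proof
      assume q: "q = set_inner_left \<and> (2 \<le> dst s t \<longrightarrow> solved m (nxt s t) t)"
      have "snd m 11 v t = inner v t" using q d by (auto simp: solved_def v_def)
      moreover have "x + (z - x) = max x z" for x z :: nat by auto
      moreover have "min (max (side v {s, nxt v t}) (inner v t)) (Suc n) = max (side v {s, nxt v t}) (inner v t)"
        "min (Suc (max (side v {s, nxt v t}) (inner v t))) (Suc n) = inner s t"
        using il inner_step_left by auto
      ultimately show ?thesis
        using m' q f(2,3) m2 H[OF vn] by (simp add: set_inner_left_def)
    next
      assume q: "q = set_inner_right \<and> (2 \<le> dst s t \<longrightarrow> solved m s (nxt t s))"
      then have sy: "snd m 11 s y = inner s y" using d by (auto simp: solved_def y_def)
      have yn: "y < n" using yV by simp
      define y' where "y' = nxt y s"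
      define m3 where "m3 = setr 11 y' (setr 10 y m2)"
      have rk: "ranked m3 y" using H(2)[OF yn] m2(5) by (simp add: ranked_def m3_def)
      obtain w where w: "choice y {t, y'} w" "run n (pick 9 (R 10) [R 5, R 11]) m3 = setr 9 w m3"
        using run_pick[OF rk yn, of "R 10" "{t, y'}" "[R 5, R 11]" 9] f(3) by (auto simp: m3_def)
      have "side y {t, y'} = branch y w"
        by (rule side_best[OF _ _ choice_best[OF yn w(1)]])
          (use yn yV far_pair.next_neq[OF flip] in \<open>auto simp: y'_def\<close>)
      then have i: "inner s t = max (inner s y) (dst s y + branch y w)"
        using inner_step_right by (simp add: y'_def)
      have "x + (z - x) = max x z" for x z :: nat by auto
      moreover have "min (dst s y + branch y w) (Suc n) = dst s y + branch y w" "min (inner s t) (Suc n) = inner s t"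
        using i il by auto
      ultimately have v: "ev n (Add (T 11 (R 4) (R 10))
         (Sub (Add (T 5 (R 4) (R 10)) (T 6 (R 10) (R 9))) (T 11 (R 4) (R 10)))) (setr 9 w m3) = inner s t"
        using f(3) m2 H(1)[OF yn] sy i by (simp add: m3_def)
      have "run n set_inner_right m2 = putt 11 s t (inner s t) (setr 9 w m3)"
        using f(3) m2 w(2) v by (simp add: set_inner_right_def m3_def y_def y'_def del: ev.simps(5,6))
      then show ?thesis using m' q by (simp add: m3_def)
    qed
    then have tab: "snd m' 11 = (snd m 11)(s := (snd m 11 s)(t := inner s t))"
      "snd m' 12 = (snd m 12)(s := (snd m 12 s)(t := of_bool (facing s t)))"
      using f(1) by (auto simp: m1_def)
    then show ?thesis by (auto simp: solved_def)
  qed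
  then show "solved m' s t" and "\<And>x y. (x, y) \<noteq> (s, t) \<Longrightarrow> solved m' x y = solved m x y" by auto
qed


lemma set_pair_frame:
  assumes "q = set_inner_left \<or> q = set_inner_right"
  shows "x \<in> {0, 2, 3} \<Longrightarrow> fst (run n (set_pair q) m) x = fst m x"
    and "a \<notin> {11, 12} \<Longrightarrow> snd (run n (set_pair q) m) a = snd m a"
    and "prepared (run n (set_pair q) m) = prepared m"
proof -
  show 1: "x \<in> {0, 2, 3} \<Longrightarrow> fst (run n (set_pair q) m) x = fst m x" for x
    by (rule run_frame_reg)
      (use assms in \<open>auto simp: set_pair_def set_facing_def set_inner_left_def set_inner_right_def\<close>)
  show 2: "a \<notin> {11, 12} \<Longrightarrow> snd (run n (set_pair q) m) a = snd m a" for a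
    by (rule run_frame_tab)
      (use assms in \<open>auto simp: set_pair_def set_facing_def set_inner_left_def set_inner_right_def\<close>)
  show "prepared (run n (set_pair q) m) = prepared m"
    by (rule prepared_cong) (auto simp: 1 2)
qed

lemma run_dynamic:
  fixes m :: mem
  defines "f \<equiv> snd m 3 0"
  assumes p: "prepared m" and inj: "inj_on f {..<n}" and fV: "f ` {..<n} \<subseteq> {0..<n}"
    and conv: "\<And>k i j. k \<le> n \<Longrightarrow> i < k \<Longrightarrow> j < k \<Longrightarrow> nxt (f i) (f j) \<in> f ` {..<k}"
  shows "prepared (run n dynamic m) \<and>
    (\<forall>i<n. \<forall>j<n. i \<noteq> j \<longrightarrow> solved (run n dynamic m) (f i) (f j))"
proof -
  have fn: "f i < n" if "i < n" for i using fV that by auto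
  have f_eq: "f i = f j \<longleftrightarrow> i = j" if "i < n" "j < n" for i j using inj that by (auto simp: inj_on_eq_iff)
  have solved_setr [simp]: "solved (setr x z m') s t = solved m' s t" for x z m' s t
    by (simp add: solved_def)
  have prep_setr: "prepared (setr x z m') = prepared m'" if "x \<noteq> 0" for x z m'
    by (rule prepared_cong) (use that in auto)
  define base where "base i m' \<longleftrightarrow> prepared m' \<and> snd m' 3 = snd m 3 \<and>
     (\<forall>j<i. \<forall>l<i. j \<noteq> l \<longrightarrow> solved m' (f j) (f l))" for i m'
  define row where "row i k m' \<longleftrightarrow> (\<forall>j<k. j < i \<longrightarrow> solved m' (f i) (f j))" for i k m'
  define column where "column i k m' \<longleftrightarrow> (\<forall>j<k. j < i \<longrightarrow> solved m' (f j) (f i))" for i k m'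
  have dist2: "dst (f i) (f j) \<ge> 2 \<Longrightarrow> nxt (f i) (f j) \<noteq> f j" if "i < n" "j < n" for i j
    using dst_eq_1[of "f i" "f j"] dst_eq_0[of "f i" "f j"] fn[OF that(1)] fn[OF that(2)] by fastforce
  \<comment> \<open>Prefixes of the order are closed under first steps, so a step that does not end
    at the newest vertex ends at an older one.\<close>
  have toward: "\<exists>l<i. nxt (f k) (f j) = f l"
    if "i < n" "k \<le> i" "j \<le> i" "k \<noteq> j" "nxt (f k) (f j) \<noteq> f i" for i k j
  proof -
    have "nxt (f k) (f j) \<in> f ` {..<Suc i}" using conv[of "Suc i" k j] that by auto
    then show ?thesis using that(5) by (auto simp: less_Suc_eq)
  qed
  have "base n (run n dynamic m)"
    unfolding dynamic_def
  proof (rule run_For[where I = base])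
    show "base 0 m" using p by (simp add: base_def)
  next
    fix i m' assume i: "i < n" and B: "base i m'"
    let ?L = "For 3 (Cnd (Lt (R 3) (R 2))
       (Sq (Set 4 (T 3 Zero (R 2))) (Sq (Set 5 (T 3 Zero (R 3))) (set_pair set_inner_left))) Nop)"
    let ?C = "For 3 (Cnd (Lt (R 3) (R 2))
       (Sq (Set 4 (T 3 Zero (R 3))) (Sq (Set 5 (T 3 Zero (R 2))) (set_pair set_inner_right))) Nop)"
    have L: "base i m' \<and> fst m' 2 = i \<and> row i n m'" if "m' = run n ?L (setr 2 i m'')" "base i m''" for m' m''
      unfolding that(1)
    proof (rule run_For[where I = "\<lambda>k m'. base i m' \<and> fst m' 2 = i \<and> row i k m'"])
      show "base i (setr 2 i m'') \<and> fst (setr 2 i m'') 2 = i \<and> row i 0 (setr 2 i m'')"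
        using that by (simp add: base_def row_def prep_setr)
      fix k m' assume k: "k < n" and I: "base i m' \<and> fst m' 2 = i \<and> row i k m'"
      show "base i (run n (Cnd (Lt (R 3) (R 2))
        (Sq (Set 4 (T 3 Zero (R 2))) (Sq (Set 5 (T 3 Zero (R 3))) (set_pair set_inner_left))) Nop) (setr 3 k m'))
        \<and> fst (run n (Cnd (Lt (R 3) (R 2))
        (Sq (Set 4 (T 3 Zero (R 2))) (Sq (Set 5 (T 3 Zero (R 3))) (set_pair set_inner_left))) Nop) (setr 3 k m')) 2 = i
        \<and> row i (Suc k) (run n (Cnd (Lt (R 3) (R 2))
        (Sq (Set 4 (T 3 Zero (R 2))) (Sq (Set 5 (T 3 Zero (R 3))) (set_pair set_inner_left))) Nop) (setr 3 k m'))"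
      proof (cases "k < i")
        case False
        then show ?thesis using I by (auto simp: base_def row_def prep_setr less_Suc_eq)
      next
        case True
        define m1 where "m1 = setr 5 (f k) (setr 4 (f i) (setr 3 k m'))"
        define m2 where "m2 = run n (set_pair set_inner_left) m1"
        have m1: "prepared m1" "fst m1 4 = f i" "fst m1 5 = f k" "snd m1 = snd m'" "fst m1 2 = i"
          using I by (auto simp: m1_def base_def prep_setr)
        have s1: "solved m1 x y = solved m' x y" for x y by (simp add: m1_def)
        have v: "\<exists>l<i. nxt (f i) (f k) = f l"
          by (rule toward) (use True i fn k nxt_eq_self[of "f i" "f k"] f_eq[of k i] in auto)
        \<comment> \<open>Both pairs consist of vertices older than \<open>f i\<close> and are
          covered by \<open>base\<close>.\<close>
        have d: "solved m1 (f k) (nxt (f i) (f k)) \<and> solved m1 (nxt (f i) (f k)) (f k)" if "2 \<le> dst (f i) (f k)"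
        proof -
          obtain l where l: "l < i" "nxt (f i) (f k) = f l" using v by blast
          then have "l \<noteq> k" using dist2[OF i k that] by auto
          then show ?thesis using l I True by (auto simp: base_def s1)
        qed
        note st = run_set_pair[OF m1(1) fn[OF i] fn[OF k], of set_inner_left, folded m2_def]
        have ne: "f i \<noteq> f k" using f_eq[OF i k] True by simp
        have new: "solved m2 (f i) (f k)" and old: "\<And>x y. (x, y) \<noteq> (f i, f k) \<Longrightarrow> solved m2 x y = solved m' x y"
          using st[OF ne m1(2,3)] d s1 by auto
        have "run n (Cnd (Lt (R 3) (R 2))
          (Sq (Set 4 (T 3 Zero (R 2))) (Sq (Set 5 (T 3 Zero (R 3))) (set_pair set_inner_left))) Nop) (setr 3 k m') = m2"
          using True I by (simp add: m2_def m1_def base_def f_def)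
        moreover have "prepared m2" "snd m2 3 = snd m 3" "fst m2 2 = i"
          using set_pair_frame[of set_inner_left] m1 I by (auto simp: m2_def base_def)
        moreover have "solved m2 (f j) (f l)" if "j < i" "l < i" "j \<noteq> l" for j l
          using old[of "f j" "f l"] that I f_eq[of j i] i by (auto simp: base_def)
        moreover have "solved m2 (f i) (f j)" if "j < Suc k" "j < i" for j
          using old[of "f i" "f j"] new that I f_eq[of j k] i k by (cases "j = k") (auto simp: row_def)
        ultimately show ?thesis by (simp add: base_def row_def)
      qed
    qed (auto simp: base_def row_def prep_setr)
    have C: "base i (run n ?C m') \<and> fst (run n ?C m') 2 = i \<and> row i n (run n ?C m') \<and> column i n (run n ?C m')"
      if "base i m'" "fst m' 2 = i" "row i n m'" for m'
    proof (rule run_For[where I = "\<lambda>k m'. base i m' \<and> fst m' 2 = i \<and> row i n m' \<and> column i k m'"])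
      show "base i m' \<and> fst m' 2 = i \<and> row i n m' \<and> column i 0 m'" using that by (simp add: column_def)
      fix k m' assume k: "k < n" and I: "base i m' \<and> fst m' 2 = i \<and> row i n m' \<and> column i k m'"
      let ?p = "Cnd (Lt (R 3) (R 2))
        (Sq (Set 4 (T 3 Zero (R 3))) (Sq (Set 5 (T 3 Zero (R 2))) (set_pair set_inner_right))) Nop"
      show "base i (run n ?p (setr 3 k m')) \<and> fst (run n ?p (setr 3 k m')) 2 = i \<and>
        row i n (run n ?p (setr 3 k m')) \<and> column i (Suc k) (run n ?p (setr 3 k m'))"
      proof (cases "k < i")
        case False
        then show ?thesis using I by (auto simp: base_def row_def column_def prep_setr less_Suc_eq)
      next
        case True
        define m1 where "m1 = setr 5 (f i) (setr 4 (f k) (setr 3 k m'))"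
        define m2 where "m2 = run n (set_pair set_inner_right) m1"
        have m1: "prepared m1" "fst m1 4 = f k" "fst m1 5 = f i" "snd m1 = snd m'" "fst m1 2 = i"
          using I by (auto simp: m1_def base_def prep_setr)
        have s1: "solved m1 x y = solved m' x y" for x y by (simp add: m1_def)
        have ne: "f k \<noteq> f i" using f_eq[OF k i] True by simp
        have dsym: "dst (f i) (f k) = dst (f k) (f i)" using dst_sym fn i k by simp
        \<comment> \<open>The first pair starts at \<open>f i\<close> and was treated in the row;
          the second consists of older vertices.\<close>
        have d: "solved m1 (f i) (nxt (f k) (f i)) \<and> solved m1 (f k) (nxt (f i) (f k))" if d2: "2 \<le> dst (f k) (f i)"
        proof
          have "\<exists>l<i. nxt (f k) (f i) = f l"
            by (rule toward) (use True i dist2[OF k i d2] in auto)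
          then show "solved m1 (f i) (nxt (f k) (f i))" using I i by (auto simp: row_def s1)
          have "\<exists>l<i. nxt (f i) (f k) = f l"
            by (rule toward) (use True i fn k nxt_eq_self[of "f i" "f k"] ne in auto)
          then obtain l where l: "l < i" "nxt (f i) (f k) = f l" by blast
          then have "l \<noteq> k" using dist2[OF i k] d2 dsym by auto
          then show "solved m1 (f k) (nxt (f i) (f k))" using l I True by (auto simp: base_def s1)
        qed
        note st = run_set_pair[OF m1(1) fn[OF k] fn[OF i] ne m1(2,3), of set_inner_right, folded m2_def]
        have new: "solved m2 (f k) (f i)" and old: "\<And>x y. (x, y) \<noteq> (f k, f i) \<Longrightarrow> solved m2 x y = solved m' x y"
          using st d s1 by auto
        have "run n ?p (setr 3 k m') = m2"
          using True I by (simp add: m2_def m1_def base_def f_def)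
        moreover have "prepared m2" "snd m2 3 = snd m 3" "fst m2 2 = i"
          using set_pair_frame[of set_inner_right] m1 I by (auto simp: m2_def base_def)
        moreover have "solved m2 (f j) (f l)" if "j < i" "l < i" "j \<noteq> l" for j l
          using old[of "f j" "f l"] that I f_eq[of l i] i by (auto simp: base_def)
        moreover have "solved m2 (f i) (f j)" if "j < n" "j < i" for j
          using old[of "f i" "f j"] that I ne by (auto simp: row_def)
        moreover have "solved m2 (f j) (f i)" if "j < Suc k" "j < i" for j
          using old[of "f j" "f i"] new that I f_eq[of j k] i k by (cases "j = k") (auto simp: column_def)
        ultimately show ?thesis by (simp add: base_def row_def column_def)
      qed
    qed (auto simp: base_def row_def column_def prep_setr)
    have "base (Suc i) m'" if "base i m'" "row i n m'" "column i n m'" for m'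
      using that i unfolding base_def row_def column_def by (auto simp: less_Suc_eq)
    then show "base (Suc i) (run n (Sq ?L ?C) (setr 2 i m'))"
      using C L[OF refl B] by simp
  qed (simp add: base_def prep_setr)
  then show ?thesis by (simp add: base_def)
qed

text \<open>The contribution of a single pair to \<open>refuted\<close>, covering both openings at
  \<open>s\<close>, as the double loop of \<open>flag\<close> meets it.\<close>

definition refutes :: "nat \<Rightarrow> nat \<Rightarrow> nat \<Rightarrow> nat \<Rightarrow> bool" where
  "refutes s t p q \<longleftrightarrow> 2 \<le> dst s t \<and>
    (p = s \<and> q = nxt s t \<and> \<not> (facing s t \<and> branch (nxt t s) t < inner s t) \<or>
     p = nxt s t \<and> q = s \<and> \<not> (branch (nxt t s) t < branch p q \<and> inner t s < branch p q))"

lemma refuted_iff: "{p, q} \<in> E \<Longrightarrow> refuted p q \<longleftrightarrow> (\<exists>(s, t)\<in>{..<n} \<times> {..<n}. refutes s t p q)"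
proof -
  assume "{p, q} \<in> E"
  then have pq: "p < n" "q < n" using edge by auto
  show ?thesis
  proof
    assume "refuted p q"
    then consider t where "t < n" "refutes p t p q" | t where "t < n" "refutes q t p q"
      by (auto simp: refuted_def refutes_def not_less)
    then show "\<exists>(s, t)\<in>{..<n} \<times> {..<n}. refutes s t p q"
      using pq by cases auto
  next
    assume "\<exists>(s, t)\<in>{..<n} \<times> {..<n}. refutes s t p q"
    then show "refuted p q" by (auto simp: refuted_def refutes_def not_less)
  qed
qed

lemma run_flag:
  assumes p: "prepared m" and solved: "\<And>s t. s < n \<Longrightarrow> t < n \<Longrightarrow> s \<noteq> t \<Longrightarrow> solved m s t"
    and zero: "\<And>p q. snd m 13 p q = 0"
  shows "\<And>p q. snd (run n flag m) 13 p q = of_bool (\<exists>(s, t)\<in>{..<n} \<times> {..<n}. refutes s t p q)"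
proof -
  define I where "I P m' \<longleftrightarrow> prepared m' \<and> snd m' 11 = snd m 11 \<and> snd m' 12 = snd m 12 \<and>
    (\<forall>p q. snd m' 13 p q = of_bool (\<exists>(s, t)\<in>P. refutes s t p q))" for P m'
  have prep_setr: "prepared (setr x z m') = prepared m'" if "x \<noteq> 0" for x z m'
    by (rule prepared_cong) (use that in auto)
  have prep_putt: "prepared (putt 13 x y z m') = prepared m'" for x y z m'
    by (rule prepared_cong) auto
  have "I ({..<n} \<times> {..<n}) (run n flag m)"
    unfolding flag_def
  proof (rule run_For_pairs[where I = I])
    show "I {} m" using p zero by (simp add: I_def)
    fix P s t m'
    assume st: "s < n" "t < n" and I: "I P m'" and r: "fst m' 2 = s" "fst m' 3 = t"
    have m': "snd m' 4 = nxt" "snd m' 5 = dst" and br: "\<And>v. v < n \<Longrightarrow> snd m' 6 v = branch v"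
      using I by (auto simp: I_def prepared_def metric_def)
    let ?p = "(Cnd (Lt One (T 5 (R 2) (R 3)))
     (Sq (Set 6 (T 4 (R 2) (R 3)))
     (Sq (Set 10 (T 4 (R 3) (R 2)))
     (Sq (Cnd (An (Eq (T 12 (R 2) (R 3)) One) (Lt (T 6 (R 10) (R 3)) (T 11 (R 2) (R 3))))
           Nop (Put 13 (R 2) (R 6) One))
       (Cnd (An (Lt (T 6 (R 10) (R 3)) (T 6 (R 6) (R 2))) (Lt (T 11 (R 3) (R 2)) (T 6 (R 6) (R 2))))
           Nop (Put 13 (R 6) (R 2) One)))))
     Nop)"
    show "I (insert (s, t) P) (run n ?p m')"
    proof (cases "2 \<le> dst s t")
      case False
      then show ?thesis using I r m' by (auto simp: I_def refutes_def)
    next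
      case True
      define v y where "v = nxt s t" and "y = nxt t s"
      have vy: "v < n" "y < n" "s \<noteq> t" using nxt_in[of s t] nxt_in[of t s] st True dst_self[of s]
        by (auto simp: v_def y_def)
      have tabs: "snd m' 11 s t = inner s t" "snd m' 11 t s = inner t s" "snd m' 12 s t = of_bool (facing s t)"
        using solved[OF st] solved[OF st(2,1)] vy True I by (auto simp: solved_def I_def)
      define A where "A \<longleftrightarrow> facing s t \<and> branch y t < inner s t"
      define B where "B \<longleftrightarrow> branch y t < branch v s \<and> inner t s < branch v s"
      define m1 where "m1 = setr 10 y (setr 6 v m')"
      define m2 where "m2 = (if A then m1 else putt 13 s v 1 m1)"
      define m3 where "m3 = (if B then m2 else putt 13 v s 1 m2)"
      have run: "run n ?p m' = m3"
        using True r m' br[OF vy(1)] br[OF vy(2)] tabs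
        by (simp add: m3_def m2_def m1_def A_def B_def flip: v_def y_def) blast
      have t13: "snd m3 13 p q = (if p = s \<and> q = v \<and> \<not> A \<or> p = v \<and> q = s \<and> \<not> B then 1 else snd m' 13 p q)" for p q
        by (simp add: m3_def m2_def m1_def)
      have ref: "refutes s t p q \<longleftrightarrow> p = s \<and> q = v \<and> \<not> A \<or> p = v \<and> q = s \<and> \<not> B" for p q
        using True by (auto simp: refutes_def A_def B_def v_def y_def)
      have "snd m3 13 p q = of_bool (\<exists>(s, t)\<in>insert (s, t) P. refutes s t p q)" for p q
      proof (cases "refutes s t p q")
        case True
        then show ?thesis unfolding t13 ref[symmetric] by simp
      next
        case False
        have "snd m' 13 p q = of_bool (\<exists>(s, t)\<in>P. refutes s t p q)" using I by (simp add: I_def)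
        then show ?thesis unfolding t13 ref[symmetric] if_not_P[OF False] using False by simp
      qed
      moreover have "prepared m3"
        using I by (simp add: m3_def m2_def m1_def prep_setr prep_putt I_def)
      moreover have "snd m3 11 = snd m 11" "snd m3 12 = snd m 12"
        using I by (auto simp: m3_def m2_def m1_def I_def)
      ultimately show ?thesis unfolding run by (simp add: I_def)
    qed
  qed (auto simp: I_def prep_setr)
  then show "\<And>p q. snd (run n flag m) 13 p q = of_bool (\<exists>(s, t)\<in>{..<n} \<times> {..<n}. refutes s t p q)"
    by (simp add: I_def)
qed

lemma run_answer:
  assumes "snd m 5 = dst" and bad: "\<And>p q. snd m 13 p q = of_bool (\<exists>(s, t)\<in>{..<n} \<times> {..<n}. refutes s t p q)"
    and "0 < n"
  shows "fst (run n answer m) 12 = (if P1_win E then 1 else 2)"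
proof -
  define good where "good p q \<longleftrightarrow> dst p q = 1 \<and> snd m 13 p q = 0" for p q
  define I where "I P m' \<longleftrightarrow> snd m' = snd m \<and> fst m' 12 = (if \<exists>(p, q)\<in>P. good p q then 1 else 2)" for P and m' :: mem
  have "I ({..<n} \<times> {..<n}) (run n answer m)"
    unfolding answer_def run.simps(4)
  proof (rule run_For_pairs[where I = I])
    show "I {} (run n (Set 12 (Add One One)) m)" using assms(3) by (simp add: I_def)
    fix P i j m'
    assume "i < n" "j < n" "I P m'" "fst m' 2 = i" "fst m' 3 = j"
    then show "I (insert (i, j) P) (run n (Cnd (An (Eq (T 5 (R 2) (R 3)) One) (Eq (T 13 (R 2) (R 3)) Zero)) (Set 12 One) Nop) m')"
      using assms(1) by (auto simp: I_def good_def)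
  qed (auto simp: I_def)
  moreover have "(\<exists>(p, q)\<in>{..<n} \<times> {..<n}. good p q) \<longleftrightarrow> (\<exists>p q. {p, q} \<in> E \<and> \<not> refuted p q)"
  proof -
    \<comment> \<open>Distance 1 recognises the edges, so no adjacency table is needed.\<close>
    have "p < n \<and> q < n \<and> good p q \<longleftrightarrow> {p, q} \<in> E \<and> \<not> refuted p q" for p q
    proof (cases "{p, q} \<in> E")
      case True
      then show ?thesis using edge[OF True] dst_edge[OF True] refuted_iff[OF True] bad by (auto simp: good_def)
    next
      case False
      then show ?thesis using dst_eq_1[of p q] edge_nxt[of p q] by (auto simp: good_def)
    qed
    then show ?thesis by (simp add: Bex_def)
  qed
  ultimately show ?thesis by (simp add: I_def P1_win_iff_refuted)
qed

end

section \<open>The complete algorithm\<close>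

lemma run_solve:
  assumes tree: "tree {0..<n} E" and es: "edge_list es E" "holds_input es m" "length es \<le> n"
    and r: "fst m 0 = n" and zero: "\<And>a i j. 2 \<le> a \<Longrightarrow> snd m a i j = 0"
  shows "fst (run n solve m) 12 = (if P1_win E then 1 else 2)"
proof -
  define m1 where "m1 = run n grow m"
  define m2 where "m2 = run n heights m1"
  define m3 where "m3 = run n tops m2"
  define m4 where "m4 = run n dynamic m3"
  define m5 where "m5 = run n flag m4"
  define f where "f = snd m1 3 0"
  have g: "grown n E n m1" unfolding m1_def by (rule run_grow[OF tree es zero])
  then have inj: "inj_on f {..<n}" and fV: "f ` {..<n} \<subseteq> {0..<n}"
    by (simp_all add: grown_def f_def Let_def)
  \<comment> \<open>The order lists \<open>n\<close> distinct vertices and therefore all of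
    them.\<close>
  have S: "f ` {..<n} = {0..<n}"
    by (rule card_subset_eq) (use inj fV card_image[OF inj] in auto)
  have "routed_tree {0..<n} E (snd m1 4) (snd m1 5)"
    and conv: "\<And>k i j. k \<le> n \<Longrightarrow> i < k \<Longrightarrow> j < k \<Longrightarrow> snd m1 4 (f i) (f j) \<in> f ` {..<k}"
    using g S tree_sub_edges_all[OF tree] by (simp_all add: grown_def Let_def flip: f_def)
  then interpret numbered_tree n E "snd m1 4" "snd m1 5" by (simp add: numbered_tree_def)
  have n: "0 < n" using tree by (auto simp: tree_def connected_graph_def)
  have w: "0 \<notin> wr grow" "0 \<notin> wr heights" "0 \<notin> wr tops" "wt grow = {2, 3, 4, 5}" "wt heights = {6}"
    "wt tops = {7, 8, 9, 10}" "wt dynamic = {11, 12}" "wt flag = {13}"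
    by (auto simp: grow_def scan_def attach_def mark_def heights_def tops_def select_def
      dynamic_def set_pair_def set_facing_def set_inner_left_def set_inner_right_def flag_def)
  have r1: "fst m1 0 = n" "fst m2 0 = n" "fst m3 0 = n"
    using r w by (simp_all add: m1_def m2_def m3_def run_frame_reg)
  have "snd m1 6 v w = 0" for v w using w zero by (simp add: m1_def run_frame_tab)
  then have h: "\<forall>v<n. snd m2 6 v = branch v"
    unfolding m2_def by (intro run_heights) (simp_all add: metric_def r1)
  have t2: "snd m2 a = snd m1 a" if "a \<noteq> 6" for a using w that by (simp add: m2_def run_frame_tab)
  have t3: "snd m3 a = snd m2 a" if "a < 7 \<or> 10 < a" for a
    unfolding m3_def by (rule run_frame_tab) (use w that in auto)
  have "\<forall>v<n. ranked m3 v" unfolding m3_def by (rule run_tops[OF r1(2) h])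
  then have p3: "prepared m3" using h r1 t2 t3 by (simp add: prepared_def metric_def)
  have f3: "snd m3 3 0 = f" using t2 t3 by (simp add: f_def)
  note dyn = run_dynamic[OF p3, unfolded f3, OF inj fV conv, folded m4_def]
  have "solved m4 s t" if "s < n" "t < n" "s \<noteq> t" for s t
  proof -
    have "s \<in> f ` {..<n}" "t \<in> f ` {..<n}" using S that by auto
    then show ?thesis using dyn that by auto
  qed
  moreover have "snd m4 13 p q = 0" for p q
    using w zero t2 t3 by (simp add: m4_def m1_def run_frame_tab)
  ultimately have "snd m5 13 p q = of_bool (\<exists>(s, t)\<in>{..<n} \<times> {..<n}. refutes s t p q)" for p q
    unfolding m5_def by (intro run_flag) (use dyn in auto)
  moreover have "snd m5 5 = snd m1 5" using w t2 t3 by (simp add: m5_def m4_def run_frame_tab)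
  ultimately have "fst (run n answer m5) 12 = (if P1_win E then 1 else 2)"
    using n by (intro run_answer)
  then show ?thesis by (simp add: solve_def m5_def m4_def m3_def m2_def m1_def)
qed

lemma solve_wellf: "wellf solve"
  by (simp add: solve_def grow_def scan_def attach_def mark_def heights_def tops_def select_def
      dynamic_def set_pair_def set_facing_def set_inner_left_def set_inner_right_def flag_def answer_def)

lemma solve_depth: "depth solve \<le> 2"
  by (simp add: solve_def grow_def scan_def attach_def mark_def heights_def tops_def select_def
      dynamic_def set_pair_def set_facing_def set_inner_left_def set_inner_right_def flag_def answer_def)

theorem theorem4p6:
  shows "\<exists>(c :: com) (k :: nat) (time :: nat \<Rightarrow> nat).
    (\<lambda>n. real (time n)) \<in> O(\<lambda>n. real n ^ 2) \<and>
    (\<forall>(n :: nat) (E :: nat set set) (es :: (nat \<times> nat) list).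
       tree {0..<n} E \<and> edge_list es E \<longrightarrow>
       (\<exists>t s. exec ((n + 2) ^ k) c (input_state n es) t s \<and> t \<le> time n \<and>
          (P1_win E \<and> reg s 0 = 1 \<or> P2_win E \<and> reg s 0 = 2)))"
proof -
  obtain C where C: "\<And>n. cost n solve \<le> C * (n + 1) ^ 2" using cost_bound[OF solve_depth] by auto
  \<comment> \<open>The answer may enter register 0 only at the end, since \<open>n\<close> is kept
    there throughout \<open>solve\<close>; this last assignment costs the 2.\<close>
  define time where "time n = C * (n + 1) ^ 2 + 2" for n
  let ?c = "Seq (cp solve) (Assign 0 (Reg 12))"
  have "(\<lambda>n. real (time n)) \<in> O(\<lambda>n. real n ^ 2)"
  proof (rule bigoI)
    show "\<forall>\<^sub>F n in sequentially. norm (real (time n)) \<le> real (4 * C + 2) * norm (real n ^ 2)"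
    proof (rule eventually_sequentiallyI[of 1])
      fix n :: nat assume "1 \<le> n"
      have "(n + 1) ^ 2 \<le> (2 * n) ^ 2" by (rule power_mono) (use \<open>1 \<le> n\<close> in auto)
      then have "C * (n + 1) ^ 2 \<le> C * (2 * n) ^ 2" by (rule mult_le_mono2)
      moreover have "C * (2 * n) ^ 2 = 4 * C * n ^ 2" by (simp add: power_mult_distrib)
      moreover have "1 \<le> n ^ 2" using \<open>1 \<le> n\<close> by simp
      ultimately have "time n \<le> (4 * C + 2) * n ^ 2"
        unfolding time_def add_mult_distrib by linarith
      then have "real (time n) \<le> real ((4 * C + 2) * n ^ 2)" by (rule of_nat_mono)
      then show "norm (real (time n)) \<le> real (4 * C + 2) * norm (real n ^ 2)" by (simp add: algebra_simps)
    qed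
  qed
  \<comment> \<open>Words up to \<open>(n + 2) ^ 2\<close> hold every table index, so the exponent 2
    suffices for the word size.\<close>
  moreover have "\<exists>t s. exec ((n + 2) ^ 2) ?c (input_state n es) t s \<and> t \<le> time n \<and>
      (P1_win E \<and> reg s 0 = 1 \<or> P2_win E \<and> reg s 0 = 2)"
    if tree: "tree {0..<n} E" and es: "edge_list es E" for n E es
  proof -
    let ?s = "input_state n es"
    \<comment> \<open>The input arrays are cut into rows of length \<open>n + 2\<close>; with fewer
      than \<open>n\<close> edges, all of the input lies in row 0.\<close>
    define m :: mem where "m = (reg ?s, \<lambda>a i j. arr ?s a (i * (n + 2) + j))"
    have "card E = length es"
      using es distinct_card[of "map edge_of es"] by (simp add: edge_list_def)
    then have len: "Suc (length es) = n" using tree_card_edges[OF tree] by simp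
    have bound: "fst (es ! i) < n \<and> snd (es ! i) < n" if "i < length es" for i
    proof -
      have "edge_of (es ! i) \<in> E" using es that by (auto simp: edge_list_def)
      then have "edge_of (es ! i) \<subseteq> {0..<n}" using tree by (auto simp: tree_def simple_graph_def)
      then show ?thesis by (cases "es ! i") auto
    qed
    have "arr ?s a i \<le> n" for a i
      using bound[of i] by (auto simp: input_state_def)
    then have "repr n m ?s"
      using len by (auto simp: repr_def m_def input_state_def le_Suc_eq)
    from cp_correct[OF solve_wellf this order_refl] obtain t s where
      1: "exec ((n + 2) ^ 2) (cp solve) ?s t s" "t \<le> cost n solve" "repr n (run n solve m) s" by auto
    have "fst (run n solve m) 12 = (if P1_win E then 1 else 2)"
      by (rule run_solve[OF tree es]) (use len in \<open>auto simp: m_def holds_input_def input_state_def\<close>)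
    then have s: "reg s 12 = (if P1_win E then 1 else 2)" using 1(3) by (simp add: repr_def)
    have "2 \<le> (n + 2) ^ 2" by (simp add: power2_eq_square)
    then have "exec ((n + 2) ^ 2) (Assign 0 (Reg 12)) s 2 (s\<lparr>reg := (reg s)(0 := reg s 12)\<rparr>)"
      using exec_Assign[of "(n + 2) ^ 2" "Reg 12" s 0] s by (simp add: eval_nat_numeral)
    from exec_Seq[OF 1(1) this] show ?thesis
      using 1(2) C[of n] s by (intro exI conjI) (auto simp: time_def P2_win_def split: if_splits)
  qed
  ultimately show ?thesis by blast
qed

end
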